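(* Let $\Gamma$ be a tropical curve. Then the following are equivalent: (1) there exists a model $(G,l)$ for $\Gamma$ such that $l(E(G))=\{\infty\}$; and (2) $\operatorname{Aut}_{\boldsymbol{T}}(\operatorname{Rat}(\Gamma))\neq\operatorname{Aut}_{\mathrm{semiring}}(\operatorname{Rat}(\Gamma))$.
   Context: **Semirings.** A semiring is a commutative semiring with absorbing additive neutral element, multiplicative identity, and these two distinct. A semifield is a semiring in which every element other than the additive neutral element is multiplicatively invertible. A semiring homomorphism preserves addition, multiplication, the additive neutral element and the multiplicative identity. The tropical semifield is $\boldsymbol{T} := (\mathbb{R} \cup \{-\infty\}, \oplus = \max, \odot = +)$ (additive neutral element $-\infty$, multiplicative identity the real number $0$). **Tropical curves.** A graph is an unweighted, undirected, finite, connected nonempty multigraph, possibly with loops. A leaf end is a vertex of valence one (loops count twice); a leaf edge is an edge incident to a leaf end. An edge-weighted graph $(G,l)$ is a graph $G$ with a function $l : E(G) \to \mathbb{R}_{>0} \cup \{\infty\}$ on its set of edges $E(G)$ that takes the value $\infty$ only on leaf edges. A tropical curve $\Gamma$ is the underlying topological space of some $(G,l)$ together with an identification of each edge $e$ with $[0,l(e)]$, where $[0,\infty]$ is the one-point compactification of $[0,\infty)$; if $l(e)=\infty$, the leaf end of $e$ is identified with $\infty$ (if $E(G)=\{e\}$ and $l(e)=\infty$, either leaf end may be chosen). Such $(G,l)$ is called a model for $\Gamma$. Points identified with $\infty$ are points at infinity; other points are finite points. **Rational functions.** A rational function on $\Gamma$ is either the constant function $-\infty$ or a continuous map $f:\Gamma\to\mathbb{R}\cup\{\pm\infty\}$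 that is piecewise affine with integer slopes and finitely many pieces and takes values $\pm\infty$ only at points at infinity. $\operatorname{Rat}(\Gamma)$ is the set of these; with $(f\oplus g)(x)=\max\{f(x),g(x)\}$ and $(f\odot g)(x)=f(x)+g(x)$ at finite points, extended continuously to points at infinity (and $f\oplus(-\infty)=f$, $f\odot(-\infty)=-\infty$), it is a semifield, and a $\boldsymbol{T}$-algebra via the inclusion of constants $\boldsymbol{T}\hookrightarrow\operatorname{Rat}(\Gamma)$. $\operatorname{Aut}_{\mathrm{semiring}}(\operatorname{Rat}(\Gamma))$ is the group of bijective semiring homomorphisms $\operatorname{Rat}(\Gamma)\to\operatorname{Rat}(\Gamma)$, and $\operatorname{Aut}_{\boldsymbol{T}}(\operatorname{Rat}(\Gamma))$ is the subgroup of those fixing every constant $t\in\boldsymbol{T}$ (the $\boldsymbol{T}$-algebra automorphisms).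
   Formalization: The tropical curve Γ is assumed to have more than one point; for a one-point Γ the equivalence fails, since Rat(Γ)=T has the automorphism t↦2t so (2) holds, while every model has no edges, so l(E(G)) is empty and (1) fails. *)

theory Defs
  imports "HOL-Analysis.Analysis" "HOL-Algebra.Ring"
begin

section \<open>Edge-weighted graphs\<close>

text \<open>
  An edge has the set of its one or two end vertices attached to it; it is a loop if this set is a
  singleton. Distinct edges may have the same ends.
\<close>

record ('v, 'e) mgraph =
  verts :: "'v set"
  edges :: "'e set"
  ends :: "'e \<Rightarrow> 'v set"

definition connected_mgraph :: "('v, 'e) mgraph \<Rightarrow> bool" where
  "connected_mgraph G \<longleftrightarrow>
     (\<forall>u \<in> verts G. \<forall>v \<in> verts G. (u, v) \<in> {(x, y). \<exists>e \<in> edges G. ends G e = {x, y}}\<^sup>*)"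

definition graph :: "('v, 'e) mgraph \<Rightarrow> bool" where
  "graph G \<longleftrightarrow> finite (verts G) \<and> finite (edges G) \<and> verts G \<noteq> {} \<and>
     (\<forall>e \<in> edges G. \<exists>u \<in> verts G. \<exists>v \<in> verts G. ends G e = {u, v}) \<and>
     connected_mgraph G"

text \<open>Loops count twice.\<close>

definition valence :: "('v, 'e) mgraph \<Rightarrow> 'v \<Rightarrow> nat" where
  "valence G v = card {e \<in> edges G. v \<in> ends G e} + card {e \<in> edges G. ends G e = {v}}"

definition leaf_end :: "('v, 'e) mgraph \<Rightarrow> 'v \<Rightarrow> bool" where
  "leaf_end G v \<longleftrightarrow> v \<in> verts G \<and> valence G v = 1"

definition leaf_edge :: "('v, 'e) mgraph \<Rightarrow> 'e \<Rightarrow> bool" where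
  "leaf_edge G e \<longleftrightarrow> e \<in> edges G \<and> (\<exists>v \<in> ends G e. leaf_end G v)"

definition edge_weighted_graph :: "('v, 'e) mgraph \<Rightarrow> ('e \<Rightarrow> ereal) \<Rightarrow> bool" where
  "edge_weighted_graph G l \<longleftrightarrow> graph G \<and>
     (\<forall>e \<in> edges G. 0 < l e \<and> (l e = \<infinity> \<longrightarrow> leaf_edge G e))"

section \<open>Tropical curves and their models\<close>

text \<open>
  The points of a tropical curve are the elements of a topological type \<open>'p\<close>, and the vertices of
  its models are points of it. Since a model has only finitely many edges, natural numbers suffice
  to name them.

  \<open>identification G l \<iota>\<close> says that \<open>'p\<close> is the underlying topological space of \<open>(G, l)\<close>, where
  \<open>\<iota> e\<close> maps \<open>[0, l e]\<close> onto the edge \<open>e\<close>: the only points identified with each other are end points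
  of edges that are the same vertex of \<open>G\<close>, and the topology is the quotient topology. The subspace
  \<open>[0, \<infinity>]\<close> of the extended reals is the one-point compactification of \<open>[0, \<infinity>)\<close>.
\<close>

definition identification ::
  "('p::topological_space, nat) mgraph \<Rightarrow> (nat \<Rightarrow> ereal) \<Rightarrow> (nat \<Rightarrow> ereal \<Rightarrow> 'p) \<Rightarrow> bool" where
  "identification G l \<iota> \<longleftrightarrow>
     (\<forall>e \<in> edges G. ends G e = {\<iota> e 0, \<iota> e (l e)} \<and> (l e = \<infinity> \<longrightarrow> leaf_end G (\<iota> e \<infinity>))) \<and>
     inj_on (\<lambda>(e, t). \<iota> e t) (SIGMA e:edges G. {0<..<l e}) \<and>
     (\<forall>e \<in> edges G. \<forall>t \<in> {0<..<l e}. \<iota> e t \<notin> verts G) \<and>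
     (UNIV :: 'p set) = verts G \<union> (\<Union>e \<in> edges G. \<iota> e ` {0..l e}) \<and>
     (\<forall>U. open U \<longleftrightarrow>
        (\<forall>e \<in> edges G. openin (top_of_set {0..l e}) {t \<in> {0..l e}. \<iota> e t \<in> U}))"

text \<open>
  \<open>walk G l \<iota> x r y\<close>: one gets from \<open>x\<close> to \<open>y\<close> in finitely many steps of total length \<open>r\<close>, each
  step moving along a single edge.
\<close>

inductive walk ::
  "('p, nat) mgraph \<Rightarrow> (nat \<Rightarrow> ereal) \<Rightarrow> (nat \<Rightarrow> ereal \<Rightarrow> 'p) \<Rightarrow> 'p \<Rightarrow> ereal \<Rightarrow> 'p \<Rightarrow> bool"
  for G l \<iota> x where
  refl: "walk G l \<iota> x 0 x"
| step: "\<lbrakk>walk G l \<iota> x r y; e \<in> edges G; s \<in> {0..l e}; t \<in> {0..l e}; y = \<iota> e s\<rbrakk>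
    \<Longrightarrow> walk G l \<iota> x (r + \<bar>t - s\<bar>) (\<iota> e t)"

text \<open>The distance from a point at infinity to any other point is \<open>\<infinity>\<close>.\<close>

definition path_dist ::
  "('p, nat) mgraph \<Rightarrow> (nat \<Rightarrow> ereal) \<Rightarrow> (nat \<Rightarrow> ereal \<Rightarrow> 'p) \<Rightarrow> 'p \<Rightarrow> 'p \<Rightarrow> ereal" where
  "path_dist G l \<iota> x y = Inf {r. walk G l \<iota> x r y}"

text \<open>
  One tropical curve has many models (an edge can be subdivided, for instance). What they share is
  the topological space together with the lengths on it. Hence a tropical curve is represented by
  the path distance \<open>\<Gamma>\<close> on its point type, and the models of \<open>\<Gamma>\<close> are those edge-weighted graphs
  that have an identification with the space inducing that distance.
\<close>

type_synonym 'p curve = "'p \<Rightarrow> 'p \<Rightarrow> ereal"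

definition model_via ::
  "'p::topological_space curve \<Rightarrow> ('p, nat) mgraph \<Rightarrow> (nat \<Rightarrow> ereal) \<Rightarrow> (nat \<Rightarrow> ereal \<Rightarrow> 'p) \<Rightarrow> bool"
  where
  "model_via \<Gamma> G l \<iota> \<longleftrightarrow>
     edge_weighted_graph G l \<and> identification G l \<iota> \<and> \<Gamma> = path_dist G l \<iota>"

definition model ::
  "'p::topological_space curve \<Rightarrow> ('p, nat) mgraph \<Rightarrow> (nat \<Rightarrow> ereal) \<Rightarrow> bool" where
  "model \<Gamma> G l \<longleftrightarrow> (\<exists>\<iota>. model_via \<Gamma> G l \<iota>)"

definition tropical_curve :: "'p::topological_space curve \<Rightarrow> bool" where
  "tropical_curve \<Gamma> \<longleftrightarrow> (\<exists>G l. model \<Gamma> G l)"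

definition points_at_infinity :: "'p::topological_space curve \<Rightarrow> 'p set" where
  "points_at_infinity \<Gamma> = {x. \<exists>G l \<iota>. model_via \<Gamma> G l \<iota> \<and> (\<exists>e \<in> edges G. l e = \<infinity> \<and> x = \<iota> e \<infinity>)}"

definition finite_points :: "'p::topological_space curve \<Rightarrow> 'p set" where
  "finite_points \<Gamma> = - points_at_infinity \<Gamma>"

section \<open>Rational functions\<close>

text \<open>
  \<open>S\<close> is the set of break points. Nothing is demanded of \<open>g\<close> at the break points, nor at the end
  points of the interval: this predicate is only used together with continuity.
\<close>

definition piecewise_affine_int :: "ereal \<Rightarrow> (ereal \<Rightarrow> ereal) \<Rightarrow> bool" where
  "piecewise_affine_int L g \<longleftrightarrow>
     (\<exists>S :: real set. finite S \<and>
       (\<forall>a b. 0 \<le> a \<and> a < b \<and> ereal b \<le> L \<and> {a<..<b} \<inter> S = {} \<longrightarrow>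
         (\<exists>(k::int) (c::real). \<forall>t \<in> {a<..<b}. g (ereal t) = ereal (of_int k * t + c))))"

definition Rat :: "'p::topological_space curve \<Rightarrow> ('p \<Rightarrow> ereal) set" where
  "Rat \<Gamma> = insert (\<lambda>_. - \<infinity>)
     {f. continuous_on UNIV f \<and>
         (\<exists>G l \<iota>. model_via \<Gamma> G l \<iota> \<and> (\<forall>e \<in> edges G. piecewise_affine_int (l e) (f \<circ> \<iota> e))) \<and>
         (\<forall>x. \<bar>f x\<bar> = \<infinity> \<longrightarrow> x \<in> points_at_infinity \<Gamma>)}"

text \<open>
  At a point at infinity the sum of the values can be the meaningless \<open>\<infinity> - \<infinity>\<close>; there the
  value of \<open>f \<odot> g\<close> is the limit of \<open>f + g\<close> along the finite points.
\<close>

definition rat_mult ::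
  "'p::topological_space curve \<Rightarrow> ('p \<Rightarrow> ereal) \<Rightarrow> ('p \<Rightarrow> ereal) \<Rightarrow> 'p \<Rightarrow> ereal" where
  "rat_mult \<Gamma> f g =
     (if f = (\<lambda>_. - \<infinity>) \<or> g = (\<lambda>_. - \<infinity>) then (\<lambda>_. - \<infinity>)
      else (\<lambda>x. if x \<in> finite_points \<Gamma> then f x + g x
                else Lim (at x within finite_points \<Gamma>) (\<lambda>y. f y + g y)))"

text \<open>
  For the addition the pointwise maximum is already the continuous extension, because the maximum
  is continuous on the extended reals.
\<close>

definition Rat_semifield :: "'p::topological_space curve \<Rightarrow> ('p \<Rightarrow> ereal) ring" where
  "Rat_semifield \<Gamma> =
     \<lparr>carrier = Rat \<Gamma>, mult = rat_mult \<Gamma>, one = (\<lambda>_. 0),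
      zero = (\<lambda>_. - \<infinity>), add = (\<lambda>f g x. max (f x) (g x))\<rparr>"

section \<open>Automorphisms\<close>

text \<open>
  \<open>ring_hom\<close> requires compatibility with sum, product and one, but not with zero. Automorphisms are
  made \<open>extensional\<close> so that each is represented by exactly one function.
\<close>

definition Aut_semiring :: "('a, 'm) ring_scheme \<Rightarrow> ('a \<Rightarrow> 'a) set" where
  "Aut_semiring R =
     {\<psi> \<in> ring_hom R R. \<psi> \<zero>\<^bsub>R\<^esub> = \<zero>\<^bsub>R\<^esub> \<and> bij_betw \<psi> (carrier R) (carrier R) \<and>
        \<psi> \<in> extensional (carrier R)}"

text \<open>The elements of the tropical semifield are the extended reals other than \<open>\<infinity>\<close>.\<close>

definition Aut_T :: "'p::topological_space curve \<Rightarrow> (('p \<Rightarrow> ereal) \<Rightarrow> ('p \<Rightarrow> ereal)) set" where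
  "Aut_T \<Gamma> = {\<psi> \<in> Aut_semiring (Rat_semifield \<Gamma>). \<forall>t::ereal. t \<noteq> \<infinity> \<longrightarrow> \<psi> (\<lambda>_. t) = (\<lambda>_. t)}"

end

theory Submission
  imports Defs
begin

text \<open>
  A semiring automorphism \<open>\<psi>\<close> respects the order given by \<open>f \<le> g \<longleftrightarrow> f \<oplus> g = g\<close>. It also maps real
  constants to real constants: since slopes are integers, a function is constant if it has an
  \<open>n\<close>-th root for every \<open>n\<close> (\<open>cval_slope\<close>, \<open>\<psi>_cst\<close>). On constants \<open>\<psi>\<close> is therefore a monotone additive
  map of the reals, that is, multiplication by some \<open>c > 0\<close>, and \<open>\<psi>\<close> is a \<open>T\<close>-algebra automorphism if
  and only if \<open>c = 1\<close>. The theorem says which curves admit some \<open>c \<noteq> 1\<close>.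

  If all edges are infinite, they are rays with a common start, because every one of them is a leaf
  edge. Stretching all rays by a factor \<open>c\<close> and dividing all values by \<open>c\<close> leaves the slopes as they
  are, so this is an automorphism that moves constants (\<open>rescale_automorphism\<close>).

  Conversely, let \<open>\<psi>\<close> multiply constants by \<open>c \<noteq> 1\<close>. On the real-valued rational functions, \<open>\<psi> / c\<close>
  is a homomorphism of lattice-ordered groups that fixes all constants. By compactness of the curve it
  is composition with a map \<open>\<phi>\<close> (\<open>\<phi>_exists\<close>), which is a homeomorphism. Having slopes \<open>-1\<close>, \<open>0\<close>, \<open>1\<close>
  only is a property that \<open>\<psi>\<close> preserves, because slopes divisible by \<open>k\<close> mean being locally a
  \<open>k\<close>-th power (\<open>\<Psi>_slope\<close>). Applied to functions of the form \<open>max 0 (r - dist x)\<close>, this shows that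
  \<open>\<phi>\<close> divides all distances by \<open>c\<close> (\<open>\<phi>_scales\<close>). Hence \<open>\<phi>\<close> carries every model of the curve to a
  model of the same curve with all lengths divided by \<open>c\<close> (\<open>push_model\<close>).

  Take a model with as few edges as possible, and its image. What remains of the curve when the open
  infinite edges are removed, the core, is the same for both (\<open>core_subset\<close>): otherwise a vertex of one
  of the two models would lie inside an infinite edge of the other. Since spheres of small radius do
  not depend on the model, that vertex would have valence two, and its two edges could be merged into
  one (\<open>merge_at_vertex\<close>), unless both are infinite and the curve consists of these two. So \<open>\<phi>\<close> maps
  the core onto itself and divides its diameter by \<open>c\<close>. The diameter is finite, hence zero, and
  therefore no edge is finite (\<open>minimal_model_star\<close>).

  The notions of the statement that refer to some model have to be computed in a fixed one. Points at
  infinity are those at distance \<open>\<infinity>\<close> from all other points. For rational functions, the point is that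
  two models differ, away from finitely many points, by maps of the form \<open>t \<mapsto> \<plusminus>t + d\<close>
  (\<open>transition\<close>).
\<close>

section \<open>Path distance\<close>

lemma ereal_abs_diff_commute: "\<bar>a - b\<bar> = \<bar>b - a\<bar>" for a b :: ereal
  by (cases a; cases b) auto

lemma ereal_Inf_add_ge:
  fixes A B :: "ereal set"
  assumes "\<And>r s. r \<in> A \<Longrightarrow> s \<in> B \<Longrightarrow> c \<le> r + s" "\<And>r. r \<in> A \<Longrightarrow> 0 \<le> r" "\<And>r. r \<in> B \<Longrightarrow> 0 \<le> r"
  shows "c \<le> Inf A + Inf B"
proof -
  have B0: "0 \<le> Inf B" and A0: "0 \<le> Inf A" using assms by (auto intro: Inf_greatest)
  have 1: "c \<le> r + Inf B" if "r \<in> A" for r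
  proof (cases "r = \<infinity>")
    case False
    moreover have "0 \<le> r" using assms(2) that by blast
    ultimately obtain r' where r': "r = ereal r'" by (cases r) auto
    have "c - r \<le> Inf B"
      using assms(1)[OF that] r'
      by (intro Inf_greatest) (simp add: ereal_minus_le_iff add.commute)
    then show ?thesis using r' by (simp add: ereal_minus_le_iff add.commute)
  qed (use B0 in auto)
  show ?thesis
  proof (cases "Inf B = \<infinity>")
    case False
    then obtain r' where r': "Inf B = ereal r'" using B0 by (cases "Inf B") auto
    have "c - Inf B \<le> Inf A"
      using 1 r' by (intro Inf_greatest) (simp add: ereal_minus_le_iff add.commute)
    then show ?thesis using r' by (simp add: ereal_minus_le_iff add.commute)
  qed (use A0 in auto)
qed

lemma walk_nonneg: "walk G l \<iota> x r y \<Longrightarrow> 0 \<le> r"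
  by (induction rule: walk.induct) auto

lemma walk_trans:
  assumes "walk G l \<iota> x r y" "walk G l \<iota> y s z"
  shows "walk G l \<iota> x (r + s) z"
  using assms(2,1)
proof (induction rule: walk.induct)
  case (step r' y' e s t)
  then show ?case using walk.step[of G l \<iota> x "r + r'" y' e s t] by (simp add: add.assoc)
qed simp

lemma walk_edge:
  assumes "e \<in> edges G" "s \<in> {0..l e}" "t \<in> {0..l e}"
  shows "walk G l \<iota> (\<iota> e s) \<bar>t - s\<bar> (\<iota> e t)"
  using walk.step[of G l \<iota> "\<iota> e s" 0 "\<iota> e s" e s t] walk.refl[of G l \<iota> "\<iota> e s"] assms by simp

lemma walk_sym: "walk G l \<iota> x r y \<Longrightarrow> walk G l \<iota> y r x"
proof (induction rule: walk.induct)
  case (step r y e s t)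
  have "walk G l \<iota> (\<iota> e t) \<bar>s - t\<bar> (\<iota> e s)" using step by (intro walk_edge)
  from walk_trans[OF this] step show ?case
    by (metis add.commute ereal_abs_diff_commute)
qed (rule walk.refl)

lemma path_dist_nonneg: "0 \<le> path_dist G l \<iota> x y"
  unfolding path_dist_def by (rule Inf_greatest) (auto dest: walk_nonneg)

lemma path_dist_refl [simp]: "path_dist G l \<iota> x x = 0"
proof (rule antisym[OF _ path_dist_nonneg])
  show "path_dist G l \<iota> x x \<le> 0"
    unfolding path_dist_def by (rule Inf_lower) (simp add: walk.refl)
qed

lemma path_dist_sym: "path_dist G l \<iota> x y = path_dist G l \<iota> y x"
  unfolding path_dist_def by (rule arg_cong[of _ _ Inf]) (auto intro: walk_sym)

lemma path_dist_triangle: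
  "path_dist G l \<iota> x z \<le> path_dist G l \<iota> x y + path_dist G l \<iota> y z"
  unfolding path_dist_def
  by (rule ereal_Inf_add_ge) (auto intro: Inf_lower walk_trans dest: walk_nonneg)

lemma path_dist_edge:
  "\<lbrakk>e \<in> edges G; s \<in> {0..l e}; t \<in> {0..l e}\<rbrakk> \<Longrightarrow> path_dist G l \<iota> (\<iota> e s) (\<iota> e t) \<le> \<bar>t - s\<bar>"
  unfolding path_dist_def by (auto intro!: Inf_lower walk_edge)

text \<open>
  The path distance is the largest of all (extended) pseudometrics in which no edge is longer than
  its parameter interval. Every comparison of path distances below goes through this maximality.
\<close>

lemma path_dist_greatest:
  fixes D :: "'p \<Rightarrow> 'p \<Rightarrow> ereal"
  assumes "\<And>x. D x x \<le> 0" "\<And>x y z. D x z \<le> D x y + D y z"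
    and "\<And>e s t. e \<in> edges G \<Longrightarrow> s \<in> {0..l e} \<Longrightarrow> t \<in> {0..l e} \<Longrightarrow> D (\<iota> e s) (\<iota> e t) \<le> \<bar>t - s\<bar>"
  shows "D x y \<le> path_dist G l \<iota> x y"
proof -
  have "D x y \<le> r" if "walk G l \<iota> x r y" for r y
    using that
  proof (induction rule: walk.induct)
    case (step r y e s t)
    have "D x (\<iota> e t) \<le> D x y + D y (\<iota> e t)" by (rule assms)
    also have "\<dots> \<le> r + \<bar>t - s\<bar>" using step assms(3)[of e s t] by (intro add_mono) auto
    finally show ?case .
  qed (rule assms)
  then show ?thesis unfolding path_dist_def by (auto intro: Inf_greatest)
qed

section \<open>Models of a curve with more than one point\<close>

text \<open>
  With a second point in the space, every vertex lies on an edge, so that all points can be described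
  by an edge and a parameter.
\<close>

locale tmodel =
  fixes \<Gamma> :: "'p::topological_space curve" and G l \<iota>
  assumes mv: "model_via \<Gamma> G l \<iota>"
    and np: "\<exists>x y :: 'p. x \<noteq> y"
begin

lemma \<Gamma>_eq: "\<Gamma> = path_dist G l \<iota>"
  using mv by (simp add: model_via_def)

lemma fin_edges [simp]: "finite (edges G)" and fin_verts [simp]: "finite (verts G)"
  and ends_verts: "e \<in> edges G \<Longrightarrow> ends G e \<subseteq> verts G"
  and connected_graph: "connected_mgraph G"
  using mv unfolding model_via_def edge_weighted_graph_def graph_def by auto

lemma l_pos: "e \<in> edges G \<Longrightarrow> 0 < l e"
  using mv unfolding model_via_def edge_weighted_graph_def by auto

lemma ends_eq: "e \<in> edges G \<Longrightarrow> ends G e = {\<iota> e 0, \<iota> e (l e)}"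
  and infinite_leaf: "e \<in> edges G \<Longrightarrow> l e = \<infinity> \<Longrightarrow> leaf_end G (\<iota> e \<infinity>)"
  using mv unfolding model_via_def identification_def by auto

lemma inj_interior:
  assumes "e \<in> edges G" "e' \<in> edges G" "0 < s" "s < l e" "0 < t" "t < l e'" "\<iota> e s = \<iota> e' t"
  shows "e = e'" "s = t"
proof -
  have "inj_on (\<lambda>(e, t). \<iota> e t) (SIGMA e:edges G. {0<..<l e})"
    using mv unfolding model_via_def identification_def by auto
  from inj_onD[OF this, of "(e, s)" "(e', t)"] assms show "e = e'" "s = t" by auto
qed

lemma interior_not_vert: "\<lbrakk>e \<in> edges G; 0 < t; t < l e\<rbrakk> \<Longrightarrow> \<iota> e t \<notin> verts G"
  using mv unfolding model_via_def identification_def by auto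

lemma start_vert: "e \<in> edges G \<Longrightarrow> \<iota> e 0 \<in> verts G"
  and end_vert: "e \<in> edges G \<Longrightarrow> \<iota> e (l e) \<in> verts G"
  using ends_verts ends_eq by auto

lemma vert_or_edge: "x \<in> verts G \<or> (\<exists>e\<in>edges G. \<exists>t\<in>{0..l e}. x = \<iota> e t)"
proof -
  have "(UNIV :: 'p set) = verts G \<union> (\<Union>e \<in> edges G. \<iota> e ` {0..l e})"
    using mv unfolding model_via_def identification_def by blast
  then show ?thesis by blast
qed

lemma open_iff:
  "open U \<longleftrightarrow> (\<forall>e \<in> edges G. openin (top_of_set {0..l e}) {t \<in> {0..l e}. \<iota> e t \<in> U})"
  using mv unfolding model_via_def identification_def by blast

lemma vert_on_edge:
  assumes "v \<in> verts G"
  shows "\<exists>e\<in>edges G. v \<in> ends G e"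
proof (rule ccontr)
  assume none: "\<not> ?thesis"
  have "w = v" if "w \<in> verts G" for w
  proof -
    have "(v, w) \<in> {(x, y). \<exists>e \<in> edges G. ends G e = {x, y}}\<^sup>*"
      using connected_graph assms that by (auto simp: connected_mgraph_def)
    then show "w = v"
    proof (induction rule: rtrancl_induct)
      case (step y z)
      then obtain e where "e \<in> edges G" "ends G e = {v, z}" by auto
      then show ?case using none by blast
    qed simp
  qed
  then have "verts G = {v}" using assms by blast
  moreover have "edges G = {}"
  proof (rule equals0I)
    fix e assume "e \<in> edges G"
    then show False using start_vert[of e] ends_eq[of e] none \<open>verts G = {v}\<close> by auto
  qed
  ultimately have "x = v" for x using vert_or_edge[of x] by auto
  then show False using np by metis
qed

lemma point_on_edge: obtains e t where "e \<in> edges G" "0 \<le> t" "t \<le> l e" "x = \<iota> e t"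
proof (cases "x \<in> verts G")
  case True
  then show ?thesis using vert_on_edge[OF True] ends_eq l_pos that
    by (metis empty_iff insert_iff less_imp_le order_refl)
qed (use vert_or_edge[of x] that in auto)

text \<open>
  The parameters of a point. An inner point of an edge has one parameter. The parameters of a vertex
  correspond to the ends of edges attached to it, so that their number is its valence.
\<close>

definition pre :: "'p \<Rightarrow> (nat \<times> ereal) set" where
  "pre x = {(e, t). e \<in> edges G \<and> 0 \<le> t \<and> t \<le> l e \<and> \<iota> e t = x}"

lemma mem_pre: "(e, t) \<in> pre x \<longleftrightarrow> e \<in> edges G \<and> 0 \<le> t \<and> t \<le> l e \<and> \<iota> e t = x"
  by (simp add: pre_def)

lemma pre_nonempty: "\<exists>e t. (e, t) \<in> pre x"
  by (rule point_on_edge[of x]) (use mem_pre in blast)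

lemma pre_notvert:
  assumes "(e, t) \<in> pre x" "x \<notin> verts G"
  shows "0 < t" "t < l e"
  using assms start_vert end_vert by (auto simp: mem_pre less_le)

lemma pre_vert:
  assumes "(e, t) \<in> pre x" "x \<in> verts G"
  shows "t = 0 \<or> t = l e"
  using assms interior_not_vert[of e t] by (auto simp: mem_pre less_le)

lemma pre_cases:
  assumes "(e, s) \<in> pre x" "(e', t) \<in> pre x"
  shows "(e = e' \<and> s = t) \<or> x \<in> verts G \<and> (s = 0 \<or> s = l e) \<and> (t = 0 \<or> t = l e')"
proof (cases "x \<in> verts G")
  case True
  then show ?thesis using assms pre_vert by blast
next
  case False
  then have "0 < s" "s < l e" "0 < t" "t < l e'"
    using pre_notvert[OF assms(1)] pre_notvert[OF assms(2)] by auto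
  then show ?thesis using inj_interior[of e e' s t] assms by (auto simp: mem_pre)
qed

lemma pre_interior:
  assumes "e \<in> edges G" "0 < t" "t < l e"
  shows "pre (\<iota> e t) = {(e, t)}"
proof -
  have "(e, t) \<in> pre (\<iota> e t)" using assms by (auto simp: mem_pre)
  then show ?thesis using pre_cases[of e t "\<iota> e t"] assms by fastforce
qed

lemma finite_pre: "finite (pre x)"
proof (cases "x \<in> verts G")
  case True
  have "pre x \<subseteq> (\<lambda>e. (e, 0)) ` edges G \<union> (\<lambda>e. (e, l e)) ` edges G"
  proof
    fix p assume "p \<in> pre x"
    moreover obtain e t where "p = (e, t)" by (cases p)
    ultimately show "p \<in> (\<lambda>e. (e, 0)) ` edges G \<union> (\<lambda>e. (e, l e)) ` edges G"
      using pre_vert[OF _ True, of e t] by (auto simp: mem_pre)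
  qed
  then show ?thesis by (rule finite_subset) auto
next
  case False
  obtain e t where "(e, t) \<in> pre x" using pre_nonempty by blast
  then have "pre x = {(e, t)}" using pre_cases False by fastforce
  then show ?thesis by simp
qed

text \<open>
  The points at infinity of this model. Together with \<open>points_at_infinity_eq\<close>, the characterization
  \<open>infp_iff\<close> by distances shows that these are the points at infinity of the curve.
\<close>

definition infp :: "'p \<Rightarrow> bool" where
  "infp x \<longleftrightarrow> (\<exists>e\<in>edges G. l e = \<infinity> \<and> x = \<iota> e \<infinity>)"

text \<open>
  A point at infinity is a leaf end: another parameter would make its valence at least two.
\<close>

lemma pre_infinite:
  assumes "e \<in> edges G" "l e = \<infinity>"
  shows "pre (\<iota> e \<infinity>) = {(e, \<infinity>)}"
proof -
  let ?x = "\<iota> e \<infinity>"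
  let ?A = "{e' \<in> edges G. ?x \<in> ends G e'}" and ?B = "{e' \<in> edges G. ends G e' = {?x}}"
  have "card ?A + card ?B = 1"
    using infinite_leaf[OF assms] by (simp add: leaf_end_def valence_def)
  moreover have eA: "e \<in> ?A" using assms ends_eq by auto
  moreover have "card ?A \<noteq> 0" using eA by (subst card_0_eq) auto
  ultimately have "card ?A = 1" and B0: "card ?B = 0" by linarith+
  then obtain a where "?A = {a}" by (auto simp: card_1_singleton_iff)
  then have A: "?A = {e}" using eA by (metis singletonD)
  have B: "?B = {}" using B0 by (subst (asm) card_0_eq) auto
  have "e' = e \<and> t = \<infinity>" if "(e', t) \<in> pre ?x" for e' t
  proof -
    have "?x \<in> verts G" using end_vert assms by metis
    then have t: "t = 0 \<or> t = l e'" using pre_vert that by blast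
    then have "e' \<in> ?A" using that ends_eq by (auto simp: mem_pre)
    then have "e' = e" using A by auto
    moreover have "t \<noteq> 0" using B that ends_eq[of e] assms \<open>e' = e\<close>
      by (auto simp: mem_pre)
    ultimately show ?thesis using t assms by auto
  qed
  moreover have "(e, \<infinity>) \<in> pre ?x" using assms by (auto simp: mem_pre)
  ultimately show ?thesis by auto
qed

lemma pre_ray:
  assumes "e \<in> edges G" "l e = \<infinity>" "0 < s"
  shows "pre (\<iota> e s) = {(e, s)}"
proof (cases "s = \<infinity>")
  case False
  then show ?thesis using assms by (intro pre_interior) auto
qed (use pre_infinite assms in simp)

lemma pre_finite_real:
  assumes "\<not> infp x" "(e, t) \<in> pre x"
  shows "\<exists>t'. t = ereal t'"
  using assms by (cases t) (auto simp: mem_pre infp_def)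

lemma infp_edge_iff:
  assumes "e \<in> edges G" "0 \<le> t" "t \<le> l e"
  shows "infp (\<iota> e t) \<longleftrightarrow> t = \<infinity>"
proof
  assume "infp (\<iota> e t)"
  then obtain e' where "e' \<in> edges G" "l e' = \<infinity>" "\<iota> e t = \<iota> e' \<infinity>" by (auto simp: infp_def)
  moreover from this have "(e, t) \<in> pre (\<iota> e' \<infinity>)" using assms by (auto simp: mem_pre)
  ultimately show "t = \<infinity>" using pre_infinite by auto
next
  assume "t = \<infinity>"
  then show "infp (\<iota> e t)" using assms by (auto simp: infp_def)
qed

lemma finite_infp: "finite {x. infp x}"
proof -
  have "{x. infp x} \<subseteq> (\<lambda>e. \<iota> e \<infinity>) ` edges G" by (auto simp: infp_def)
  then show ?thesis by (rule finite_subset) auto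
qed

lemma \<Gamma>_nonneg [simp]: "0 \<le> \<Gamma> x y" and \<Gamma>_refl [simp]: "\<Gamma> x x = 0"
  and \<Gamma>_triangle: "\<Gamma> x z \<le> \<Gamma> x y + \<Gamma> y z"
  unfolding \<Gamma>_eq by (simp_all add: path_dist_nonneg path_dist_triangle)

lemma \<Gamma>_sym: "\<Gamma> x y = \<Gamma> y x"
  unfolding \<Gamma>_eq by (rule path_dist_sym)

lemma \<Gamma>_edge:
  "\<lbrakk>e \<in> edges G; 0 \<le> s; s \<le> l e; 0 \<le> t; t \<le> l e\<rbrakk> \<Longrightarrow> \<Gamma> (\<iota> e s) (\<iota> e t) \<le> \<bar>t - s\<bar>"
  unfolding \<Gamma>_eq by (rule path_dist_edge) auto

text \<open>
  Since \<open>\<infinity> - \<infinity> = \<infinity>\<close> in the extended reals, even a step that stays at the infinite end of an edge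
  has length \<open>\<infinity>\<close>.
\<close>

lemma walk_from_infp:
  assumes "walk G l \<iota> x r y" "infp x"
  shows "(r = 0 \<and> y = x) \<or> r = \<infinity>"
  using assms(1)
proof (induction rule: walk.induct)
  case (step r y e s t)
  obtain e' where e': "e' \<in> edges G" "l e' = \<infinity>" "x = \<iota> e' \<infinity>" using assms(2) by (auto simp: infp_def)
  show ?case
  proof (cases "r = \<infinity>")
    case False
    then have "y = x" using step by auto
    then have "(e, s) \<in> pre (\<iota> e' \<infinity>)" using step e' by (auto simp: mem_pre)
    then have "s = \<infinity>" using pre_infinite e' by auto
    then show ?thesis using walk_nonneg[OF step(1)] by (cases t; cases r) auto
  qed auto
qed simp

lemma \<Gamma>_infp: "infp x \<Longrightarrow> y \<noteq> x \<Longrightarrow> \<Gamma> x y = \<infinity>"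
  unfolding \<Gamma>_eq path_dist_def using walk_from_infp[of x]
  by (intro antisym Inf_greatest) auto

end

section \<open>Small balls\<close>

lemma finite_pos_lower_bound:
  fixes A :: "ereal set"
  assumes "finite A" "\<And>a. a \<in> A \<Longrightarrow> 0 < a"
  shows "\<exists>r>0::real. \<forall>a\<in>A. ereal r \<le> a"
  using assms
proof (induction A rule: finite_induct)
  case empty
  show ?case by (auto intro: exI[of _ 1])
next
  case (insert a A)
  then obtain r where r: "r > 0" "\<forall>a\<in>A. ereal r \<le> a" by auto
  obtain q where q: "0 < ereal q" "ereal q < a"
    using ereal_dense2[of 0 a] insert.prems by auto
  show ?case
  proof (intro exI[of _ "min r q"] conjI ballI)
    show "0 < min r q" using r q by simp
    fix b assume "b \<in> insert a A"
    then show "ereal (min r q) \<le> b"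
      using r q by (metis ereal_less_eq(3) insertE less_imp_le min.cobounded1 min.cobounded2 order_trans)
  qed
qed

lemma ereal_abs_small_unique:
  fixes s s' t :: ereal
  assumes "\<bar>t - s\<bar> < ereal r" "\<bar>t - s'\<bar> < ereal r" "s \<noteq> s' \<Longrightarrow> ereal (2 * r) \<le> \<bar>s' - s\<bar>"
  shows "s = s'"
proof (rule ccontr)
  assume "s \<noteq> s'"
  then show False using assms by (cases s; cases s'; cases t) auto
qed

lemma ereal_abs_triangle: "\<bar>c - a\<bar> \<le> \<bar>b - a\<bar> + \<bar>c - b\<bar>" for a b c :: ereal
  by (cases a; cases b; cases c) auto

context tmodel
begin

text \<open>
  A radius \<open>r\<close> is good for \<open>x\<close> if the ball of radius \<open>r\<close> about \<open>x\<close> is a star: on each edge, the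
  parameters of \<open>x\<close> are so far from each other and from the ends of the edge that the ball
  consists of disjoint segments of length \<open>r\<close> that meet in \<open>x\<close> only.
\<close>

definition good :: "'p \<Rightarrow> real \<Rightarrow> bool" where
  "good x r \<longleftrightarrow> 0 < r \<and> \<not> infp x \<and>
     (\<forall>e s t. (e, s) \<in> pre x \<longrightarrow> (e, t) \<in> pre x \<or> t = 0 \<or> t = l e \<longrightarrow> t \<noteq> s \<longrightarrow>
       ereal (2 * r) \<le> \<bar>t - s\<bar>)"

lemma good_pos: "good x r \<Longrightarrow> 0 < r" and good_not_infp: "good x r \<Longrightarrow> \<not> infp x"
  by (auto simp: good_def)

lemma goodD:
  "\<lbrakk>good x r; (e, s) \<in> pre x; (e, t) \<in> pre x \<or> t = 0 \<or> t = l e; t \<noteq> s\<rbrakk> \<Longrightarrow> ereal (2 * r) \<le> \<bar>t - s\<bar>"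
  by (auto simp: good_def)

lemma good_mono:
  assumes "good x r" "0 < r'" "r' \<le> r"
  shows "good x r'"
  unfolding good_def
proof (intro conjI allI impI)
  fix e s t assume "(e, s) \<in> pre x" "(e, t) \<in> pre x \<or> t = 0 \<or> t = l e" "t \<noteq> s"
  then have "ereal (2 * r) \<le> \<bar>t - s\<bar>" by (rule goodD[OF assms(1)])
  moreover have "ereal (2 * r') \<le> ereal (2 * r)" using assms by simp
  ultimately show "ereal (2 * r') \<le> \<bar>t - s\<bar>" by (rule order_trans[rotated])
qed (use assms good_not_infp in auto)

lemma good_exists:
  assumes "\<not> infp x"
  shows "\<exists>r. good x r"
proof -
  define B where "B = pre x \<union> (\<lambda>e. (e, 0)) ` edges G \<union> (\<lambda>e. (e, l e)) ` edges G"
  define A where "A = (\<lambda>((e, s), (e', t)). \<bar>t - s\<bar>) ` {((e, s), (e', t)) \<in> pre x \<times> B. t \<noteq> s}"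
  have "finite B" by (simp add: B_def finite_pre)
  then have "finite A" unfolding A_def
    by (intro finite_imageI finite_subset[OF _ finite_cartesian_product[OF finite_pre]]) auto
  moreover have "0 < a" if a: "a \<in> A" for a
  proof -
    obtain e s e' t where *: "(e, s) \<in> pre x" "t \<noteq> s" "a = \<bar>t - s\<bar>"
      using a by (auto simp: A_def)
    obtain s' where "s = ereal s'" using pre_finite_real[OF assms *(1)] by auto
    then show ?thesis using * by (cases t) auto
  qed
  ultimately obtain r where r: "r > 0" "\<forall>a\<in>A. ereal r \<le> a" using finite_pos_lower_bound by blast
  have "ereal r \<le> \<bar>t - s\<bar>"
    if "(e, s) \<in> pre x" "(e, t) \<in> pre x \<or> t = 0 \<or> t = l e" "t \<noteq> s" for e s t
  proof -
    have "(e, t) \<in> B" using that by (auto simp: B_def mem_pre)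
    then have "\<bar>t - s\<bar> \<in> A" using that unfolding A_def by force
    then show ?thesis using r by auto
  qed
  then have "good x (r / 2)" using r assms by (auto simp: good_def)
  then show ?thesis ..
qed

text \<open>
  A walk of length less than \<open>2 * r\<close> that starts in \<open>x\<close> reaches an end of an edge only when it is back
  in \<open>x\<close>. Hence it ends at most as far from some parameter of \<open>x\<close> as its length.
\<close>

lemma good_walk:
  assumes "good x r" "walk G l \<iota> x \<rho> y" "\<rho> < ereal (2 * r)" "(e, t) \<in> pre y"
  shows "\<exists>s. (e, s) \<in> pre x \<and> \<bar>t - s\<bar> \<le> \<rho>"
  using assms(2-)
proof (induction arbitrary: e t rule: walk.induct)
  case refl
  then obtain t' where "t = ereal t'" using pre_finite_real good_not_infp assms(1) by blast
  then show ?case using refl by (intro exI[of _ t]) auto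
next
  case (step \<rho> y e1 s1 t1)
  have "\<rho> \<le> \<rho> + \<bar>t1 - s1\<bar>" using add_left_mono[of 0 "\<bar>t1 - s1\<bar>" \<rho>] by simp
  then have "\<rho> < ereal (2 * r)" using step.prems(1) by order
  moreover have "(e1, s1) \<in> pre y" using step by (auto simp: mem_pre)
  ultimately obtain s0 where s0: "(e1, s0) \<in> pre x" "\<bar>s1 - s0\<bar> \<le> \<rho>" using step.IH by blast
  have "\<bar>t1 - s0\<bar> \<le> \<bar>s1 - s0\<bar> + \<bar>t1 - s1\<bar>" by (rule ereal_abs_triangle)
  also have "\<dots> \<le> \<rho> + \<bar>t1 - s1\<bar>" using s0 by (intro add_mono) auto
  finally have le: "\<bar>t1 - s0\<bar> \<le> \<rho> + \<bar>t1 - s1\<bar>" .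
  have t1: "(e1, t1) \<in> pre (\<iota> e1 t1)" using step by (auto simp: mem_pre)
  consider "e = e1" "t = t1" | "t1 = 0 \<or> t1 = l e1" using pre_cases[OF t1 step.prems(2)] by blast
  then show ?case
  proof cases
    case 1
    then show ?thesis using s0 le by auto
  next
    case 2
    have "t1 = s0"
    proof (rule ccontr)
      assume "t1 \<noteq> s0"
      then have "ereal (2 * r) \<le> \<bar>t1 - s0\<bar>" using goodD[OF assms(1) s0(1)] 2 by blast
      then show False using le step.prems(1) by order
    qed
    then have "\<iota> e1 t1 = x" using s0 by (auto simp: mem_pre)
    then have "(e, t) \<in> pre x" using step.prems(2) by simp
    moreover from this obtain t' where "t = ereal t'"
      using pre_finite_real good_not_infp assms(1) by blast
    ultimately show ?thesis
      using walk_nonneg[OF step(1)] by (intro exI[of _ t]) (auto intro: add_nonneg_nonneg)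
  qed
qed

lemma local_dist:
  assumes "good x r" "(e, s) \<in> pre x" "0 \<le> t" "t \<le> l e" "\<bar>t - s\<bar> < ereal r"
  shows "\<Gamma> x (\<iota> e t) = \<bar>t - s\<bar>"
proof (rule antisym)
  show "\<Gamma> x (\<iota> e t) \<le> \<bar>t - s\<bar>" using \<Gamma>_edge[of e s t] assms by (auto simp: mem_pre)
  have "\<bar>t - s\<bar> \<le> \<rho>" if w: "walk G l \<iota> x \<rho> (\<iota> e t)" for \<rho>
  proof (rule ccontr)
    assume "\<not> ?thesis"
    then have \<rho>: "\<rho> < \<bar>t - s\<bar>" by auto
    then have \<rho>r: "\<rho> < ereal r" using assms(5) by order
    also have "\<dots> \<le> ereal (2 * r)" using good_pos[OF assms(1)] by auto
    finally have "\<rho> < ereal (2 * r)" .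
    moreover have "(e, t) \<in> pre (\<iota> e t)" using assms by (auto simp: mem_pre)
    ultimately obtain s' where s': "(e, s') \<in> pre x" "\<bar>t - s'\<bar> \<le> \<rho>"
      using good_walk[OF assms(1) w] by blast
    have "s = s'"
    proof (rule ereal_abs_small_unique[OF assms(5)])
      show "\<bar>t - s'\<bar> < ereal r" using s' \<rho>r by order
      show "s \<noteq> s' \<Longrightarrow> ereal (2 * r) \<le> \<bar>s' - s\<bar>" using goodD[OF assms(1,2)] s' by blast
    qed
    then show False using s' \<rho> by auto
  qed
  then show "\<bar>t - s\<bar> \<le> \<Gamma> x (\<iota> e t)" unfolding \<Gamma>_eq path_dist_def by (auto intro: Inf_greatest)
qed

lemma local_dist_converse:
  assumes "good x r" "\<Gamma> x y < ereal r" "(e, t) \<in> pre y"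
  shows "\<exists>s. (e, s) \<in> pre x \<and> \<Gamma> x y = \<bar>t - s\<bar>"
proof -
  obtain \<rho> where \<rho>: "walk G l \<iota> x \<rho> y" "\<rho> < ereal r"
    using assms(2) unfolding \<Gamma>_eq path_dist_def by (auto simp: Inf_less_iff)
  then have "\<rho> < ereal (2 * r)" using good_pos[OF assms(1)]
    by (metis ereal_less_eq(3) less_le_trans mult_2 less_add_same_cancel1 less_imp_le)
  then obtain s where s: "(e, s) \<in> pre x" "\<bar>t - s\<bar> \<le> \<rho>"
    using good_walk[OF assms(1) \<rho>(1) _ assms(3)] by blast
  then have "\<bar>t - s\<bar> < ereal r" using \<rho> by order
  then have "\<Gamma> x (\<iota> e t) = \<bar>t - s\<bar>" using local_dist[OF assms(1) s(1)] assms(3) by (auto simp: mem_pre)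
  then show ?thesis using s assms(3) by (auto simp: mem_pre)
qed

lemma \<Gamma>_eq_0_iff: "\<Gamma> x y = 0 \<longleftrightarrow> x = y"
proof
  assume 0: "\<Gamma> x y = 0"
  show "x = y"
  proof (cases "infp x")
    case True
    then show ?thesis using 0 \<Gamma>_infp[of x y] by auto
  next
    case False
    then obtain r where r: "good x r" using good_exists by blast
    obtain e t where et: "(e, t) \<in> pre y" using pre_nonempty by blast
    obtain s where s: "(e, s) \<in> pre x" "0 = \<bar>t - s\<bar>"
      using local_dist_converse[OF r _ et] 0 good_pos[OF r] by auto
    then have "t = s" by (cases t; cases s) auto
    then show ?thesis using s et by (auto simp: mem_pre)
  qed
qed simp

text \<open>
  For an inner point of an edge, only the distance to the two ends of the edge matters.
\<close>

lemma good_interior: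
  assumes "e \<in> edges G" "0 < r" "2 * r \<le> s" "ereal (s + 2 * r) \<le> l e"
  shows "good (\<iota> e (ereal s)) r"
proof -
  have s: "0 < ereal s" "ereal s < l e" using assms by (auto simp: less_le_trans[OF _ assms(4)])
  have "\<not> infp (\<iota> e (ereal s))" using infp_edge_iff[of e "ereal s"] s assms by auto
  then show ?thesis unfolding good_def pre_interior[OF assms(1) s] using assms
    by (cases "l e") auto
qed

lemma interior_dist:
  assumes "e \<in> edges G" "\<bar>t - s\<bar> < r" "2 * r \<le> s" "ereal (s + 2 * r) \<le> l e"
  shows "\<Gamma> (\<iota> e (ereal s)) (\<iota> e (ereal t)) = ereal \<bar>t - s\<bar>"
proof -
  have r: "0 < r" using assms(2) by auto
  have tl: "ereal t \<le> l e" using order_trans[OF _ assms(4), of "ereal t"] assms by auto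
  have sl: "ereal s \<le> l e" using order_trans[OF _ assms(4), of "ereal s"] r by auto
  have "\<Gamma> (\<iota> e (ereal s)) (\<iota> e (ereal t)) = \<bar>ereal t - ereal s\<bar>"
    using good_interior[OF assms(1) r assms(3,4)] assms r tl sl
    by (intro local_dist) (auto simp: mem_pre)
  then show ?thesis by simp
qed

lemma finite_neighbour:
  assumes "\<not> infp x"
  shows "\<exists>y. y \<noteq> x \<and> \<Gamma> x y < \<infinity>"
proof -
  obtain e s where es: "(e, s) \<in> pre x" using pre_nonempty by blast
  then have e: "e \<in> edges G" by (auto simp: mem_pre)
  obtain s' where s': "s = ereal s'" using pre_finite_real[OF assms es] by auto
  obtain q where q: "0 < ereal q" "ereal q < l e" using ereal_dense2[OF l_pos[OF e]] by auto
  have "ereal (q / 2) < l e" using less_trans[OF _ q(2), of "ereal (q / 2)"] q(1) by simp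
  moreover have "0 < ereal (q / 2)" using q(1) by simp
  moreover have "q \<noteq> s' \<or> q / 2 \<noteq> s'" using q(1) by auto
  ultimately obtain t where t: "0 < ereal t" "ereal t < l e" "t \<noteq> s'"
    using q by blast
  have "\<iota> e (ereal t) \<noteq> x"
  proof
    assume "\<iota> e (ereal t) = x"
    then have "(e, s) = (e, ereal t)" using pre_interior[OF e t(1,2)] es by blast
    then show False using s' t(3) by simp
  qed
  moreover have "\<Gamma> x (\<iota> e (ereal t)) \<le> \<bar>ereal t - s\<bar>"
    using \<Gamma>_edge[of e s "ereal t"] es t by (auto simp: mem_pre)
  then have "\<Gamma> x (\<iota> e (ereal t)) < \<infinity>" by (rule le_less_trans) (simp add: s')
  ultimately show ?thesis by blast
qed

lemma infp_iff: "infp x \<longleftrightarrow> (\<forall>y. y \<noteq> x \<longrightarrow> \<Gamma> x y = \<infinity>)"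
proof
  assume inf: "\<forall>y. y \<noteq> x \<longrightarrow> \<Gamma> x y = \<infinity>"
  show "infp x"
  proof (rule ccontr)
    assume "\<not> infp x"
    then obtain y where "y \<noteq> x" "\<Gamma> x y < \<infinity>" using finite_neighbour by blast
    then show False using inf by simp
  qed
qed (use \<Gamma>_infp in blast)

end

lemma infp_model_independent:
  assumes "tmodel \<Gamma> G l \<iota>" "tmodel \<Gamma> G' l' \<iota>'"
  shows "tmodel.infp G l \<iota> x \<longleftrightarrow> tmodel.infp G' l' \<iota>' x"
  unfolding tmodel.infp_iff[OF assms(1)] tmodel.infp_iff[OF assms(2)] ..

context tmodel
begin

lemma points_at_infinity_eq: "points_at_infinity \<Gamma> = {x. infp x}"
proof (intro subset_antisym subsetI)
  fix x assume "x \<in> points_at_infinity \<Gamma>"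
  then obtain G' l' \<iota>' e where *: "model_via \<Gamma> G' l' \<iota>'" "e \<in> edges G'" "l' e = \<infinity>" "x = \<iota>' e \<infinity>"
    unfolding points_at_infinity_def by auto
  interpret M': tmodel \<Gamma> G' l' \<iota>' using * np by unfold_locales
  have "M'.infp x" unfolding M'.infp_def using * by blast
  then show "x \<in> {x. infp x}" unfolding infp_iff M'.infp_iff by simp
next
  fix x assume "x \<in> {x. infp x}"
  then have "\<exists>e \<in> edges G. l e = \<infinity> \<and> x = \<iota> e \<infinity>" by (simp add: infp_def)
  with mv have "\<exists>G l \<iota>. model_via \<Gamma> G l \<iota> \<and> (\<exists>e \<in> edges G. l e = \<infinity> \<and> x = \<iota> e \<infinity>)" by (intro exI conjI)
  then show "x \<in> points_at_infinity \<Gamma>" unfolding points_at_infinity_def by (rule CollectI)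
qed

lemma finite_points_eq: "finite_points \<Gamma> = {x. \<not> infp x}"
  by (auto simp: finite_points_def points_at_infinity_eq)

section \<open>Topology of the curve\<close>

lemma open_fromI:
  "(\<And>e. e \<in> edges G \<Longrightarrow> openin (top_of_set {0..l e}) {t \<in> {0..l e}. \<iota> e t \<in> U}) \<Longrightarrow> open U"
  by (subst open_iff) simp

lemma open_edgeD:
  "open U \<Longrightarrow> e \<in> edges G \<Longrightarrow> openin (top_of_set {0..l e}) {t \<in> {0..l e}. \<iota> e t \<in> U}"
  by (subst (asm) open_iff) simp

lemma continuous_edge:
  assumes "e \<in> edges G"
  shows "continuous_on {0..l e} (\<iota> e)"
  unfolding continuous_openin_preimage_eq
proof (intro allI impI)
  fix U :: "'p set" assume "open U"
  then have "openin (top_of_set {0..l e}) {t \<in> {0..l e}. \<iota> e t \<in> U}"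
    using assms by (rule open_edgeD)
  moreover have "{t \<in> {0..l e}. \<iota> e t \<in> U} = {0..l e} \<inter> \<iota> e -` U" by auto
  ultimately show "openin (top_of_set {0..l e}) ({0..l e} \<inter> \<iota> e -` U)" by simp
qed

lemma continuous_from_edges:
  fixes f :: "'p \<Rightarrow> 'b::topological_space"
  assumes "\<And>e. e \<in> edges G \<Longrightarrow> continuous_on {0..l e} (\<lambda>t. f (\<iota> e t))"
  shows "continuous_on UNIV f"
  unfolding continuous_on_open_vimage[OF open_UNIV]
proof (intro allI impI)
  fix B :: "'b set" assume B: "open B"
  have "openin (top_of_set {0..l e}) {t \<in> {0..l e}. \<iota> e t \<in> f -` B}" if "e \<in> edges G" for e
  proof -
    have "openin (top_of_set {0..l e}) ({0..l e} \<inter> (\<lambda>t. f (\<iota> e t)) -` B)"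
      using assms[OF that] B unfolding continuous_openin_preimage_eq by blast
    moreover have "{0..l e} \<inter> (\<lambda>t. f (\<iota> e t)) -` B = {t \<in> {0..l e}. \<iota> e t \<in> f -` B}" by auto
    ultimately show ?thesis by simp
  qed
  then have "open (f -` B)" by (rule open_fromI)
  then show "open (f -` B \<inter> UNIV)" by simp
qed

lemma continuous_edge_real:
  assumes "e \<in> edges G"
  shows "continuous_on {t. 0 \<le> t \<and> ereal t \<le> l e} (\<lambda>t. \<iota> e (ereal t))"
  by (rule continuous_on_compose2[OF continuous_edge[OF assms]])
    (auto intro: continuous_intros)

lemma UNIV_edges: "(UNIV :: 'p set) = (\<Union>e\<in>edges G. \<iota> e ` {0..l e})"
proof (rule equalityI; rule subsetI)
  fix x :: 'p
  obtain e t where "e \<in> edges G" "0 \<le> t" "t \<le> l e" "x = \<iota> e t" by (rule point_on_edge)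
  then have "x \<in> \<iota> e ` {0..l e}" by simp
  with \<open>e \<in> edges G\<close> show "x \<in> (\<Union>e\<in>edges G. \<iota> e ` {0..l e})" by blast
qed simp

lemma compact_UNIV: "compact (UNIV :: 'p set)"
proof -
  have "compact (\<iota> e ` {0..l e})" if "e \<in> edges G" for e
    using continuous_edge[OF that] closed_atLeastAtMost[of 0 "l e"]
    by (intro compact_continuous_image) (simp_all add: compact_eq_closed)
  then have "compact (\<Union>e\<in>edges G. \<iota> e ` {0..l e})" by (intro compact_UN) auto
  then show ?thesis unfolding UNIV_edges .
qed

text \<open>
  Points strictly inside an edge, or at its infinite end, lie on no other edge.
\<close>

lemma open_edge_part:
  assumes e: "e \<in> edges G" and W: "open W"
    and int: "\<And>t. t \<in> W \<Longrightarrow> 0 \<le> t \<Longrightarrow> t \<le> l e \<Longrightarrow> 0 < t \<and> (t < l e \<or> l e = \<infinity>)"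
  shows "open (\<iota> e ` (W \<inter> {0..l e}))"
proof -
  have pre: "pre (\<iota> e t) = {(e, t)}" if "t \<in> W \<inter> {0..l e}" for t
  proof (cases "t < l e")
    case True
    then show ?thesis using int that by (intro pre_interior[OF e]) auto
  next
    case False
    then show ?thesis using int[of t] that pre_infinite[OF e] by auto
  qed
  have *: "e' = e \<and> t = s" if "e' \<in> edges G" "t \<in> {0..l e'}" "s \<in> W \<inter> {0..l e}" "\<iota> e' t = \<iota> e s" for e' t s
  proof -
    have "(e', t) \<in> pre (\<iota> e s)" using that by (auto simp: mem_pre)
    then show ?thesis using pre[OF that(3)] by simp
  qed
  have "openin (top_of_set {0..l e'}) {t \<in> {0..l e'}. \<iota> e' t \<in> \<iota> e ` (W \<inter> {0..l e})}"
    if "e' \<in> edges G" for e'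
  proof (cases "e' = e")
    case True
    have "{t \<in> {0..l e'}. \<iota> e' t \<in> \<iota> e ` (W \<inter> {0..l e})} = {0..l e'} \<inter> W"
      using * that True by blast
    then show ?thesis using W by (simp add: openin_open_Int)
  next
    case False
    then have "{t \<in> {0..l e'}. \<iota> e' t \<in> \<iota> e ` (W \<inter> {0..l e})} = {}"
      using * that by blast
    then show ?thesis by (simp only: openin_empty)
  qed
  then show ?thesis by (rule open_fromI)
qed

lemma open_segment_image:
  assumes "e \<in> edges G" "0 \<le> a" "b \<le> l e"
  shows "open (\<iota> e ` {a<..<b})"
proof -
  have "open (\<iota> e ` ({a<..<b} \<inter> {0..l e}))" using assms by (intro open_edge_part) auto
  moreover have "{a<..<b} \<inter> {0..l e} = {a<..<b}" using assms by auto
  ultimately show ?thesis by simp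
qed

lemma open_ray:
  assumes "e \<in> edges G" "l e = \<infinity>" "0 \<le> a"
  shows "open (\<iota> e ` {a<..\<infinity>})"
proof -
  have "open (\<iota> e ` ({a<..} \<inter> {0..l e}))" using assms by (intro open_edge_part) auto
  moreover have "{a<..} \<inter> {0..l e} = {a<..\<infinity>}" using assms by auto
  ultimately show ?thesis by simp
qed

lemma closed_point: "closed {x :: 'p}"
proof -
  have "openin (top_of_set {0..l e}) {t \<in> {0..l e}. \<iota> e t \<in> - {x}}" if "e \<in> edges G" for e
  proof -
    have "{t \<in> {0..l e}. \<iota> e t \<in> - {x}} = {0..l e} \<inter> - (snd ` (pre x \<inter> {p. fst p = e}))"
    proof (intro equalityI subsetI)
      fix t assume t: "t \<in> {t \<in> {0..l e}. \<iota> e t \<in> - {x}}"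
      then show "t \<in> {0..l e} \<inter> - (snd ` (pre x \<inter> {p. fst p = e}))" by (auto simp: mem_pre)
    next
      fix t assume t: "t \<in> {0..l e} \<inter> - (snd ` (pre x \<inter> {p. fst p = e}))"
      then have "(e, t) \<notin> pre x" by force
      then show "t \<in> {t \<in> {0..l e}. \<iota> e t \<in> - {x}}" using t that by (auto simp: mem_pre)
    qed
    moreover have "open (- (snd ` (pre x \<inter> {p. fst p = e})))"
      by (intro open_Compl finite_imp_closed finite_imageI finite_Int) (simp add: finite_pre)
    ultimately show ?thesis by (simp add: openin_open_Int)
  qed
  then have "open (- {x})" by (rule open_fromI)
  then show ?thesis unfolding closed_def .
qed

lemma closed_finite_set: "finite (A :: 'p set) \<Longrightarrow> closed A"
proof (induction A rule: finite_induct)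
  case (insert x A)
  have "closed ({x} \<union> A)" by (rule closed_Un[OF closed_point insert.IH])
  then show ?case by simp
qed simp

lemma open_preimage_ereal:
  assumes "open U" "(e, t) \<in> pre x" "x \<in> U"
  obtains W where "open W" "t \<in> W" "\<And>s. s \<in> W \<Longrightarrow> 0 \<le> s \<Longrightarrow> s \<le> l e \<Longrightarrow> \<iota> e s \<in> U"
proof -
  have "openin (top_of_set {0..l e}) {t \<in> {0..l e}. \<iota> e t \<in> U}"
    using assms by (intro open_edgeD) (auto simp: mem_pre)
  then obtain W where W: "open W" "{t \<in> {0..l e}. \<iota> e t \<in> U} = {0..l e} \<inter> W"
    by (auto simp: openin_open)
  have "t \<in> {t \<in> {0..l e}. \<iota> e t \<in> U}" using assms by (auto simp: mem_pre)
  then have "t \<in> W" using W(2) by blast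
  moreover have "\<iota> e s \<in> U" if "s \<in> W" "0 \<le> s" "s \<le> l e" for s
  proof -
    have "s \<in> {0..l e} \<inter> W" using that by simp
    then show ?thesis unfolding W(2)[symmetric] by simp
  qed
  ultimately show ?thesis by (rule that[OF W(1)])
qed

lemma open_contains_segment:
  assumes "open U" "x \<in> U"
  obtains e a b where "e \<in> edges G" "0 \<le> a" "a < b" "ereal b \<le> l e"
    "\<And>t. a < t \<Longrightarrow> t < b \<Longrightarrow> \<iota> e (ereal t) \<in> U"
proof -
  obtain e t where et: "(e, t) \<in> pre x" using pre_nonempty by blast
  then have e: "e \<in> edges G" and t: "0 \<le> t" "t \<le> l e" by (auto simp: mem_pre)
  obtain W where W: "open W" "t \<in> W" "\<And>s. s \<in> W \<Longrightarrow> 0 \<le> s \<Longrightarrow> s \<le> l e \<Longrightarrow> \<iota> e s \<in> U"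
    using open_preimage_ereal[OF assms(1) et assms(2)] by blast
  have "\<exists>p q. 0 \<le> p \<and> p < q \<and> q \<le> l e \<and> {p<..<q} \<subseteq> W"
  proof (cases "t < l e")
    case True
    then obtain b where b: "t < b" "{t..<b} \<subseteq> W" using open_right[OF W(1,2), of "l e"] by blast
    have "{t<..<min b (l e)} \<subseteq> {t..<b}" by auto
    then have "{t<..<min b (l e)} \<subseteq> W" using b(2) by (rule order_trans)
    then show ?thesis using True b(1) t by (intro exI[of _ t] exI[of _ "min b (l e)"]) auto
  next
    case False
    then have tl: "t = l e" using t by auto
    then obtain b where b: "b < t" "{b<..t} \<subseteq> W" using open_left[OF W(1,2), of 0] l_pos[OF e] by blast
    have "{max b 0<..<t} \<subseteq> {b<..t}" by auto
    then have "{max b 0<..<t} \<subseteq> W" using b(2) by (rule order_trans)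
    then show ?thesis using tl b(1) l_pos[OF e] by (intro exI[of _ "max b 0"] exI[of _ t]) auto
  qed
  then obtain p q where pq: "0 \<le> p" "p < q" "q \<le> l e" "{p<..<q} \<subseteq> W" by blast
  obtain a where a: "p < ereal a" "ereal a < q" using ereal_dense2[OF pq(2)] by blast
  obtain b where b: "ereal a < ereal b" "ereal b < q" using ereal_dense2[OF a(2)] by blast
  show ?thesis
  proof (rule that[OF e])
    have "0 \<le> ereal a" using pq(1) a(1) by order
    then show "0 \<le> a" by simp
    show "a < b" using b by simp
    show "ereal b \<le> l e" using b pq by order
    fix s assume s: "a < s" "s < b"
    have 1: "p < ereal s" using a(1) s less_trans[of p "ereal a" "ereal s"] by simp
    have 2: "ereal s < q" using b(2) s less_trans[of "ereal s" "ereal b" q] by simp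
    have "ereal s \<in> W" using pq(4) 1 2 by auto
    moreover have "0 \<le> ereal s" "ereal s \<le> l e" using 1 2 pq by order+
    ultimately show "\<iota> e (ereal s) \<in> U" using W(3) by blast
  qed
qed

lemma open_contains_tail:
  assumes "open U" "e \<in> edges G" "l e = \<infinity>" "\<iota> e \<infinity> \<in> U"
  obtains M where "0 \<le> M" "\<And>t. ereal M < t \<Longrightarrow> \<iota> e t \<in> U"
proof -
  have "(e, \<infinity>) \<in> pre (\<iota> e \<infinity>)" using assms by (simp add: mem_pre)
  then obtain W where W: "open W" "\<infinity> \<in> W" "\<And>s. s \<in> W \<Longrightarrow> 0 \<le> s \<Longrightarrow> s \<le> l e \<Longrightarrow> \<iota> e s \<in> U"
    using open_preimage_ereal[OF assms(1) _ assms(4)] by blast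
  obtain M where M: "{ereal M<..} \<subseteq> W" using open_PInfty[OF W(1,2)] by blast
  show ?thesis
  proof (rule that[of "max M 0"])
    fix t assume t: "ereal (max M 0) < t"
    have "ereal M < t" using t le_less_trans[of "ereal M" "ereal (max M 0)" t] by simp
    moreover have "0 \<le> t" using t by (cases t) auto
    ultimately show "\<iota> e t \<in> U" using M W(3) assms(3) by auto
  qed simp
qed

text \<open>
  A point at infinity has the tails of its edge as neighbourhoods, so that limits at this point are
  limits of functions of a real variable at infinity.
\<close>

lemma at_infp_eq:
  assumes "e \<in> edges G" "l e = \<infinity>"
  shows "at (\<iota> e \<infinity>) = filtermap (\<lambda>t. \<iota> e (ereal t)) at_top"
    and "at (\<iota> e \<infinity>) within {x. \<not> infp x} = filtermap (\<lambda>t. \<iota> e (ereal t)) at_top"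
proof -
  let ?F = "filtermap (\<lambda>t. \<iota> e (ereal t)) at_top"
  have t: "\<iota> e (ereal t) \<noteq> \<iota> e \<infinity> \<and> \<not> infp (\<iota> e (ereal t))" if "0 \<le> t" for t
    using infp_edge_iff[of e "ereal t"] infp_edge_iff[of e \<infinity>] assms that by auto
  have A: "at (\<iota> e \<infinity>) \<le> ?F"
  proof (rule filter_leI)
    fix P assume "eventually P ?F"
    then obtain M where M: "\<And>t. M < t \<Longrightarrow> P (\<iota> e (ereal t))"
      by (auto simp: eventually_filtermap eventually_at_top_dense)
    let ?U = "\<iota> e ` {ereal (max M 0)<..\<infinity>}"
    have "0 \<le> ereal (max M 0)" by (simp del: ereal_max)
    then have "open ?U" using assms by (intro open_ray)
    moreover have "P y" if y: "y \<in> ?U" "y \<noteq> \<iota> e \<infinity>" for y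
    proof -
      obtain s where s: "y = \<iota> e s" "ereal (max M 0) < s" using y(1) by auto
      then have "s \<noteq> \<infinity>" using y(2) by auto
      then obtain t where "s = ereal t" using s(2) by (cases s) auto
      then show "P y" using s M by auto
    qed
    moreover have "\<iota> e \<infinity> \<in> ?U" by (rule imageI) (simp del: ereal_max)
    ultimately show "eventually P (at (\<iota> e \<infinity>))"
      unfolding eventually_at_topological by blast
  qed
  have B: "?F \<le> at (\<iota> e \<infinity>) within {x. \<not> infp x}"
  proof (rule filter_leI)
    fix P assume "eventually P (at (\<iota> e \<infinity>) within {x. \<not> infp x})"
    then obtain U where U: "open U" "\<iota> e \<infinity> \<in> U"
      "\<And>y. y \<in> U \<Longrightarrow> y \<noteq> \<iota> e \<infinity> \<Longrightarrow> \<not> infp y \<Longrightarrow> P y"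
      unfolding eventually_at_topological by auto
    obtain M where M: "0 \<le> M" "\<And>t. ereal M < t \<Longrightarrow> \<iota> e t \<in> U"
      using open_contains_tail[OF U(1) assms U(2)] by blast
    have "P (\<iota> e (ereal s))" if "M < s" for s using t[of s] U(3) M that by auto
    then show "eventually P ?F"
      unfolding eventually_filtermap eventually_at_top_dense by blast
  qed
  have C: "at (\<iota> e \<infinity>) within {x. \<not> infp x} \<le> at (\<iota> e \<infinity>)" by (rule at_le) simp
  show "at (\<iota> e \<infinity>) = ?F" "at (\<iota> e \<infinity>) within {x. \<not> infp x} = ?F" using A B C by order+
qed

lemma eventually_not_infp: "\<not> infp x \<Longrightarrow> eventually (\<lambda>y. \<not> infp y) (at x)"
proof -
  assume "\<not> infp x"
  moreover have "open (- {y. infp y})" using closed_finite_set[OF finite_infp] by auto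
  ultimately show ?thesis
    unfolding eventually_at_topological by (intro exI[of _ "- {y. infp y}"]) auto
qed

text \<open>A point at infinity is a limit of finite points, so that finite points are dense.\<close>

lemma continuous_eqI:
  fixes f g :: "'p \<Rightarrow> 'b::t2_space"
  assumes "continuous_on UNIV f" "continuous_on UNIV g" "\<And>x. \<not> infp x \<Longrightarrow> f x = g x"
  shows "f = g"
proof
  fix x
  show "f x = g x"
  proof (cases "infp x")
    case True
    then obtain e where e: "e \<in> edges G" "l e = \<infinity>" "x = \<iota> e \<infinity>" by (auto simp: infp_def)
    let ?F = "at x within {x. \<not> infp x}"
    have nt: "?F \<noteq> bot" using at_infp_eq(2)[OF e(1,2)] e(3) by (simp add: filtermap_bot_iff)
    have f: "(f \<longlongrightarrow> f x) ?F" and g: "(g \<longlongrightarrow> g x) ?F"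
      using assms(1,2) by (auto simp: continuous_on_def intro: tendsto_within_subset)
    have "eventually (\<lambda>y. f y = g y) ?F" using assms(3) by (simp add: eventually_at_filter)
    with f have "(g \<longlongrightarrow> f x) ?F" by (rule Lim_transform_eventually)
    then show ?thesis using tendsto_unique[OF nt _ g] by blast
  qed (rule assms)
qed

text \<open>The graph is connected, and consecutive edges of a path share a vertex.\<close>

lemma constant_from_edges:
  assumes "\<And>e s t. e \<in> edges G \<Longrightarrow> s \<in> {0..l e} \<Longrightarrow> t \<in> {0..l e} \<Longrightarrow> f (\<iota> e s) = f (\<iota> e t)"
  shows "f x = f y"
proof -
  have verts: "f u = f v" if "u \<in> verts G" "v \<in> verts G" for u v
  proof -
    have "(u, v) \<in> {(x, y). \<exists>e \<in> edges G. ends G e = {x, y}}\<^sup>*"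
      using connected_graph that by (auto simp: connected_mgraph_def)
    then show ?thesis
    proof (induction rule: rtrancl_induct)
      case (step y z)
      then obtain e where e: "e \<in> edges G" "ends G e = {y, z}" by auto
      have "f (\<iota> e 0) = f (\<iota> e (l e))" using assms[OF e(1)] l_pos[OF e(1)] by simp
      moreover have "{y, z} = {\<iota> e 0, \<iota> e (l e)}" using e ends_eq by auto
      ultimately have "f y = f z" by (metis doubleton_eq_iff)
      then show ?case using step by simp
    qed simp
  qed
  have "\<exists>v\<in>verts G. f x = f v" for x
  proof -
    obtain e t where et: "e \<in> edges G" "0 \<le> t" "t \<le> l e" "x = \<iota> e t" by (rule point_on_edge)
    then have "f x = f (\<iota> e 0)" using assms[of e t 0] by auto
    then show ?thesis using start_vert et by blast
  qed
  then show ?thesis using verts by metis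
qed

end

section \<open>Piecewise affine functions of a real variable\<close>

text \<open>
  The real-valued counterpart of \<open>piecewise_affine_int\<close>: only parameters strictly between the ends are
  concerned, and at these a rational function has real values.
\<close>

definition rpa :: "ereal \<Rightarrow> (real \<Rightarrow> real) \<Rightarrow> bool" where
  "rpa L u \<longleftrightarrow>
     (\<exists>S. finite S \<and>
       (\<forall>a b. 0 \<le> a \<and> a < b \<and> ereal b \<le> L \<and> {a<..<b} \<inter> S = {} \<longrightarrow>
         (\<exists>(k::int) (d::real). \<forall>t \<in> {a<..<b}. u t = of_int k * t + d)))"

lemma real_in_segment:
  assumes "ereal b \<le> L" "t \<in> {a<..<b}"
  shows "ereal t < L"
  using assms less_le_trans[of "ereal t" "ereal b" L] by simp

lemma piecewise_affine_int_iff: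
  assumes "\<And>t. 0 < t \<Longrightarrow> ereal t < L \<Longrightarrow> g (ereal t) = ereal (u t)"
  shows "piecewise_affine_int L g \<longleftrightarrow> rpa L u"
proof -
  have "(\<forall>t \<in> {a<..<b}. g (ereal t) = ereal (of_int k * t + d)) \<longleftrightarrow> (\<forall>t \<in> {a<..<b}. u t = of_int k * t + d)"
    if "0 \<le> a" "ereal b \<le> L" for a b d and k :: int
  proof (rule ball_cong[OF HOL.refl])
    fix t assume "t \<in> {a<..<b}"
    then have "g (ereal t) = ereal (u t)" using real_in_segment[OF that(2)] that(1) by (intro assms) auto
    then show "(g (ereal t) = ereal (of_int k * t + d)) = (u t = of_int k * t + d)" by simp
  qed
  then show ?thesis unfolding piecewise_affine_int_def rpa_def by (simp cong: conj_cong)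
qed

lemma rpaE:
  assumes "rpa L u"
  obtains S where "finite S"
    "\<And>a b. \<lbrakk>0 \<le> a; a < b; ereal b \<le> L; {a<..<b} \<inter> S = {}\<rbrakk> \<Longrightarrow>
      \<exists>(k::int) d. \<forall>t \<in> {a<..<b}. u t = of_int k * t + d"
proof -
  obtain S where S: "finite S" "\<forall>a b. 0 \<le> a \<and> a < b \<and> ereal b \<le> L \<and> {a<..<b} \<inter> S = {} \<longrightarrow>
         (\<exists>(k::int) (d::real). \<forall>t \<in> {a<..<b}. u t = of_int k * t + d)"
    using assms unfolding rpa_def by metis
  show ?thesis by (rule that[OF S(1)]) (use S(2) in simp)
qed

lemma rpaI:
  assumes "finite S"
    "\<And>a b. \<lbrakk>0 \<le> a; a < b; ereal b \<le> L; {a<..<b} \<inter> S = {}\<rbrakk> \<Longrightarrow>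
      \<exists>(k::int) d. \<forall>t \<in> {a<..<b}. u t = of_int k * t + d"
  shows "rpa L u"
  unfolding rpa_def by (intro exI[of _ S] conjI assms(1) allI impI assms(2)) auto

lemma rpa_common:
  assumes "rpa L u" "rpa L v"
  obtains S where "finite S"
    "\<And>a b. \<lbrakk>0 \<le> a; a < b; ereal b \<le> L; {a<..<b} \<inter> S = {}\<rbrakk> \<Longrightarrow>
      \<exists>(k::int) d (k'::int) d'. \<forall>t \<in> {a<..<b}. u t = of_int k * t + d \<and> v t = of_int k' * t + d'"
proof -
  obtain S where S: "finite S" "\<And>a b. \<lbrakk>0 \<le> a; a < b; ereal b \<le> L; {a<..<b} \<inter> S = {}\<rbrakk> \<Longrightarrow>
      \<exists>(k::int) d. \<forall>t \<in> {a<..<b}. u t = of_int k * t + d"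
    using rpaE[OF assms(1)] by blast
  obtain T where T: "finite T" "\<And>a b. \<lbrakk>0 \<le> a; a < b; ereal b \<le> L; {a<..<b} \<inter> T = {}\<rbrakk> \<Longrightarrow>
      \<exists>(k::int) d. \<forall>t \<in> {a<..<b}. v t = of_int k * t + d"
    using rpaE[OF assms(2)] by blast
  show ?thesis
  proof (rule that[of "S \<union> T"])
    show "finite (S \<union> T)" using S T by simp
    fix a b assume *: "0 \<le> a" "a < b" "ereal b \<le> L" "{a<..<b} \<inter> (S \<union> T) = {}"
    then have "{a<..<b} \<inter> S = {}" "{a<..<b} \<inter> T = {}" by blast+
    then show "\<exists>(k::int) d (k'::int) d'. \<forall>t \<in> {a<..<b}. u t = of_int k * t + d \<and> v t = of_int k' * t + d'"
      using S(2)[OF *(1-3)] T(2)[OF *(1-3)] by blast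
  qed
qed

lemma rpa_const: "rpa L (\<lambda>_. c)"
proof (rule rpaI[of "{}"])
  fix a b :: real
  show "\<exists>(k::int) d. \<forall>t \<in> {a<..<b}. c = of_int k * t + d" by (intro exI[of _ 0] exI[of _ c]) simp
qed simp

lemma rpa_add:
  assumes "rpa L u" "rpa L v"
  shows "rpa L (\<lambda>t. u t + v t)"
proof (rule rpa_common[OF assms])
  fix S assume S: "finite S" "\<And>a b. \<lbrakk>0 \<le> a; a < b; ereal b \<le> L; {a<..<b} \<inter> S = {}\<rbrakk> \<Longrightarrow>
      \<exists>(k::int) d (k'::int) d'. \<forall>t \<in> {a<..<b}. u t = of_int k * t + d \<and> v t = of_int k' * t + d'"
  show ?thesis
  proof (rule rpaI[OF S(1)])
    fix a b assume "0 \<le> a" "a < b" "ereal b \<le> L" "{a<..<b} \<inter> S = {}"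
    from S(2)[OF this] obtain k d k' d' where
      "\<forall>t \<in> {a<..<b}. u t = of_int k * t + d \<and> v t = of_int k' * t + d'" by blast
    then show "\<exists>(k::int) d. \<forall>t \<in> {a<..<b}. u t + v t = of_int k * t + d"
      by (intro exI[of _ "k + k'"] exI[of _ "d + d'"]) (auto simp: algebra_simps)
  qed
qed

lemma rpa_uminus:
  assumes "rpa L u"
  shows "rpa L (\<lambda>t. - u t)"
proof (rule rpaE[OF assms])
  fix S assume S: "finite S" "\<And>a b. \<lbrakk>0 \<le> a; a < b; ereal b \<le> L; {a<..<b} \<inter> S = {}\<rbrakk> \<Longrightarrow>
      \<exists>(k::int) d. \<forall>t \<in> {a<..<b}. u t = of_int k * t + d"
  show ?thesis
  proof (rule rpaI[OF S(1)])
    fix a b assume "0 \<le> a" "a < b" "ereal b \<le> L" "{a<..<b} \<inter> S = {}"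
    from S(2)[OF this] obtain k d where "\<forall>t \<in> {a<..<b}. u t = of_int k * t + d" by blast
    then show "\<exists>(k::int) d. \<forall>t \<in> {a<..<b}. - u t = of_int k * t + d"
      by (intro exI[of _ "- k"] exI[of _ "- d"]) auto
  qed
qed

lemma rpa_rescale:
  assumes "rpa \<infinity> u" "0 < c"
  shows "rpa \<infinity> (\<lambda>t. u (c * t) / c)"
proof (rule rpaE[OF assms(1)])
  fix S assume S: "finite S" "\<And>a b. \<lbrakk>0 \<le> a; a < b; ereal b \<le> \<infinity>; {a<..<b} \<inter> S = {}\<rbrakk> \<Longrightarrow>
      \<exists>(k::int) d. \<forall>t \<in> {a<..<b}. u t = of_int k * t + d"
  show ?thesis
  proof (rule rpaI[of "(\<lambda>s. s / c) ` S"])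
    fix a b assume *: "0 \<le> a" "a < b" "{a<..<b} \<inter> (\<lambda>s. s / c) ` S = {}"
    have "{c * a<..<c * b} \<inter> S = {}"
    proof (rule equals0I)
      fix s assume s: "s \<in> {c * a<..<c * b} \<inter> S"
      then have "s / c \<in> {a<..<b}" using assms(2) by (auto simp: field_simps)
      then show False using * s by blast
    qed
    then obtain k d where kd: "\<And>t. t \<in> {c * a<..<c * b} \<Longrightarrow> u t = of_int k * t + d"
      using S(2)[of "c * a" "c * b"] * assms(2) by auto
    have "u (c * t) / c = of_int k * t + d / c" if "t \<in> {a<..<b}" for t
      using kd[of "c * t"] that assms(2) by (simp add: field_simps)
    then show "\<exists>(k::int) d. \<forall>t \<in> {a<..<b}. u (c * t) / c = of_int k * t + d" by blast
  qed (use S in simp)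
qed

text \<open>
  Besides the break points of \<open>u\<close> and \<open>v\<close>, the maximum has a break point wherever the graphs of
  two different affine pieces cross. There are only finitely many crossings, since two of them are
  separated by a break point of \<open>u\<close> or \<open>v\<close>.
\<close>

lemma rpa_max:
  assumes "rpa L u" "rpa L v"
  shows "rpa L (\<lambda>t. max (u t) (v t))"
proof (rule rpa_common[OF assms])
  fix S assume S: "finite S" "\<And>a b. \<lbrakk>0 \<le> a; a < b; ereal b \<le> L; {a<..<b} \<inter> S = {}\<rbrakk> \<Longrightarrow>
      \<exists>(k::int) d (k'::int) d'. \<forall>t \<in> {a<..<b}. u t = of_int k * t + d \<and> v t = of_int k' * t + d'"
  \<comment> \<open>The crossings; each of them is determined by the set of break points to its left.\<close>
  define T where "T = {t. \<exists>a b. 0 \<le> a \<and> a < t \<and> t < b \<and> ereal b \<le> L \<and> {a<..<b} \<inter> S = {} \<and>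
    u t = v t \<and> (\<exists>s\<in>{a<..<b}. u s \<noteq> v s)}"
  have sep: "\<exists>s\<in>S. t1 < s \<and> s < t2" if t: "t1 \<in> T" "t2 \<in> T" "t1 < t2" for t1 t2
  proof (rule ccontr)
    assume none: "\<not> ?thesis"
    obtain a b where ab: "0 \<le> a" "a < t1" "t1 < b" "ereal b \<le> L" "{a<..<b} \<inter> S = {}"
      and u1: "u t1 = v t1" and ne: "\<exists>s\<in>{a<..<b}. u s \<noteq> v s"
      using t(1) unfolding T_def by blast
    obtain a' b' where ab': "0 \<le> a'" "a' < t2" "t2 < b'" "ereal b' \<le> L" "{a'<..<b'} \<inter> S = {}" "u t2 = v t2"
      using t(2) unfolding T_def by blast
    let ?b = "max b b'"
    have "{a<..<?b} \<inter> S = {}"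
    proof (rule equals0I)
      fix s assume s: "s \<in> {a<..<?b} \<inter> S"
      then have "s \<notin> {a<..<b}" "s \<notin> {a'<..<b'}" using ab ab' by blast+
      then have "b \<le> s" "s \<le> a'" using s by auto
      then have "t1 < s" "s < t2" using ab(3) ab'(2) by linarith+
      then show False using none s by blast
    qed
    moreover have "ereal ?b \<le> L" using ab ab' by (simp add: max_def)
    ultimately obtain k d k' d' where
      kd: "\<And>t. t \<in> {a<..<?b} \<Longrightarrow> u t = of_int k * t + d \<and> v t = of_int k' * t + d'"
      using S(2)[of a ?b] ab by force
    have "t1 \<in> {a<..<?b}" "t2 \<in> {a<..<?b}" using ab(2,3) ab'(3) t(3) by auto
    then have eq: "of_int k * t1 + d = of_int k' * t1 + d'" "of_int k * t2 + d = of_int k' * t2 + d'"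
      using kd[of t1] kd[of t2] u1 ab'(6) by simp_all
    then have "(real_of_int k - real_of_int k') * (t2 - t1) = 0" by (simp add: algebra_simps)
    then have "k = k'" using t(3) by auto
    moreover from this have "d = d'" using eq by simp
    ultimately have "u s = v s" if "s \<in> {a<..<b}" for s using kd[of s] that by (simp add: less_max_iff_disj)
    then show False using ne by blast
  qed
  have "finite T"
  proof (rule finite_imageD)
    show "finite ((\<lambda>t. {s\<in>S. s < t}) ` T)" by (rule finite_subset[of _ "Pow S"]) (use S in auto)
    show "inj_on (\<lambda>t. {s\<in>S. s < t}) T"
    proof (rule linorder_inj_onI)
      fix t1 t2 assume t: "t1 < t2" "t1 \<in> T" "t2 \<in> T"
      then obtain s where s: "s \<in> S" "t1 < s" "s < t2" using sep by blast
      then have "s \<in> {s\<in>S. s < t2}" "s \<notin> {s\<in>S. s < t1}" by auto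
      then show "{s\<in>S. s < t1} \<noteq> {s\<in>S. s < t2}" by blast
    qed (rule linear)
  qed
  show ?thesis
  proof (rule rpaI[of "S \<union> T"])
    show "finite (S \<union> T)" using S \<open>finite T\<close> by simp
    fix a b assume *: "0 \<le> a" "a < b" "ereal b \<le> L" "{a<..<b} \<inter> (S \<union> T) = {}"
    then have disj: "{a<..<b} \<inter> S = {}" "{a<..<b} \<inter> T = {}" by blast+
    obtain k d k' d' where
      kd: "\<And>t. t \<in> {a<..<b} \<Longrightarrow> u t = of_int k * t + d \<and> v t = of_int k' * t + d'"
      using S(2)[OF *(1-3) disj(1)] by blast
    consider "\<forall>t\<in>{a<..<b}. u t = v t" | "\<forall>t\<in>{a<..<b}. u t \<noteq> v t"
    proof (cases "\<forall>t\<in>{a<..<b}. u t = v t")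
      case False
      have "u t \<noteq> v t" if t: "t \<in> {a<..<b}" for t
      proof
        assume "u t = v t"
        then have "t \<in> T" unfolding T_def using * disj(1) False t by (intro CollectI exI[of _ a] exI[of _ b]) auto
        then show False using disj t by blast
      qed
      then show ?thesis using that by blast
    qed (use that in blast)
    then show "\<exists>(k::int) d. \<forall>t \<in> {a<..<b}. max (u t) (v t) = of_int k * t + d"
    proof cases
      case 1
      then show ?thesis using kd by (intro exI[of _ k] exI[of _ d]) auto
    next
      case 2
      let ?h = "\<lambda>t. (real_of_int k - real_of_int k') * t + (d - d')"
      have h: "u t - v t = ?h t" if "t \<in> {a<..<b}" for t
        using kd[OF that] by (simp add: algebra_simps)
      have "(\<forall>t\<in>{a<..<b}. ?h t < 0) \<or> (\<forall>t\<in>{a<..<b}. ?h t > 0)"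
      proof (rule ccontr)
        assume "\<not> ?thesis"
        then obtain p q where pq: "p \<in> {a<..<b}" "q \<in> {a<..<b}" "?h p \<ge> 0" "?h q \<le> 0" by force
        have "connected (?h ` {a<..<b})"
          by (intro connected_continuous_image continuous_intros) simp
        then have "0 \<in> ?h ` {a<..<b}"
          using pq connectedD_interval[of "?h ` {a<..<b}" "?h q" "?h p" 0] by blast
        then obtain z where "z \<in> {a<..<b}" "?h z = 0" by auto
        then show False using 2 h[of z] by auto
      qed
      then consider "\<forall>t\<in>{a<..<b}. u t < v t" | "\<forall>t\<in>{a<..<b}. v t < u t" using h by force
      then show ?thesis
      proof cases
        case 1
        then show ?thesis using kd by (intro exI[of _ k'] exI[of _ d']) (auto simp: max_def dest: less_imp_le)
      next
        case 2
        then show ?thesis using kd by (intro exI[of _ k] exI[of _ d]) (auto simp: max_def)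
      qed
    qed
  qed
qed

lemma rpa_right:
  assumes "rpa L u" "0 \<le> x" "ereal x < L"
  obtains \<delta> d and k :: int where "0 < \<delta>" "ereal (x + \<delta>) \<le> L" "\<And>t. x < t \<Longrightarrow> t < x + \<delta> \<Longrightarrow> u t = of_int k * t + d"
proof (rule rpaE[OF assms(1)])
  fix S assume S: "finite S" "\<And>a b. \<lbrakk>0 \<le> a; a < b; ereal b \<le> L; {a<..<b} \<inter> S = {}\<rbrakk> \<Longrightarrow>
      \<exists>(k::int) d. \<forall>t \<in> {a<..<b}. u t = of_int k * t + d"
  obtain e where e: "e > 0" "\<forall>s\<in>S. s \<noteq> x \<longrightarrow> e \<le> dist x s" using finite_set_avoid[OF S(1)] by blast
  obtain b where b: "ereal x < ereal b" "ereal b < L" using ereal_dense2[OF assms(3)] by auto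
  define \<delta> where "\<delta> = min e (b - x)"
  have "0 < \<delta>" using e b by (auto simp: \<delta>_def)
  moreover have "ereal (x + \<delta>) \<le> L" using b(2) order_trans[of "ereal (x + \<delta>)" "ereal b" L] by (auto simp: \<delta>_def)
  moreover have "{x<..<x + \<delta>} \<inter> S = {}"
  proof (rule equals0I)
    fix s assume "s \<in> {x<..<x + \<delta>} \<inter> S"
    then show False using e by (auto simp: \<delta>_def dist_real_def)
  qed
  ultimately show ?thesis using S(2)[of x "x + \<delta>"] assms(2) that[of \<delta>] by force
qed

lemma rpa_left:
  assumes "rpa L u" "0 < x" "ereal x \<le> L"
  obtains \<delta> d and k :: int where "0 < \<delta>" "\<delta> \<le> x" "\<And>t. x - \<delta> < t \<Longrightarrow> t < x \<Longrightarrow> u t = of_int k * t + d"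
proof (rule rpaE[OF assms(1)])
  fix S assume S: "finite S" "\<And>a b. \<lbrakk>0 \<le> a; a < b; ereal b \<le> L; {a<..<b} \<inter> S = {}\<rbrakk> \<Longrightarrow>
      \<exists>(k::int) d. \<forall>t \<in> {a<..<b}. u t = of_int k * t + d"
  obtain e where e: "e > 0" "\<forall>s\<in>S. s \<noteq> x \<longrightarrow> e \<le> dist x s" using finite_set_avoid[OF S(1)] by blast
  define \<delta> where "\<delta> = min e x"
  have "0 < \<delta>" "\<delta> \<le> x" using e assms by (auto simp: \<delta>_def)
  moreover have "{x - \<delta><..<x} \<inter> S = {}"
  proof (rule equals0I)
    fix s assume "s \<in> {x - \<delta><..<x} \<inter> S"
    then show False using e by (auto simp: \<delta>_def dist_real_def)
  qed
  ultimately show ?thesis using S(2)[of "x - \<delta>" x] assms(3) that[of \<delta>] by force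
qed

lemma affine_eq_on_segment:
  fixes k k' :: int
  assumes "a < b" "\<And>t. t \<in> {a<..<b} \<Longrightarrow> of_int k * t + d = of_int k' * t + (d' :: real)"
  shows "k = k'" "d = d'"
proof -
  define p q where "p = (2 * a + b) / 3" and "q = (a + 2 * b) / 3"
  have pq: "p \<in> {a<..<b}" "q \<in> {a<..<b}" "p < q" using assms(1) by (auto simp: p_def q_def)
  have "(real_of_int k - real_of_int k') * (q - p) = 0"
    using assms(2)[OF pq(1)] assms(2)[OF pq(2)] by (simp add: algebra_simps)
  then show "k = k'" using pq by auto
  then show "d = d'" using assms(2)[OF pq(1)] by auto
qed

lemma rpa_at_infinity:
  assumes "rpa \<infinity> u"
  obtains M d and k :: int where "0 \<le> M" "\<And>t. M < t \<Longrightarrow> u t = of_int k * t + d"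
proof (rule rpaE[OF assms(1)])
  fix S assume S: "finite S" "\<And>a b. \<lbrakk>0 \<le> a; a < b; ereal b \<le> \<infinity>; {a<..<b} \<inter> S = {}\<rbrakk> \<Longrightarrow>
      \<exists>(k::int) d. \<forall>t \<in> {a<..<b}. u t = of_int k * t + d"
  define M where "M = Max (insert 0 S)"
  have M: "0 \<le> M" "\<And>s. s \<in> S \<Longrightarrow> s \<le> M" using S(1) by (auto simp: M_def)
  have aff: "\<exists>(k::int) d. \<forall>t \<in> {M<..<b}. u t = of_int k * t + d" if "M < b" for b
    using that M by (intro S(2)) force+
  obtain k d where kd: "\<forall>t \<in> {M<..<M + 1}. u t = of_int k * t + d" using aff[of "M + 1"] by auto
  have "u t = of_int k * t + d" if t: "M < t" for t
  proof -
    obtain k' d' where kd': "\<forall>t \<in> {M<..<t + 1}. u t = of_int k' * t + d'" using aff[of "t + 1"] t by auto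
    have "of_int k * s + d = of_int k' * s + d'" if "s \<in> {M<..<min (M + 1) (t + 1)}" for s
      using kd kd' that by (metis greaterThanLessThan_iff min_less_iff_conj)
    then have "k = k'" "d = d'" using affine_eq_on_segment[of M "min (M + 1) (t + 1)" k d k' d'] t by auto
    then show ?thesis using kd' t by auto
  qed
  with M(1) show ?thesis by (rule that)
qed

lemma rpa_cong:
  assumes "\<And>t. 0 < t \<Longrightarrow> ereal t < L \<Longrightarrow> u t = v t"
  shows "rpa L u \<longleftrightarrow> rpa L v"
proof -
  let ?g = "\<lambda>x. ereal (u (real_of_ereal x))"
  have "piecewise_affine_int L ?g \<longleftrightarrow> rpa L u" by (rule piecewise_affine_int_iff) simp
  moreover have "piecewise_affine_int L ?g \<longleftrightarrow> rpa L v" by (rule piecewise_affine_int_iff) (simp add: assms)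
  ultimately show ?thesis by simp
qed

text \<open>
  Outside finitely many points the derivative vanishes.
\<close>

lemma rpa_constant:
  assumes "rpa L u" "0 \<le> a" "a \<le> b" "ereal b \<le> L" "continuous_on {a..b} u"
    and zero: "\<And>p q d (k::int). \<lbrakk>0 \<le> p; p < q; ereal q \<le> L; \<forall>t\<in>{p<..<q}. u t = of_int k * t + d\<rbrakk> \<Longrightarrow> k = 0"
  shows "u b = u a"
proof (rule rpaE[OF assms(1)])
  fix S assume S: "finite S" "\<And>a b. \<lbrakk>0 \<le> a; a < b; ereal b \<le> L; {a<..<b} \<inter> S = {}\<rbrakk> \<Longrightarrow>
      \<exists>(k::int) d. \<forall>t \<in> {a<..<b}. u t = of_int k * t + d"
  have "(u has_derivative (\<lambda>h. 0)) (at x within {a..b})" if x: "x \<in> {a..b} - (S \<union> {a, b})" for x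
  proof -
    obtain \<epsilon> where \<epsilon>: "\<epsilon> > 0" "\<forall>s\<in>S. s \<noteq> x \<longrightarrow> \<epsilon> \<le> dist x s" using finite_set_avoid[OF S(1)] by blast
    define p q where "p = max a (x - \<epsilon>)" and "q = min b (x + \<epsilon>)"
    have pq: "a \<le> p" "p < x" "x < q" "q \<le> b" using x \<epsilon>(1) by (auto simp: p_def q_def)
    have "{p<..<q} \<inter> S = {}"
    proof (rule equals0I)
      fix s assume s: "s \<in> {p<..<q} \<inter> S"
      then have "s \<noteq> x" using x by blast
      then have "\<epsilon> \<le> dist x s" using \<epsilon>(2) s by simp
      then show False using s by (auto simp: p_def q_def dist_real_def)
    qed
    moreover have qL: "ereal q \<le> L" using order_trans[OF _ assms(4), of "ereal q"] pq by simp
    ultimately obtain k d where kd: "\<forall>t \<in> {p<..<q}. u t = of_int k * t + d"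
      using S(2)[of p q] pq assms(2) by auto
    then have "k = 0" using zero[OF _ _ qL kd] pq assms(2) by simp
    then have "\<And>t. t \<in> {p<..<q} \<Longrightarrow> d = u t" using kd by simp
    then have "(u has_derivative (\<lambda>h. 0)) (at x)"
      using pq by (intro has_derivative_transform_within_open[OF has_derivative_const[of d], of "{p<..<q}"]) auto
    then show ?thesis by (rule has_derivative_at_withinI)
  qed
  then show ?thesis
    using has_derivative_zero_unique_strong_interval[of "S \<union> {a, b}" a b u "u a" b] S(1) assms(3,5) by auto
qed

lemma affine_limit: "\<exists>L. ((\<lambda>t. ereal (k * t + d)) \<longlongrightarrow> L) at_top" for k d :: real
proof -
  have pos: "((\<lambda>t. ereal (k * t + d)) \<longlongrightarrow> \<infinity>) at_top" if "k > 0" for k d :: real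
    unfolding tendsto_PInfty_eq_at_top filterlim_at_top
  proof
    fix Z :: real
    show "eventually (\<lambda>t. Z \<le> k * t + d) at_top"
      using eventually_ge_at_top[of "(Z - d) / k"] by eventually_elim (use that in \<open>simp add: field_simps\<close>)
  qed
  consider "k = 0" | "k > 0" | "k < 0" by linarith
  then show ?thesis
  proof cases
    case 1
    then show ?thesis by (intro exI[of _ "ereal d"]) simp
  next
    case 2
    then show ?thesis using pos by blast
  next
    case 3
    then have "((\<lambda>t. - ereal ((- k) * t + (- d))) \<longlongrightarrow> - \<infinity>) at_top"
      by (intro tendsto_uminus_ereal pos) simp
    moreover have "(\<lambda>t. - ereal ((- k) * t + (- d))) = (\<lambda>t. ereal (k * t + d))" by auto
    ultimately show ?thesis by (intro exI[of _ "- \<infinity>"]) (simp only:)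
  qed
qed

lemma affine_on_closure:
  fixes u :: "real \<Rightarrow> real"
  assumes "a < b" "continuous_on {a..b} u" "\<And>t. a < t \<Longrightarrow> t < b \<Longrightarrow> u t = k * t + d" "t \<in> {a..b}"
  shows "u t = k * t + d"
proof -
  have cl: "closure {a<..<b} = {a..b}" by (rule closure_greaterThanLessThan[OF assms(1)])
  have "continuous_on (closure {a<..<b}) (\<lambda>t. u t - (k * t + d))"
    unfolding cl by (intro continuous_intros assms(2))
  then have "u t - (k * t + d) = 0"
    by (rule continuous_constant_on_closure) (use assms cl in auto)
  then show ?thesis by simp
qed

section \<open>Comparing two models\<close>

lemma room:
  assumes "0 < x" "ereal x < L"
  obtains R where "0 < R" "8 * R \<le> x" "ereal (x + 8 * R) \<le> L"
proof -
  obtain b where b: "ereal x < ereal b" "ereal b < L" using ereal_dense2[OF assms(2)] by auto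
  define R where "R = min (x / 8) ((b - x) / 8)"
  have "R \<le> (b - x) / 8" unfolding R_def by (rule min.cobounded2)
  then have "ereal (x + 8 * R) \<le> ereal b" by simp
  then have "ereal (x + 8 * R) \<le> L" using b(2) by order
  moreover have "0 < R" "8 * R \<le> x" using assms b by (auto simp: R_def)
  ultimately show ?thesis using that by blast
qed

lemma isometry_sign:
  fixes a x p :: real
  assumes "\<bar>a\<bar> = \<bar>x\<bar>" "\<bar>a - of_int \<sigma> * p\<bar> = \<bar>x - p\<bar>" "p > 0" "\<sigma> = 1 \<or> \<sigma> = - 1"
  shows "a = of_int \<sigma> * x"
  using assms by (auto simp: abs_if split: if_splits)

locale tmodel_pair = tmodel \<Gamma> G l \<iota> + M': tmodel \<Gamma> G' l' \<iota>'
  for \<Gamma> :: "'p::topological_space curve" and G l \<iota> G' l' \<iota>'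
begin

lemma infp_pair: "M'.infp x \<longleftrightarrow> infp x"
  by (rule infp_model_independent[OF M'.tmodel_axioms tmodel_axioms])

text \<open>
  Near the parameter \<open>t\<close>, the edge \<open>e\<close> of the first model runs along the edge \<open>e'\<close> of the second one,
  forwards or backwards according to the sign \<open>\<sigma>\<close>.
\<close>

definition trans_at :: "nat \<Rightarrow> real \<Rightarrow> nat \<times> int \<times> real \<Rightarrow> bool" where
  "trans_at e t = (\<lambda>(e', \<sigma>, d). e' \<in> edges G' \<and> (\<sigma> = 1 \<or> \<sigma> = - 1) \<and>
     (\<exists>r>0. \<forall>s. \<bar>s - t\<bar> < r \<longrightarrow> 0 < of_int \<sigma> * s + d \<and> ereal (of_int \<sigma> * s + d) < l' e' \<and>
        \<iota> e (ereal s) = \<iota>' e' (ereal (of_int \<sigma> * s + d))))"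

text \<open>
  On a small ball around a point that lies inside an edge of either model, both parameters are
  isometric to the ball, so they differ by an isometry of an interval of the real line.
\<close>

lemma trans_at_exists:
  assumes e: "e \<in> edges G" and t0: "0 < t0" "ereal t0 < l e" and nv: "\<iota> e (ereal t0) \<notin> verts G'"
  shows "\<exists>p. trans_at e t0 p"
proof -
  let ?x = "\<iota> e (ereal t0)"
  obtain e' u where eu: "(e', u) \<in> M'.pre ?x" using M'.pre_nonempty by blast
  then have e': "e' \<in> edges G'" by (simp add: M'.mem_pre)
  have u: "0 < u" "u < l' e'" using M'.pre_notvert[OF eu nv] by auto
  then obtain u0 where u0: "u = ereal u0" by (cases u) auto
  have prex: "M'.pre ?x = {(e', ereal u0)}" using M'.pre_interior[OF e' u] eu u0 by (simp add: M'.mem_pre)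
  have xu: "?x = \<iota>' e' (ereal u0)" using eu u0 by (simp add: M'.mem_pre)
  \<comment> \<open>The factor 8 leaves room for comparing any two points of the ball with each other.\<close>
  obtain R1 where R1: "0 < R1" "8 * R1 \<le> t0" "ereal (t0 + 8 * R1) \<le> l e" using room t0 by blast
  obtain R2 where R2: "0 < R2" "8 * R2 \<le> u0" "ereal (u0 + 8 * R2) \<le> l' e'" using room[of u0 "l' e'"] u u0 by auto
  define R where "R = min R1 R2"
  have R: "0 < R" "8 * R \<le> t0" "8 * R \<le> u0" using R1 R2 by (auto simp: R_def)
  have Rl: "ereal (t0 + 8 * R) \<le> l e"
    by (rule order_trans[OF _ R1(3)]) (simp add: R_def)
  have Rl': "ereal (u0 + 8 * R) \<le> l' e'"
    by (rule order_trans[OF _ R2(3)]) (simp add: R_def)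
  have below: "ereal s \<le> l e" if "s \<le> t0 + 8 * R" for s using order_trans[OF _ Rl, of "ereal s"] that by simp
  have below': "ereal s \<le> l' e'" if "s \<le> u0 + 8 * R" for s using order_trans[OF _ Rl', of "ereal s"] that by simp
  have good': "M'.good ?x R" unfolding xu by (rule M'.good_interior[OF e' R(1)]) (use R below' in auto)
  have "\<exists>h. \<iota> e (ereal t) = \<iota>' e' (ereal h) \<and> \<bar>h - u0\<bar> = \<bar>t - t0\<bar>" if t: "\<bar>t - t0\<bar> < R" for t
  proof -
    have d: "\<Gamma> ?x (\<iota> e (ereal t)) = ereal \<bar>t - t0\<bar>"
      by (rule interior_dist[OF e t]) (use R below in auto)
    obtain e1 t1 where et1: "(e1, t1) \<in> M'.pre (\<iota> e (ereal t))" using M'.pre_nonempty by blast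
    have "\<Gamma> ?x (\<iota> e (ereal t)) < ereal R" using d t by simp
    from M'.local_dist_converse[OF good' this et1] obtain s where
      s: "(e1, s) \<in> M'.pre ?x" "\<Gamma> ?x (\<iota> e (ereal t)) = \<bar>t1 - s\<bar>" by blast
    then have "e1 = e'" "s = ereal u0" using prex by auto
    moreover from this obtain h where "t1 = ereal h" using s(2) d by (cases t1) auto
    ultimately show ?thesis using s(2) d et1 by (intro exI[of _ h]) (auto simp: M'.mem_pre)
  qed
  then obtain h where h: "\<And>t. \<bar>t - t0\<bar> < R \<Longrightarrow> \<iota> e (ereal t) = \<iota>' e' (ereal (h t)) \<and> \<bar>h t - u0\<bar> = \<bar>t - t0\<bar>"
    by metis
  have iso: "\<bar>h t - h s\<bar> = \<bar>t - s\<bar>" if st: "\<bar>s - t0\<bar> < R" "\<bar>t - t0\<bar> < R" for s t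
  proof -
    have "\<Gamma> (\<iota> e (ereal s)) (\<iota> e (ereal t)) = ereal \<bar>t - s\<bar>"
      by (rule interior_dist[OF e, of t s "2 * R"]) (use R below st in auto)
    moreover have "\<Gamma> (\<iota>' e' (ereal (h s))) (\<iota>' e' (ereal (h t))) = ereal \<bar>h t - h s\<bar>"
      by (rule M'.interior_dist[OF e', of "h t" "h s" "2 * R"]) (use R below' st h[of s] h[of t] in auto)
    ultimately show ?thesis using h st by simp
  qed
  define p where "p = R / 2"
  have p: "0 < p" "\<bar>(t0 + p) - t0\<bar> < R" using R by (auto simp: p_def)
  obtain \<sigma> :: int where \<sigma>: "\<sigma> = 1 \<or> \<sigma> = - 1" "h (t0 + p) - u0 = of_int \<sigma> * p"
  proof (cases "h (t0 + p) - u0 = p")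
    case True
    then show ?thesis using that[of 1] by simp
  next
    case False
    then show ?thesis using that[of "- 1"] h[OF p(2)] p(1) by (auto simp: abs_if split: if_splits)
  qed
  define d where "d = u0 - of_int \<sigma> * t0"
  have hs: "h s = of_int \<sigma> * s + d" if s: "\<bar>s - t0\<bar> < R" for s
  proof -
    have "\<bar>h s - h (t0 + p)\<bar> = \<bar>s - (t0 + p)\<bar>" using iso s p by blast
    then have "\<bar>(h s - u0) - of_int \<sigma> * p\<bar> = \<bar>(s - t0) - p\<bar>" using \<sigma>(2) by (simp add: algebra_simps)
    then have "h s - u0 = of_int \<sigma> * (s - t0)" using h[OF s] p(1) \<sigma>(1) by (intro isometry_sign) auto
    then show ?thesis by (simp add: d_def algebra_simps)
  qed
  have "0 < of_int \<sigma> * s + d \<and> ereal (of_int \<sigma> * s + d) < l' e' \<and>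
        \<iota> e (ereal s) = \<iota>' e' (ereal (of_int \<sigma> * s + d))" if s: "\<bar>s - t0\<bar> < R" for s
  proof -
    have "\<bar>h s - u0\<bar> < R" using h[OF s] s by simp
    then have "0 < h s" "h s < u0 + 8 * R" using R by auto
    then have "ereal (h s) < l' e'" using less_le_trans[OF _ Rl', of "ereal (h s)"] by simp
    then show ?thesis using hs[OF s] h[OF s] \<open>0 < h s\<close> by simp
  qed
  then have "trans_at e t0 (e', \<sigma>, d)" unfolding trans_at_def using e' \<sigma>(1) R(1) by blast
  then show ?thesis by blast
qed

lemma trans_at_unique:
  assumes "trans_at e t p" "trans_at e t q"
  shows "p = q"
proof -
  obtain e1 \<sigma>1 d1 where p: "p = (e1, \<sigma>1, d1)" by (cases p)
  obtain e2 \<sigma>2 d2 where q: "q = (e2, \<sigma>2, d2)" by (cases q)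
  obtain r1 where r1: "e1 \<in> edges G'" "r1 > 0"
    "\<And>s. \<bar>s - t\<bar> < r1 \<Longrightarrow> 0 < of_int \<sigma>1 * s + d1 \<and> ereal (of_int \<sigma>1 * s + d1) < l' e1 \<and>
        \<iota> e (ereal s) = \<iota>' e1 (ereal (of_int \<sigma>1 * s + d1))"
    using assms(1) unfolding p trans_at_def prod.case by blast
  obtain r2 where r2: "e2 \<in> edges G'" "r2 > 0"
    "\<And>s. \<bar>s - t\<bar> < r2 \<Longrightarrow> 0 < of_int \<sigma>2 * s + d2 \<and> ereal (of_int \<sigma>2 * s + d2) < l' e2 \<and>
        \<iota> e (ereal s) = \<iota>' e2 (ereal (of_int \<sigma>2 * s + d2))"
    using assms(2) unfolding q trans_at_def prod.case by blast
  define r where "r = min r1 r2"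
  have r: "r > 0" "r \<le> r1" "r \<le> r2" using r1(2) r2(2) by (auto simp: r_def)
  have eq: "e1 = e2 \<and> of_int \<sigma>1 * s + d1 = of_int \<sigma>2 * s + d2" if "\<bar>s - t\<bar> < r" for s
    using M'.inj_interior[of e1 e2 "ereal (of_int \<sigma>1 * s + d1)" "ereal (of_int \<sigma>2 * s + d2)"]
      r1(1) r2(1) r1(3)[of s] r2(3)[of s] that r by auto
  have "of_int \<sigma>1 * s + d1 = of_int \<sigma>2 * s + d2" if "s \<in> {t<..<t + r}" for s
    using eq[of s] that by auto
  then have "\<sigma>1 = \<sigma>2" "d1 = d2"
    using affine_eq_on_segment[of t "t + r" \<sigma>1 d1 \<sigma>2 d2] r(1) by auto
  then show ?thesis using eq[of t] r(1) by (simp add: p q)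
qed

lemma trans_at_near:
  assumes "trans_at e t p"
  shows "eventually (\<lambda>s. trans_at e s p) (at t within A)"
proof -
  obtain e1 \<sigma>1 d1 where p: "p = (e1, \<sigma>1, d1)" by (cases p)
  obtain r1 where r1: "e1 \<in> edges G'" "\<sigma>1 = 1 \<or> \<sigma>1 = - 1" "r1 > 0"
    "\<And>s. \<bar>s - t\<bar> < r1 \<Longrightarrow> 0 < of_int \<sigma>1 * s + d1 \<and> ereal (of_int \<sigma>1 * s + d1) < l' e1 \<and>
        \<iota> e (ereal s) = \<iota>' e1 (ereal (of_int \<sigma>1 * s + d1))"
    using assms(1) unfolding p trans_at_def prod.case by blast
  have "trans_at e s p" if "\<bar>s - t\<bar> < r1" for s
    unfolding p trans_at_def prod.case
  proof (intro conjI exI[of _ "r1 - \<bar>s - t\<bar>"] allI impI)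
    fix w assume "\<bar>w - s\<bar> < r1 - \<bar>s - t\<bar>"
    then have "\<bar>w - t\<bar> < r1" by linarith
    from r1(4)[OF this] show "0 < of_int \<sigma>1 * w + d1" "ereal (of_int \<sigma>1 * w + d1) < l' e1"
      "\<iota> e (ereal w) = \<iota>' e1 (ereal (of_int \<sigma>1 * w + d1))" by auto
  qed (use r1 that in auto)
  then show ?thesis unfolding eventually_at using r1(3)
    by (intro exI[of _ r1]) (auto simp: dist_real_def)
qed

text \<open>
  Between vertices of the second model, an edge of the first model runs along a single edge of the
  second one, with speed one: this holds locally since both models induce the same distance, and
  edge, direction and offset are locally constant on an interval.
\<close>

lemma transition:
  assumes e: "e \<in> edges G" and AB: "0 \<le> A" "B \<le> l e"
    and nv: "\<And>t. A < ereal t \<Longrightarrow> ereal t < B \<Longrightarrow> \<iota> e (ereal t) \<notin> verts G'"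
    and ne: "A < ereal t0" "ereal t0 < B"
  obtains e' \<sigma> d where "e' \<in> edges G'" "\<sigma> = 1 \<or> \<sigma> = - 1"
    "\<And>t. A < ereal t \<Longrightarrow> ereal t < B \<Longrightarrow> 0 < of_int \<sigma> * t + d \<and> ereal (of_int \<sigma> * t + d) < l' e' \<and>
        \<iota> e (ereal t) = \<iota>' e' (ereal (of_int \<sigma> * t + d))"
proof -
  let ?I = "{t. A < ereal t \<and> ereal t < B}"
  define T where "T = (\<lambda>t. SOME p. trans_at e t p)"
  have ex: "\<exists>p. trans_at e t p" if "t \<in> ?I" for t
  proof (rule trans_at_exists[OF e])
    have "0 < ereal t" using le_less_trans[OF AB(1), of "ereal t"] that by auto
    then show "0 < t" by simp
    show "ereal t < l e" using less_le_trans[OF _ AB(2)] that by auto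
    show "\<iota> e (ereal t) \<notin> verts G'" using nv that by auto
  qed
  have T: "trans_at e t (T t)" if "t \<in> ?I" for t unfolding T_def by (rule someI_ex[OF ex[OF that]])
  have "connected ?I"
    unfolding connected_iff_interval
  proof (intro ballI allI impI)
    fix x y z assume *: "x \<in> ?I" "y \<in> ?I" "x \<le> z" "z \<le> y"
    have "A < ereal z" using * less_le_trans[of A "ereal x" "ereal z"] by simp
    moreover have "ereal z < B" using * le_less_trans[of "ereal z" "ereal y" B] by simp
    ultimately show "z \<in> ?I" by simp
  qed
  moreover have "\<forall>t\<in>?I. eventually (\<lambda>s. T t = T s) (at t within ?I)"
  proof
    fix t assume t: "t \<in> ?I"
    have "eventually (\<lambda>s. s \<in> ?I \<and> trans_at e s (T t)) (at t within ?I)"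
      by (rule eventually_conj[OF _ trans_at_near[OF T[OF t]]]) (simp add: eventually_at_filter)
    then show "eventually (\<lambda>s. T t = T s) (at t within ?I)"
      by eventually_elim (use trans_at_unique T in blast)
  qed
  ultimately have const: "T t0 = T t" if "t \<in> ?I" for t
    using connected_local_const[of ?I t0 t T] ne that by blast
  obtain e' \<sigma> d where p: "T t0 = (e', \<sigma>, d)" by (cases "T t0")
  have Tt: "trans_at e t (e', \<sigma>, d)" if "t \<in> ?I" for t using T[OF that] const[OF that] p by simp
  show ?thesis
  proof (rule that[of e' \<sigma> d])
    show "e' \<in> edges G'" "\<sigma> = 1 \<or> \<sigma> = - 1" using Tt[of t0] ne unfolding trans_at_def prod.case by blast+
    fix t assume "A < ereal t" "ereal t < B"
    then have "trans_at e t (e', \<sigma>, d)" using Tt by blast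
    then obtain r where "r > 0" "\<forall>s. \<bar>s - t\<bar> < r \<longrightarrow> 0 < of_int \<sigma> * s + d \<and> ereal (of_int \<sigma> * s + d) < l' e' \<and>
        \<iota> e (ereal s) = \<iota>' e' (ereal (of_int \<sigma> * s + d))"
      unfolding trans_at_def prod.case by blast
    then show "0 < of_int \<sigma> * t + d \<and> ereal (of_int \<sigma> * t + d) < l' e' \<and>
        \<iota> e (ereal t) = \<iota>' e' (ereal (of_int \<sigma> * t + d))" by simp
  qed
qed

lemma transition_bounds:
  assumes "a < b" "\<sigma> = 1 \<or> \<sigma> = - (1::int)"
    and "\<And>t. a < t \<Longrightarrow> t < b \<Longrightarrow> 0 < of_int \<sigma> * t + d \<and> ereal (of_int \<sigma> * t + d) < L"
  shows "\<exists>a' b'. 0 \<le> a' \<and> a' < b' \<and> ereal b' \<le> L \<and> (\<lambda>t. of_int \<sigma> * t + d) ` {a<..<b} = {a'<..<b'}"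
proof -
  have L: "ereal s \<le> L" if "\<And>w. w < s \<Longrightarrow> s - (b - a) < w \<Longrightarrow> ereal w < L" for s
  proof (cases L)
    case (real r)
    have "s \<le> r" by (rule dense_le_bounded[of "s - (b - a)"]) (use assms(1) that real in \<open>auto simp: less_imp_le\<close>)
    then show ?thesis using real by simp
  next
    case MInf
    have "s - (b - a) / 2 < s" "s - (b - a) < s - (b - a) / 2" using assms(1) by (auto simp: field_simps)
    then show ?thesis using that MInf by fastforce
  qed simp
  show ?thesis
  proof (cases "\<sigma> = 1")
    case True
    have "- d \<le> a" by (rule dense_ge_bounded[OF assms(1)]) (use assms(3) True in force)
    moreover have "ereal (b + d) \<le> L" by (rule L) (use assms(3)[of "w - d" for w] True in auto)
    moreover have "(\<lambda>t. of_int \<sigma> * t + d) ` {a<..<b} = {a + d<..<b + d}"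
      using True by (auto simp: image_iff intro!: bexI[of _ "x - d" for x])
    ultimately show ?thesis using assms(1) by (intro exI[of _ "a + d"] exI[of _ "b + d"]) auto
  next
    case False
    then have \<sigma>: "\<sigma> = - 1" using assms(2) by simp
    have "b \<le> d" by (rule dense_le_bounded[OF assms(1)]) (use assms(3) \<sigma> in force)
    moreover have "ereal (d - a) \<le> L" by (rule L) (use assms(3)[of "d - w" for w] \<sigma> in auto)
    moreover have "(\<lambda>t. of_int \<sigma> * t + d) ` {a<..<b} = {d - b<..<d - a}"
      using \<sigma> by (auto simp: image_iff intro!: bexI[of _ "d - x" for x])
    ultimately show ?thesis using assms(1) by (intro exI[of _ "d - b"] exI[of _ "d - a"]) auto
  qed
qed

text \<open>
  The break points in the first model are the parameters of the vertices and of the break points of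
  the second model.
\<close>

lemma piecewise_affine_transfer:
  assumes pa: "\<And>e'. e' \<in> edges G' \<Longrightarrow> piecewise_affine_int (l' e') (f \<circ> \<iota>' e')"
    and e: "e \<in> edges G"
  shows "piecewise_affine_int (l e) (f \<circ> \<iota> e)"
proof -
  have "\<forall>e'\<in>edges G'. \<exists>S. finite S \<and> (\<forall>a b. 0 \<le> a \<and> a < b \<and> ereal b \<le> l' e' \<and> {a<..<b} \<inter> S = {} \<longrightarrow>
         (\<exists>(k::int) (c::real). \<forall>t \<in> {a<..<b}. (f \<circ> \<iota>' e') (ereal t) = ereal (of_int k * t + c)))"
    using pa unfolding piecewise_affine_int_def by blast
  then obtain S where S0: "\<forall>e'\<in>edges G'. finite (S e') \<and>
      (\<forall>a b. 0 \<le> a \<and> a < b \<and> ereal b \<le> l' e' \<and> {a<..<b} \<inter> S e' = {} \<longrightarrow>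
         (\<exists>(k::int) (c::real). \<forall>t \<in> {a<..<b}. (f \<circ> \<iota>' e') (ereal t) = ereal (of_int k * t + c)))"
    unfolding bchoice_iff by blast
  have S: "\<And>e'. e' \<in> edges G' \<Longrightarrow> finite (S e')"
    "\<And>e' a b. e' \<in> edges G' \<Longrightarrow> 0 \<le> a \<Longrightarrow> a < b \<Longrightarrow> ereal b \<le> l' e' \<Longrightarrow> {a<..<b} \<inter> S e' = {} \<Longrightarrow>
         \<exists>(k::int) (c::real). \<forall>t \<in> {a<..<b}. f (\<iota>' e' (ereal t)) = ereal (of_int k * t + c)"
    using S0 by simp_all
  define X where "X = verts G' \<union> (\<Union>e'\<in>edges G'. (\<lambda>s. \<iota>' e' (ereal s)) ` S e')"
  have "finite X" unfolding X_def using S(1) by auto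
  define T where "T = {t. 0 < t \<and> ereal t < l e \<and> \<iota> e (ereal t) \<in> X}"
  have "finite T"
  proof (rule finite_imageD)
    show "finite ((\<lambda>t. \<iota> e (ereal t)) ` T)" by (rule finite_subset[OF _ \<open>finite X\<close>]) (auto simp: T_def)
    show "inj_on (\<lambda>t. \<iota> e (ereal t)) T"
    proof (rule inj_onI)
      fix s t assume "s \<in> T" "t \<in> T" "\<iota> e (ereal s) = \<iota> e (ereal t)"
      then show "s = t" using inj_interior(2)[OF e e, of "ereal s" "ereal t"] by (simp add: T_def)
    qed
  qed
  have pieces: "\<exists>(k::int) c. \<forall>t \<in> {a<..<b}. f (\<iota> e (ereal t)) = ereal (of_int k * t + c)"
    if ab: "0 \<le> a" "a < b" "ereal b \<le> l e" "{a<..<b} \<inter> T = {}" for a b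
  proof -
    have nX: "\<iota> e (ereal t) \<notin> X" if "a < t" "t < b" for t
    proof
      assume "\<iota> e (ereal t) \<in> X"
      then have "t \<in> T" using that ab real_in_segment[OF ab(3), of t a] by (auto simp: T_def)
      then show False using ab(4) that by auto
    qed
    obtain e' \<sigma> d where tr: "e' \<in> edges G'" "\<sigma> = 1 \<or> \<sigma> = - 1"
      "\<And>t. ereal a < ereal t \<Longrightarrow> ereal t < ereal b \<Longrightarrow> 0 < of_int \<sigma> * t + d \<and> ereal (of_int \<sigma> * t + d) < l' e' \<and>
        \<iota> e (ereal t) = \<iota>' e' (ereal (of_int \<sigma> * t + d))"
      by (rule transition[OF e, of "ereal a" "ereal b" "(a + b) / 2"]) (use ab nX X_def in auto)
    obtain a' b' where ab': "0 \<le> a'" "a' < b'" "ereal b' \<le> l' e'"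
      "(\<lambda>t. of_int \<sigma> * t + d) ` {a<..<b} = {a'<..<b'}"
      using transition_bounds[OF ab(2) tr(2), of d "l' e'"] tr(3) by auto
    have "{a'<..<b'} \<inter> S e' = {}"
    proof (rule equals0I)
      fix s assume s: "s \<in> {a'<..<b'} \<inter> S e'"
      then obtain t where t: "t \<in> {a<..<b}" "s = of_int \<sigma> * t + d" using ab'(4) by blast
      then have "\<iota> e (ereal t) = \<iota>' e' (ereal s)" using tr(3)[of t] by simp
      then have "\<iota> e (ereal t) \<in> X" using s tr(1) by (auto simp: X_def)
      then show False using nX t by simp
    qed
    then obtain k c where kc: "\<And>t. t \<in> {a'<..<b'} \<Longrightarrow> f (\<iota>' e' (ereal t)) = ereal (of_int k * t + c)"
      using S(2)[OF tr(1) ab'(1-3)] by blast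
    have "f (\<iota> e (ereal t)) = ereal (of_int (k * \<sigma>) * t + (of_int k * d + c))" if t: "t \<in> {a<..<b}" for t
    proof -
      have "of_int \<sigma> * t + d \<in> {a'<..<b'}" using ab'(4) t by blast
      then show ?thesis using kc tr(3)[of t] t by (simp add: algebra_simps)
    qed
    then show ?thesis by blast
  qed
  show ?thesis unfolding piecewise_affine_int_def comp_def
    by (intro exI[of _ T] conjI allI impI \<open>finite T\<close> pieces) simp_all
qed

end

section \<open>Rational functions in a fixed model\<close>

text \<open>
  Since points at infinity are no exception here, the tropical product of two such functions is the
  pointwise sum everywhere (\<open>rat_mult_Brat\<close>).
\<close>

definition Brat :: "'p::topological_space curve \<Rightarrow> ('p \<Rightarrow> real) set" where
  "Brat \<Gamma> = {g. (\<lambda>x. ereal (g x)) \<in> Rat \<Gamma>}"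

context tmodel
begin

text \<open>
  The rational functions other than the constant \<open>-\<infinity>\<close>, computed in this model.
\<close>

definition Rfin :: "('p \<Rightarrow> ereal) set" where
  "Rfin = {f. continuous_on UNIV f \<and> (\<forall>e\<in>edges G. piecewise_affine_int (l e) (f \<circ> \<iota> e)) \<and>
     (\<forall>x. \<bar>f x\<bar> = \<infinity> \<longrightarrow> infp x)}"

lemma Rat_eq: "Rat \<Gamma> = insert (\<lambda>_. - \<infinity>) Rfin"
proof -
  have "(\<exists>G l \<iota>. model_via \<Gamma> G l \<iota> \<and> (\<forall>e \<in> edges G. piecewise_affine_int (l e) (f \<circ> \<iota> e))) \<longleftrightarrow>
    (\<forall>e\<in>edges G. piecewise_affine_int (l e) (f \<circ> \<iota> e))" (is "?L \<longleftrightarrow> ?R") for f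
  proof
    assume ?L
    then obtain G' l' \<iota>' where *: "model_via \<Gamma> G' l' \<iota>'"
      "\<forall>e \<in> edges G'. piecewise_affine_int (l' e) (f \<circ> \<iota>' e)" by blast
    interpret P: tmodel_pair \<Gamma> G l \<iota> G' l' \<iota>'
      by (intro tmodel_pair.intro tmodel_axioms tmodel.intro * np)
    show ?R using P.piecewise_affine_transfer *(2) by blast
  next
    assume ?R
    with mv show ?L by (intro exI conjI)
  qed
  then show ?thesis unfolding Rat_def Rfin_def points_at_infinity_eq by simp
qed

lemma ex_finite_point: "\<exists>x. \<not> infp x"
proof -
  obtain e t where "e \<in> edges G" "0 \<le> t" "t \<le> l e" by (rule point_on_edge)
  then have "\<not> infp (\<iota> e 0)" using infp_edge_iff[of e 0] l_pos by auto
  then show ?thesis ..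
qed

lemma minf_notin_Rfin: "(\<lambda>_. - \<infinity>) \<notin> Rfin"
  using ex_finite_point by (auto simp: Rfin_def)

lemma Rfin_real: "f \<in> Rfin \<Longrightarrow> \<not> infp x \<Longrightarrow> \<bar>f x\<bar> \<noteq> \<infinity>"
  by (auto simp: Rfin_def)

lemma not_infp_interior:
  assumes "e \<in> edges G" "0 \<le> t" "ereal t \<le> l e"
  shows "\<not> infp (\<iota> e (ereal t))"
  using infp_edge_iff[of e "ereal t"] assms by auto

lemma Rfin_rpa_iff:
  assumes "\<And>x. \<bar>f x\<bar> = \<infinity> \<Longrightarrow> infp x" "e \<in> edges G"
  shows "piecewise_affine_int (l e) (f \<circ> \<iota> e) \<longleftrightarrow> rpa (l e) (\<lambda>t. real_of_ereal (f (\<iota> e (ereal t))))"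
proof (rule piecewise_affine_int_iff)
  fix t :: real assume "0 < t" "ereal t < l e"
  then have "\<not> infp (\<iota> e (ereal t))" using not_infp_interior assms(2) by simp
  then have "\<bar>f (\<iota> e (ereal t))\<bar> \<noteq> \<infinity>" by (rule contrapos_nn) (rule assms(1))
  then show "(f \<circ> \<iota> e) (ereal t) = ereal (real_of_ereal (f (\<iota> e (ereal t))))"
    by (simp add: ereal_real)
qed

lemma Rfin_iff:
  "f \<in> Rfin \<longleftrightarrow> continuous_on UNIV f \<and> (\<forall>e\<in>edges G. rpa (l e) (\<lambda>t. real_of_ereal (f (\<iota> e (ereal t))))) \<and>
     (\<forall>x. \<bar>f x\<bar> = \<infinity> \<longrightarrow> infp x)"
proof (cases "\<forall>x. \<bar>f x\<bar> = \<infinity> \<longrightarrow> infp x")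
  case True
  then have "piecewise_affine_int (l e) (f \<circ> \<iota> e) \<longleftrightarrow> rpa (l e) (\<lambda>t. real_of_ereal (f (\<iota> e (ereal t))))"
    if "e \<in> edges G" for e
    using Rfin_rpa_iff[of f e] that by simp
  then show ?thesis unfolding Rfin_def by simp
qed (auto simp: Rfin_def)

lemma Brat_iff:
  "g \<in> Brat \<Gamma> \<longleftrightarrow> continuous_on UNIV g \<and> (\<forall>e\<in>edges G. rpa (l e) (\<lambda>t. g (\<iota> e (ereal t))))"
proof -
  have "(\<lambda>x. ereal (g x)) \<noteq> (\<lambda>_. - \<infinity>)" by (auto dest: fun_cong)
  then have "g \<in> Brat \<Gamma> \<longleftrightarrow> (\<lambda>x. ereal (g x)) \<in> Rfin" unfolding Brat_def Rat_eq by simp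
  then show ?thesis unfolding Rfin_iff continuous_on_def lim_ereal by simp
qed

lemma Brat_cont: "g \<in> Brat \<Gamma> \<Longrightarrow> continuous_on UNIV g"
  and Brat_rpa: "g \<in> Brat \<Gamma> \<Longrightarrow> e \<in> edges G \<Longrightarrow> rpa (l e) (\<lambda>t. g (\<iota> e (ereal t)))"
  by (auto simp: Brat_iff)

lemma Brat_const: "(\<lambda>_. c) \<in> Brat \<Gamma>"
  by (simp add: Brat_iff rpa_const)

lemma Brat_add: "f \<in> Brat \<Gamma> \<Longrightarrow> g \<in> Brat \<Gamma> \<Longrightarrow> (\<lambda>x. f x + g x) \<in> Brat \<Gamma>"
  by (auto simp: Brat_iff intro!: rpa_add continuous_intros)

lemma Brat_uminus: "f \<in> Brat \<Gamma> \<Longrightarrow> (\<lambda>x. - f x) \<in> Brat \<Gamma>"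
  by (auto simp: Brat_iff intro!: rpa_uminus continuous_intros)

lemma Brat_max: "f \<in> Brat \<Gamma> \<Longrightarrow> g \<in> Brat \<Gamma> \<Longrightarrow> (\<lambda>x. max (f x) (g x)) \<in> Brat \<Gamma>"
  by (auto simp: Brat_iff intro!: rpa_max continuous_intros)

lemma Brat_sum: "finite A \<Longrightarrow> (\<And>i. i \<in> A \<Longrightarrow> f i \<in> Brat \<Gamma>) \<Longrightarrow> (\<lambda>x. \<Sum>i\<in>A. f i x) \<in> Brat \<Gamma>"
  by (induction A rule: finite_induct) (simp_all add: Brat_const Brat_add)

section \<open>Tents and ramps\<close>

text \<open>
  The local model of the distance from \<open>x\<close>: if \<open>r\<close> is good for \<open>x\<close>, this is a rational function of
  slopes \<open>-1\<close>, \<open>0\<close> and \<open>1\<close>.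
\<close>

definition tent :: "'p \<Rightarrow> real \<Rightarrow> 'p \<Rightarrow> real" where
  "tent x r y = real_of_ereal (max 0 (ereal r - \<Gamma> x y))"

lemma tent_nonneg: "0 \<le> tent x r y"
  by (simp add: tent_def real_of_ereal_pos)

lemma tent_near: "\<Gamma> x y < ereal r \<Longrightarrow> \<Gamma> x y = ereal (r - tent x r y)"
  using \<Gamma>_nonneg[of x y] by (cases "\<Gamma> x y") (auto simp: tent_def max_def)

lemma tent_pos_iff: "0 < tent x r y \<longleftrightarrow> \<Gamma> x y < ereal r"
  using \<Gamma>_nonneg[of x y] by (cases "\<Gamma> x y") (auto simp: tent_def max_def)

lemma tent_far: "\<not> \<Gamma> x y < ereal r \<Longrightarrow> tent x r y = 0"
  using tent_pos_iff[of x r y] tent_nonneg[of x r y] by simp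

lemma tent_lipschitz: "ereal \<bar>tent x r y - tent x r z\<bar> \<le> \<Gamma> y z"
proof (cases "\<Gamma> y z")
  case (real d)
  have "\<Gamma> x y \<le> \<Gamma> x z + ereal d" "\<Gamma> x z \<le> \<Gamma> x y + ereal d"
    using \<Gamma>_triangle[of x y z] \<Gamma>_triangle[of x z y] \<Gamma>_sym[of y z] real by auto
  moreover have "0 \<le> d" using \<Gamma>_nonneg[of y z] real by simp
  ultimately have "\<bar>tent x r y - tent x r z\<bar> \<le> d"
    using \<Gamma>_nonneg[of x y] \<Gamma>_nonneg[of x z]
    by (cases "\<Gamma> x y"; cases "\<Gamma> x z") (auto simp: tent_def max_def)
  then show ?thesis using real by simp
next
  case MInf
  then show ?thesis using \<Gamma>_nonneg[of y z] by simp
qed simp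

end

lemma continuous_on_Icc_lipschitz:
  fixes u :: "ereal \<Rightarrow> real"
  assumes lip: "\<And>s t. \<lbrakk>0 \<le> s; ereal s \<le> L; 0 \<le> t; ereal t \<le> L\<rbrakk> \<Longrightarrow> \<bar>u (ereal t) - u (ereal s)\<bar> \<le> \<bar>t - s\<bar>"
    and inf: "L = \<infinity> \<Longrightarrow> \<exists>M. \<forall>t. ereal M < t \<longrightarrow> u t = u \<infinity>"
  shows "continuous_on {0..L} u"
  unfolding continuous_on_def
proof
  fix x assume x: "x \<in> {0..L}"
  show "(u \<longlongrightarrow> u x) (at x within {0..L})"
  proof (cases x)
    case (real s)
    show ?thesis
      unfolding tendsto_iff
    proof (intro allI impI)
      fix \<epsilon> :: real assume "0 < \<epsilon>"
      let ?U = "{ereal (s - \<epsilon>)<..<ereal (s + \<epsilon>)}"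
      have "dist (u y) (u x) < \<epsilon>" if y: "y \<in> ?U" "y \<in> {0..L}" for y
      proof -
        obtain t where t: "y = ereal t" using y(1) by (cases y) auto
        then have "\<bar>t - s\<bar> < \<epsilon>" using y(1) by auto
        moreover have "\<bar>u (ereal t) - u (ereal s)\<bar> \<le> \<bar>t - s\<bar>" using lip[of s t] x y(2) t real by simp
        ultimately show ?thesis using t real by (simp add: dist_real_def)
      qed
      moreover have "x \<in> ?U" using real \<open>0 < \<epsilon>\<close> by simp
      ultimately show "eventually (\<lambda>y. dist (u y) (u x) < \<epsilon>) (at x within {0..L})"
        unfolding eventually_at_topological by (intro exI[of _ ?U]) simp
    qed
  next
    case PInf
    then have "L = \<infinity>" using x by simp
    then obtain M where M: "\<And>t. ereal M < t \<Longrightarrow> u t = u \<infinity>" using inf by blast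
    have "eventually (\<lambda>y. u y = u x) (at x within {0..L})"
      unfolding eventually_at_topological
    proof (intro exI[of _ "{ereal M<..}"] conjI ballI impI)
      show "x \<in> {ereal M<..}" using PInf by simp
      fix y assume "y \<in> {ereal M<..}"
      then show "u y = u x" unfolding PInf by (intro M) simp
    qed simp
    then show ?thesis by (rule tendsto_eventually)
  qed (use x in simp)
qed

context tmodel
begin

text \<open>
  Besides the parameters of \<open>x\<close>, where the slope jumps from \<open>1\<close> to \<open>-1\<close>, the break points are those at
  which the ball of radius \<open>r\<close> ends.
\<close>

lemma tent_rpa:
  assumes good: "good x r" and e: "e \<in> edges G"
  shows "rpa (l e) (\<lambda>t. tent x r (\<iota> e (ereal t)))"
proof -
  define P where "P = {s. (e, ereal s) \<in> pre x}"
  have "finite P"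
  proof -
    have "P = (\<lambda>s. (e, ereal s)) -` pre x" by (auto simp: P_def)
    then show ?thesis using finite_vimageI[OF finite_pre[of x], of "\<lambda>s. (e, ereal s)"] by (simp add: inj_on_def)
  qed
  then have "finite (P \<union> (\<lambda>s. s - r) ` P \<union> (\<lambda>s. s + r) ` P)" by simp
  then show ?thesis
  proof (rule rpaI)
    fix a b assume ab: "0 \<le> a" "a < b" "ereal b \<le> l e" "{a<..<b} \<inter> (P \<union> (\<lambda>s. s - r) ` P \<union> (\<lambda>s. s + r) ` P) = {}"
    have mem: "(e, ereal t) \<in> pre (\<iota> e (ereal t))" if "t \<in> {a<..<b}" for t
      using that ab real_in_segment[OF ab(3) that] e by (simp add: mem_pre)
    show "\<exists>(k::int) d. \<forall>t\<in>{a<..<b}. tent x r (\<iota> e (ereal t)) = of_int k * t + d"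
    proof (cases "\<exists>t\<in>{a<..<b}. \<Gamma> x (\<iota> e (ereal t)) < ereal r")
      case True
      then obtain t where t: "t \<in> {a<..<b}" "\<Gamma> x (\<iota> e (ereal t)) < ereal r" by blast
      from local_dist_converse[OF good t(2) mem[OF t(1)]] obtain s' where
        s': "(e, s') \<in> pre x" "\<Gamma> x (\<iota> e (ereal t)) = \<bar>ereal t - s'\<bar>" by blast
      then obtain s where s: "s' = ereal s" using pre_finite_real good_not_infp[OF good] by blast
      then have sP: "s \<in> P" using s' by (simp add: P_def)
      have ts: "\<bar>t - s\<bar> < r" using s' s t(2) by simp
      have no: "s \<notin> {a<..<b}" "s - r \<notin> {a<..<b}" "s + r \<notin> {a<..<b}" using sP ab(4) by blast+
      then have sr: "s - r \<le> a" "b \<le> s + r" using t(1) ts by auto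
      have tent: "tent x r (\<iota> e (ereal w)) = r - \<bar>w - s\<bar>" if w: "w \<in> {a<..<b}" for w
      proof -
        have "\<Gamma> x (\<iota> e (ereal w)) = \<bar>ereal w - ereal s\<bar>"
          using mem[OF w] s'(1) s w sr by (intro local_dist[OF good]) (auto simp: mem_pre)
        moreover have "\<bar>w - s\<bar> < r" using w sr by auto
        ultimately show ?thesis by (simp add: tent_def)
      qed
      show ?thesis
      proof (cases "s \<le> a")
        case True
        then have "\<forall>w\<in>{a<..<b}. tent x r (\<iota> e (ereal w)) = of_int (- 1) * w + (r + s)" using tent by auto
        then show ?thesis by blast
      next
        case False
        then have "\<forall>w\<in>{a<..<b}. tent x r (\<iota> e (ereal w)) = of_int 1 * w + (r - s)" using tent no by auto
        then show ?thesis by blast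
      qed
    next
      case False
      then have "\<forall>t\<in>{a<..<b}. tent x r (\<iota> e (ereal t)) = of_int 0 * t + 0" using tent_far by simp
      then show ?thesis by blast
    qed
  qed
qed

lemma tent_continuous:
  assumes good: "good x r"
  shows "continuous_on UNIV (tent x r)"
proof (rule continuous_from_edges)
  fix e assume e: "e \<in> edges G"
  show "continuous_on {0..l e} (\<lambda>t. tent x r (\<iota> e t))"
  proof (rule continuous_on_Icc_lipschitz)
    fix s t assume st: "0 \<le> s" "ereal s \<le> l e" "0 \<le> t" "ereal t \<le> l e"
    have "ereal \<bar>tent x r (\<iota> e (ereal t)) - tent x r (\<iota> e (ereal s))\<bar> \<le> \<Gamma> (\<iota> e (ereal t)) (\<iota> e (ereal s))"
      by (rule tent_lipschitz)
    also have "\<dots> \<le> \<bar>ereal s - ereal t\<bar>" using st e by (intro \<Gamma>_edge) auto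
    finally show "\<bar>tent x r (\<iota> e (ereal t)) - tent x r (\<iota> e (ereal s))\<bar> \<le> \<bar>t - s\<bar>" by simp
  next
    assume le: "l e = \<infinity>"
    define M where "M = Max (insert 0 ((\<lambda>(e, s). real_of_ereal s) ` pre x)) + r"
    have "tent x r (\<iota> e t) = 0" if t: "ereal M < t" for t
    proof (rule tent_far, rule notI)
      assume less: "\<Gamma> x (\<iota> e t) < ereal r"
      have "r \<le> M" unfolding M_def using finite_pre by (auto intro!: Max_ge)
      then have "0 \<le> M" using good_pos[OF good] by simp
      then have "0 \<le> t" using t by (cases t) auto
      then have "(e, t) \<in> pre (\<iota> e t)" using e le by (simp add: mem_pre)
      from local_dist_converse[OF good less this] obtain s where
        s: "(e, s) \<in> pre x" "\<Gamma> x (\<iota> e t) = \<bar>t - s\<bar>" by blast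
      obtain s' where s': "s = ereal s'" using pre_finite_real good_not_infp[OF good] s(1) by blast
      have "s' \<in> (\<lambda>(e, s). real_of_ereal s) ` pre x" using s(1) s' by force
      then have "s' + r \<le> M" unfolding M_def using finite_pre by (auto intro!: Max_ge)
      then show False using t s(2) s' less by (cases t) auto
    qed
    moreover have "ereal M < \<infinity>" by simp
    ultimately show "\<exists>M. \<forall>t. ereal M < t \<longrightarrow> tent x r (\<iota> e t) = tent x r (\<iota> e \<infinity>)" by metis
  qed
qed

lemma tent_Brat: "good x r \<Longrightarrow> tent x r \<in> Brat \<Gamma>"
  by (simp add: Brat_iff tent_rpa tent_continuous)

text \<open>
  The function that grows from \<open>0\<close> to \<open>1\<close> on the segment \<open>[M, M + 1]\<close> of an infinite edge, is \<open>1\<close> beyond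
  and \<open>0\<close> on the rest of the curve. It does for the infinite end of the edge what tents do for finite
  points. On the ray beyond \<open>M\<close>, each point has exactly one parameter.
\<close>

definition ramp :: "nat \<Rightarrow> real \<Rightarrow> 'p \<Rightarrow> real" where
  "ramp e M y = (if y \<in> \<iota> e ` {ereal M<..\<infinity>}
     then real_of_ereal (min 1 ((THE t. (e, t) \<in> pre y) - ereal M)) else 0)"

lemma ramp_on_ray:
  assumes "e \<in> edges G" "l e = \<infinity>" "0 \<le> M" "0 \<le> t"
  shows "ramp e M (\<iota> e t) = real_of_ereal (min 1 (max 0 (t - ereal M)))"
proof (cases "ereal M < t")
  case True
  then have "0 < t" using assms(3) by (cases t) auto
  have "pre (\<iota> e t) = {(e, t)}" by (rule pre_ray[OF assms(1,2) \<open>0 < t\<close>])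
  then have "(THE s. (e, s) \<in> pre (\<iota> e t)) = t" by auto
  moreover have "\<iota> e t \<in> \<iota> e ` {ereal M<..\<infinity>}" using True by auto
  moreover have "max 0 (t - ereal M) = t - ereal M" using True by (cases t) auto
  ultimately show ?thesis by (simp add: ramp_def)
next
  case False
  have "\<iota> e t \<notin> \<iota> e ` {ereal M<..\<infinity>}"
  proof
    assume "\<iota> e t \<in> \<iota> e ` {ereal M<..\<infinity>}"
    then obtain s where s: "\<iota> e t = \<iota> e s" "ereal M < s" by auto
    then have "0 < s" using assms(3) by (cases s) auto
    have "pre (\<iota> e s) = {(e, s)}" by (rule pre_ray[OF assms(1,2) \<open>0 < s\<close>])
    moreover have "(e, t) \<in> pre (\<iota> e s)" using s assms by (simp add: mem_pre)
    ultimately show False using s False by simp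
  qed
  moreover have "max 0 (t - ereal M) = 0" using False by (cases t) auto
  ultimately show ?thesis by (simp add: ramp_def)
qed

lemma ramp_off_ray:
  assumes "e \<in> edges G" "l e = \<infinity>" "0 \<le> M" "e' \<in> edges G" "e' \<noteq> e" "0 \<le> t" "t \<le> l e'"
  shows "ramp e M (\<iota> e' t) = 0"
proof -
  have "\<iota> e' t \<notin> \<iota> e ` {ereal M<..\<infinity>}"
  proof
    assume "\<iota> e' t \<in> \<iota> e ` {ereal M<..\<infinity>}"
    then obtain s where s: "\<iota> e' t = \<iota> e s" "ereal M < s" by auto
    then have "0 < s" using assms(3) by (cases s) auto
    have "pre (\<iota> e s) = {(e, s)}" by (rule pre_ray[OF assms(1,2) \<open>0 < s\<close>])
    moreover have "(e', t) \<in> pre (\<iota> e s)" using s assms by (simp add: mem_pre)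
    ultimately show False using assms(5) by simp
  qed
  then show ?thesis by (simp add: ramp_def)
qed

lemma ramp_Brat:
  assumes e: "e \<in> edges G" "l e = \<infinity>" "0 \<le> M"
  shows "ramp e M \<in> Brat \<Gamma>"
  unfolding Brat_iff
proof
  show "continuous_on UNIV (ramp e M)"
  proof (rule continuous_from_edges)
    fix e' assume e': "e' \<in> edges G"
    show "continuous_on {0..l e'} (\<lambda>t. ramp e M (\<iota> e' t))"
    proof (cases "e' = e")
      case True
      have "continuous_on {0..l e'} (\<lambda>t. real_of_ereal (min 1 (max 0 (t - ereal M))))"
      proof (rule continuous_on_Icc_lipschitz)
        fix s t :: real
        show "\<bar>real_of_ereal (min 1 (max 0 (ereal t - ereal M))) - real_of_ereal (min 1 (max 0 (ereal s - ereal M)))\<bar> \<le> \<bar>t - s\<bar>"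
          by (auto simp: min_def max_def abs_if one_ereal_def)
        show "\<exists>N. \<forall>t. ereal N < t \<longrightarrow> real_of_ereal (min 1 (max 0 (t - ereal M))) =
            real_of_ereal (min 1 (max 0 (\<infinity> - ereal M)))"
        proof (intro exI[of _ "M + 1"] allI impI)
          fix t assume "ereal (M + 1) < t"
          then show "real_of_ereal (min 1 (max 0 (t - ereal M))) = real_of_ereal (min 1 (max 0 (\<infinity> - ereal M)))"
            by (cases t) (auto simp: min_def max_def one_ereal_def)
        qed
      qed
      then show ?thesis
        by (rule continuous_on_eq) (use ramp_on_ray[OF e] True in simp)
    next
      case False
      then show ?thesis
        by (intro continuous_on_eq[OF continuous_on_const[of _ 0]]) (use ramp_off_ray[OF e e'] in simp)
    qed
  qed
  show "\<forall>e'\<in>edges G. rpa (l e') (\<lambda>t. ramp e M (\<iota> e' (ereal t)))"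
  proof
    fix e' assume e': "e' \<in> edges G"
    show "rpa (l e') (\<lambda>t. ramp e M (\<iota> e' (ereal t)))"
    proof (rule rpaI[of "{M, M + 1}"])
      fix a b assume ab: "0 \<le> a" "a < b" "ereal b \<le> l e'" "{a<..<b} \<inter> {M, M + 1} = {}"
      show "\<exists>(k::int) d. \<forall>t\<in>{a<..<b}. ramp e M (\<iota> e' (ereal t)) = of_int k * t + d"
      proof (cases "e' = e")
        case True
        have r: "ramp e M (\<iota> e' (ereal t)) = min 1 (max 0 (t - M))" if "t \<in> {a<..<b}" for t
          using ramp_on_ray[OF e, of "ereal t"] that ab True by (auto simp: min_def max_def one_ereal_def)
        consider "b \<le> M" | "M \<le> a" "b \<le> M + 1" | "M + 1 \<le> a" using ab(2,4) by force
        then show ?thesis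
        proof cases
          case 1
          then have "\<forall>t\<in>{a<..<b}. ramp e M (\<iota> e' (ereal t)) = of_int 0 * t + 0" using r by auto
          then show ?thesis by blast
        next
          case 2
          then have "\<forall>t\<in>{a<..<b}. ramp e M (\<iota> e' (ereal t)) = of_int 1 * t + (- M)" using r by auto
          then show ?thesis by blast
        next
          case 3
          then have "\<forall>t\<in>{a<..<b}. ramp e M (\<iota> e' (ereal t)) = of_int 0 * t + 1" using r by auto
          then show ?thesis by blast
        qed
      next
        case False
        have "\<forall>t\<in>{a<..<b}. ramp e M (\<iota> e' (ereal t)) = of_int 0 * t + 0"
        proof
          fix t assume t: "t \<in> {a<..<b}"
          then show "ramp e M (\<iota> e' (ereal t)) = of_int 0 * t + 0"
            using ramp_off_ray[OF e e' False, of "ereal t"] real_in_segment[OF ab(3) t] ab(1) by simp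
        qed
        then show ?thesis by blast
      qed
    qed simp
  qed
qed

lemma ball_in_open:
  assumes "open U" "x \<in> U" "\<not> infp x"
  obtains r where "good x r" "\<And>y. \<Gamma> x y < ereal r \<Longrightarrow> y \<in> U"
proof -
  have "\<forall>p\<in>pre x. \<exists>r>0. \<forall>t. 0 \<le> t \<and> t \<le> l (fst p) \<and> \<bar>t - snd p\<bar> < ereal r \<longrightarrow> \<iota> (fst p) t \<in> U"
  proof
    fix p assume p: "p \<in> pre x"
    obtain e s where es: "p = (e, s)" by (cases p)
    obtain s' where s': "s = ereal s'" using pre_finite_real assms(3) p es by blast
    obtain W where W: "open W" "s \<in> W" "\<And>s. s \<in> W \<Longrightarrow> 0 \<le> s \<Longrightarrow> s \<le> l e \<Longrightarrow> \<iota> e s \<in> U"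
      using open_preimage_ereal[OF assms(1) _ assms(2)] p es by blast
    obtain d where d: "d > 0" "{s - d<..<s + d} \<subseteq> W"
      using ereal_open_cont_interval[OF W(1,2)] s' by auto
    obtain r where r: "0 < ereal r" "ereal r < d" using ereal_dense2[OF d(1)] by blast
    have "\<iota> e t \<in> U" if t: "0 \<le> t" "t \<le> l e" "\<bar>t - s\<bar> < ereal r" for t
    proof -
      have "t \<in> {s - d<..<s + d}" using t(3) r s' by (cases t; cases d) auto
      then show ?thesis using d W(3) t by blast
    qed
    then show "\<exists>r>0. \<forall>t. 0 \<le> t \<and> t \<le> l (fst p) \<and> \<bar>t - snd p\<bar> < ereal r \<longrightarrow> \<iota> (fst p) t \<in> U"
      using r es by (intro exI[of _ r]) simp
  qed
  then obtain \<rho> where \<rho>: "\<And>p. p \<in> pre x \<Longrightarrow> 0 < \<rho> p"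
    "\<And>p t. p \<in> pre x \<Longrightarrow> 0 \<le> t \<Longrightarrow> t \<le> l (fst p) \<Longrightarrow> \<bar>t - snd p\<bar> < ereal (\<rho> p) \<Longrightarrow> \<iota> (fst p) t \<in> U"
    by metis
  obtain r0 where r0: "good x r0" using good_exists assms(3) by blast
  define r where "r = Min (insert r0 (\<rho> ` pre x))"
  have fin: "finite (insert r0 (\<rho> ` pre x))" using finite_pre by simp
  have "0 < r" unfolding r_def using fin \<rho>(1) good_pos[OF r0] by (subst Min_gr_iff) auto
  moreover have "r \<le> r0" and r\<rho>: "\<And>p. p \<in> pre x \<Longrightarrow> r \<le> \<rho> p" unfolding r_def using fin by (auto intro!: Min_le)
  ultimately have good: "good x r" using good_mono[OF r0] by blast
  show ?thesis
  proof (rule that[OF good])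
    fix y assume less: "\<Gamma> x y < ereal r"
    obtain e t where et: "(e, t) \<in> pre y" using pre_nonempty by blast
    from local_dist_converse[OF good less et] obtain s where
      s: "(e, s) \<in> pre x" "\<Gamma> x y = \<bar>t - s\<bar>" by blast
    have "\<bar>t - s\<bar> < ereal (\<rho> (e, s))" using less s r\<rho>[OF s(1)] less_le_trans[of "\<Gamma> x y" "ereal r" "ereal (\<rho> (e, s))"] by simp
    then have "\<iota> e t \<in> U" using \<rho>(2)[OF s(1), of t] et by (simp add: mem_pre)
    then show "y \<in> U" using et by (simp add: mem_pre)
  qed
qed

text \<open>
  A small tent over a finite point, or a ramp towards a point at infinity, fits into \<open>U\<close>. Hence the
  topology is determined by the real-valued rational functions.
\<close>

lemma Brat_separates:
  assumes "open U" "x \<in> U"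
  obtains f where "f \<in> Brat \<Gamma>" "\<And>y. 0 \<le> f y" "0 < f x" "\<And>y. y \<notin> U \<Longrightarrow> f y = 0"
proof (cases "infp x")
  case True
  then obtain e where e: "e \<in> edges G" "l e = \<infinity>" "x = \<iota> e \<infinity>" by (auto simp: infp_def)
  obtain M where M: "0 \<le> M" "\<And>t. ereal M < t \<Longrightarrow> \<iota> e t \<in> U"
    using open_contains_tail[OF assms(1) e(1,2)] assms(2) e(3) by blast
  show ?thesis
  proof (rule that[of "ramp e M"])
    show "ramp e M \<in> Brat \<Gamma>" by (rule ramp_Brat[OF e(1,2) M(1)])
    fix y
    show "0 \<le> ramp e M y"
    proof (cases "y \<in> \<iota> e ` {ereal M<..\<infinity>}")
      case True
      then obtain t where t: "y = \<iota> e t" "ereal M < t" by auto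
      then have "0 \<le> t" using M(1) by (cases t) auto
      then show ?thesis using ramp_on_ray[OF e(1,2) M(1)] t(1) by (simp add: real_of_ereal_pos)
    qed (simp add: ramp_def)
    show "0 < ramp e M x" using ramp_on_ray[OF e(1,2) M(1), of \<infinity>] e(3) by (simp add: max_def)
    show "ramp e M y = 0" if "y \<notin> U"
    proof -
      have "y \<notin> \<iota> e ` {ereal M<..\<infinity>}" using M(2) that by auto
      then show ?thesis by (simp add: ramp_def)
    qed
  qed
next
  case False
  obtain r where r: "good x r" "\<And>y. \<Gamma> x y < ereal r \<Longrightarrow> y \<in> U" using ball_in_open[OF assms False] by blast
  show ?thesis
  proof (rule that[of "tent x r"])
    show "tent x r \<in> Brat \<Gamma>" by (rule tent_Brat[OF r(1)])
    show "0 < tent x r x" using tent_pos_iff[of x r x] good_pos[OF r(1)] by simp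
    fix y
    show "0 \<le> tent x r y" by (rule tent_nonneg)
    show "y \<notin> U \<Longrightarrow> tent x r y = 0" using r(2) tent_far by blast
  qed
qed

section \<open>Recognising further models\<close>

lemma Hausdorff: "Hausdorff_space (euclidean :: 'p topology)"
  unfolding Hausdorff_space_def
proof (intro allI impI)
  fix x y :: 'p assume "x \<in> topspace euclidean \<and> y \<in> topspace euclidean \<and> x \<noteq> y"
  then have xy: "x \<in> - {y}" by simp
  have "open (- {y})" using closed_point by (rule open_Compl)
  then obtain f where f: "f \<in> Brat \<Gamma>" "\<And>z. 0 \<le> f z" "0 < f x" "\<And>z. z \<notin> - {y} \<Longrightarrow> f z = 0"
    by (rule Brat_separates[OF _ xy]) (rule that)
  have "f y = 0" by (rule f(4)) simp
  define c where "c = f x / 2"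
  have cont: "continuous_on UNIV f" by (rule Brat_cont[OF f(1)])
  show "\<exists>U V. openin euclidean U \<and> openin euclidean V \<and> x \<in> U \<and> y \<in> V \<and> disjnt U V"
  proof (intro exI conjI)
    show "openin euclidean {z. c < f z}" "openin euclidean {z. f z < c}"
      using cont by (simp_all add: open_Collect_less)
    show "x \<in> {z. c < f z}" "y \<in> {z. f z < c}" using f(3) \<open>f y = 0\<close> by (auto simp: c_def)
    show "disjnt {z. c < f z} {z. f z < c}" by (auto simp: disjnt_def)
  qed
qed

lemma compact_closed: "compact (A :: 'p set) \<Longrightarrow> closed A"
  using compactin_imp_closedin[OF Hausdorff, of A] by simp

text \<open>
  To exhibit another model of the curve, the topology need not be identified: continuous images of
  the compact edges are closed in the Hausdorff space, so that the quotient topology arises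
  automatically as soon as the edges are continuous and cover the space.
\<close>

lemma model_viaI:
  fixes G' :: "('p, nat) mgraph" and l' :: "nat \<Rightarrow> ereal"
  assumes ewg: "edge_weighted_graph G' l'"
    and ends': "\<And>e. e \<in> edges G' \<Longrightarrow> ends G' e = {\<iota>' e 0, \<iota>' e (l' e)}"
    and leaf': "\<And>e. e \<in> edges G' \<Longrightarrow> l' e = \<infinity> \<Longrightarrow> leaf_end G' (\<iota>' e \<infinity>)"
    and inj': "inj_on (\<lambda>(e, t). \<iota>' e t) (SIGMA e:edges G'. {0<..<l' e})"
    and int': "\<And>e t. e \<in> edges G' \<Longrightarrow> 0 < t \<Longrightarrow> t < l' e \<Longrightarrow> \<iota>' e t \<notin> verts G'"
    and cover': "\<And>x. \<exists>e\<in>edges G'. x \<in> \<iota>' e ` {0..l' e}"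
    and cont': "\<And>e. e \<in> edges G' \<Longrightarrow> continuous_on {0..l' e} (\<iota>' e)"
    and D1: "\<And>e s t. \<lbrakk>e \<in> edges G'; s \<in> {0..l' e}; t \<in> {0..l' e}\<rbrakk> \<Longrightarrow> \<Gamma> (\<iota>' e s) (\<iota>' e t) \<le> \<bar>t - s\<bar>"
    and D2: "\<And>e s t. \<lbrakk>e \<in> edges G; s \<in> {0..l e}; t \<in> {0..l e}\<rbrakk> \<Longrightarrow>
      path_dist G' l' \<iota>' (\<iota> e s) (\<iota> e t) \<le> \<bar>t - s\<bar>"
  shows "model_via \<Gamma> G' l' \<iota>'"
proof -
  have fin: "finite (edges G')" using ewg by (simp add: edge_weighted_graph_def graph_def)
  have "open U \<longleftrightarrow> (\<forall>e \<in> edges G'. openin (top_of_set {0..l' e}) {t \<in> {0..l' e}. \<iota>' e t \<in> U})" (is "?L \<longleftrightarrow> ?R") for U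
  proof
    assume ?L
    show ?R
    proof
      fix e assume "e \<in> edges G'"
      then have "openin (top_of_set {0..l' e}) ({0..l' e} \<inter> \<iota>' e -` U)"
        using cont' \<open>open U\<close> unfolding continuous_openin_preimage_eq by blast
      moreover have "{0..l' e} \<inter> \<iota>' e -` U = {t \<in> {0..l' e}. \<iota>' e t \<in> U}" by auto
      ultimately show "openin (top_of_set {0..l' e}) {t \<in> {0..l' e}. \<iota>' e t \<in> U}" by simp
    qed
  next
    assume R: ?R
    let ?C = "\<lambda>e. {t \<in> {0..l' e}. \<iota>' e t \<notin> U}"
    have "compact (\<iota>' e ` ?C e)" if e: "e \<in> edges G'" for e
    proof (rule compact_continuous_image)
      have C: "?C e = {0..l' e} - {t \<in> {0..l' e}. \<iota>' e t \<in> U}" by auto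
      have "closedin (top_of_set {0..l' e}) (?C e)"
        unfolding C by (rule closedin_diff) (use R e in simp_all)
      then have "closed (?C e)" by (rule closedin_closed_trans) simp
      then show "compact (?C e)" by (simp add: compact_eq_closed)
      show "continuous_on (?C e) (\<iota>' e)" by (rule continuous_on_subset[OF cont'[OF e]]) auto
    qed
    then have "closed (\<Union>e\<in>edges G'. \<iota>' e ` ?C e)" using fin compact_closed by (intro closed_UN) auto
    moreover have "(\<Union>e\<in>edges G'. \<iota>' e ` ?C e) = - U"
    proof (intro equalityI subsetI)
      fix x assume "x \<in> - U"
      moreover obtain e t where "e \<in> edges G'" "t \<in> {0..l' e}" "x = \<iota>' e t" using cover'[of x] by blast
      ultimately show "x \<in> (\<Union>e\<in>edges G'. \<iota>' e ` ?C e)" by blast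
    qed auto
    ultimately have "closed (- U)" by (simp only:)
    then show ?L by (simp add: closed_def)
  qed
  moreover have "(UNIV :: 'p set) = verts G' \<union> (\<Union>e \<in> edges G'. \<iota>' e ` {0..l' e})" using cover' by blast
  ultimately have "identification G' l' \<iota>'"
    unfolding identification_def using ends' leaf' inj' int' by auto
  moreover have "\<Gamma> = path_dist G' l' \<iota>'"
  proof (intro ext antisym)
    fix x y
    show "\<Gamma> x y \<le> path_dist G' l' \<iota>' x y"
      by (rule path_dist_greatest) (use \<Gamma>_triangle D1 in auto)
    show "path_dist G' l' \<iota>' x y \<le> \<Gamma> x y"
      unfolding \<Gamma>_eq by (rule path_dist_greatest) (use path_dist_triangle D2 in auto)
  qed
  ultimately show ?thesis using ewg by (simp add: model_via_def)
qed

end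

section \<open>The semifield of rational functions\<close>

context tmodel
begin

lemma Rfin_cont: "f \<in> Rfin \<Longrightarrow> continuous_on UNIV f"
  by (simp add: Rfin_def)

lemma Rfin_not_minf: "f \<in> Rfin \<Longrightarrow> f \<noteq> (\<lambda>_. - \<infinity>)"
  using minf_notin_Rfin by blast

lemma Rfin_tail:
  assumes "f \<in> Rfin" "e \<in> edges G" "l e = \<infinity>"
  obtains M d and k :: int where "0 \<le> M" "\<And>t. M < t \<Longrightarrow> f (\<iota> e (ereal t)) = ereal (of_int k * t + d)"
proof -
  have "rpa \<infinity> (\<lambda>t. real_of_ereal (f (\<iota> e (ereal t))))" using assms unfolding Rfin_iff by force
  then obtain M d and k :: int where *: "0 \<le> M" "\<And>t. M < t \<Longrightarrow> real_of_ereal (f (\<iota> e (ereal t))) = of_int k * t + d"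
    by (rule rpa_at_infinity) (rule that)
  have "f (\<iota> e (ereal t)) = ereal (of_int k * t + d)" if "M < t" for t
  proof -
    have "\<not> infp (\<iota> e (ereal t))" using not_infp_interior assms(2,3) *(1) that by simp
    then have "\<bar>f (\<iota> e (ereal t))\<bar> \<noteq> \<infinity>" by (rule Rfin_real[OF assms(1)])
    then show ?thesis using *(2)[OF that] ereal_real[of "f (\<iota> e (ereal t))"] by simp
  qed
  with *(1) show ?thesis by (rule that)
qed

lemma rat_mult_finite:
  assumes "f \<in> Rfin" "g \<in> Rfin" "\<not> infp x"
  shows "rat_mult \<Gamma> f g x = f x + g x"
  using assms Rfin_not_minf by (simp add: rat_mult_def finite_points_eq)

text \<open>
  Along an infinite edge the sum is eventually affine, so the limit that defines the product at the
  infinite end exists.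
\<close>

lemma rat_mult_tendsto:
  assumes "f \<in> Rfin" "g \<in> Rfin" "infp x"
  shows "((\<lambda>y. f y + g y) \<longlongrightarrow> rat_mult \<Gamma> f g x) (at x within {x. \<not> infp x})"
proof -
  obtain e where e: "e \<in> edges G" "l e = \<infinity>" "x = \<iota> e \<infinity>" using assms(3) by (auto simp: infp_def)
  let ?F = "at x within {x. \<not> infp x}"
  have F: "?F = filtermap (\<lambda>t. \<iota> e (ereal t)) at_top" using at_infp_eq(2)[OF e(1,2)] e(3) by simp
  then have nt: "?F \<noteq> bot" by (simp add: filtermap_bot_iff)
  obtain M d and k :: int where f: "\<And>t. M < t \<Longrightarrow> f (\<iota> e (ereal t)) = ereal (of_int k * t + d)"
    by (rule Rfin_tail[OF assms(1) e(1,2)]) (rule that)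
  obtain M' d' and k' :: int where g: "\<And>t. M' < t \<Longrightarrow> g (\<iota> e (ereal t)) = ereal (of_int k' * t + d')"
    by (rule Rfin_tail[OF assms(2) e(1,2)]) (rule that)
  obtain L where L: "((\<lambda>t. ereal (of_int (k + k') * t + (d + d'))) \<longlongrightarrow> L) at_top" using affine_limit by blast
  have "eventually (\<lambda>t. ereal (of_int (k + k') * t + (d + d')) = f (\<iota> e (ereal t)) + g (\<iota> e (ereal t))) at_top"
    using eventually_gt_at_top[of "max M M'"] by eventually_elim (simp add: f g algebra_simps)
  from Lim_transform_eventually[OF L this]
  have *: "((\<lambda>y. f y + g y) \<longlongrightarrow> L) ?F" unfolding F filterlim_filtermap .
  moreover have "rat_mult \<Gamma> f g x = L"
    using assms Rfin_not_minf tendsto_Lim[OF nt *] by (simp add: rat_mult_def finite_points_eq)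
  ultimately show ?thesis by simp
qed

lemma rat_mult_Rfin:
  assumes "f \<in> Rfin" "g \<in> Rfin"
  shows "rat_mult \<Gamma> f g \<in> Rfin"
  unfolding Rfin_iff
proof (intro conjI ballI allI impI)
  let ?h = "rat_mult \<Gamma> f g"
  have "(?h \<longlongrightarrow> ?h x) (at x)" for x
  proof (cases "infp x")
    case True
    then obtain e where e: "e \<in> edges G" "l e = \<infinity>" "x = \<iota> e \<infinity>" by (auto simp: infp_def)
    have "eventually (\<lambda>y. f y + g y = ?h y) (at x within {x. \<not> infp x})"
      by (simp add: eventually_at_filter rat_mult_finite assms)
    with rat_mult_tendsto[OF assms True] have "(?h \<longlongrightarrow> ?h x) (at x within {x. \<not> infp x})"
      by (rule Lim_transform_eventually)
    then show ?thesis using at_infp_eq[OF e(1,2)] e(3) by simp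
  next
    case False
    have "((\<lambda>y. f y + g y) \<longlongrightarrow> f x + g x) (at x)"
    proof (rule tendsto_add_ereal)
      show "\<bar>f x\<bar> \<noteq> \<infinity>" "\<bar>g x\<bar> \<noteq> \<infinity>"
        by (rule Rfin_real[OF assms(1) False], rule Rfin_real[OF assms(2) False])
      show "(f \<longlongrightarrow> f x) (at x)" "(g \<longlongrightarrow> g x) (at x)"
        using Rfin_cont[OF assms(1)] Rfin_cont[OF assms(2)] by (simp_all add: continuous_on_def)
    qed
    moreover have "eventually (\<lambda>y. f y + g y = ?h y) (at x)"
      using eventually_not_infp[OF False] by eventually_elim (simp add: rat_mult_finite assms)
    ultimately have "(?h \<longlongrightarrow> f x + g x) (at x)" by (rule Lim_transform_eventually)
    then show ?thesis using rat_mult_finite[OF assms False] by simp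
  qed
  then show "continuous_on UNIV ?h" by (simp add: continuous_on_def)
  fix e assume e: "e \<in> edges G"
  have "rpa (l e) (\<lambda>t. real_of_ereal (f (\<iota> e (ereal t))) + real_of_ereal (g (\<iota> e (ereal t))))"
    using assms e unfolding Rfin_iff by (intro rpa_add) auto
  moreover have "real_of_ereal (?h (\<iota> e (ereal t))) = real_of_ereal (f (\<iota> e (ereal t))) + real_of_ereal (g (\<iota> e (ereal t)))"
    if "0 < t" "ereal t < l e" for t
  proof -
    have ni: "\<not> infp (\<iota> e (ereal t))" using not_infp_interior[OF e] that by simp
    have "\<bar>f (\<iota> e (ereal t))\<bar> \<noteq> \<infinity>" "\<bar>g (\<iota> e (ereal t))\<bar> \<noteq> \<infinity>" by (rule Rfin_real[OF assms(1) ni], rule Rfin_real[OF assms(2) ni])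
    then show ?thesis unfolding rat_mult_finite[OF assms ni] by (simp add: real_of_ereal_add)
  qed
  ultimately show "rpa (l e) (\<lambda>t. real_of_ereal (?h (\<iota> e (ereal t))))" using rpa_cong by (metis (mono_tags, lifting))
next
  fix x assume inf: "\<bar>rat_mult \<Gamma> f g x\<bar> = \<infinity>"
  show "infp x"
  proof (rule ccontr)
    assume ni: "\<not> infp x"
    have "\<bar>f x\<bar> \<noteq> \<infinity>" "\<bar>g x\<bar> \<noteq> \<infinity>" by (rule Rfin_real[OF assms(1) ni], rule Rfin_real[OF assms(2) ni])
    then show False using inf unfolding rat_mult_finite[OF assms ni] by (cases "f x"; cases "g x") auto
  qed
qed

lemma ereal_Brat: "g \<in> Brat \<Gamma> \<longleftrightarrow> (\<lambda>x. ereal (g x)) \<in> Rfin"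
proof -
  have "(\<lambda>x. ereal (g x)) \<noteq> (\<lambda>_. - \<infinity>)" by (auto dest: fun_cong)
  then show ?thesis unfolding Brat_def Rat_eq by simp
qed

lemma rat_mult_Brat:
  assumes "f \<in> Brat \<Gamma>" "g \<in> Brat \<Gamma>"
  shows "rat_mult \<Gamma> (\<lambda>x. ereal (f x)) (\<lambda>x. ereal (g x)) = (\<lambda>x. ereal (f x + g x))"
proof (rule continuous_eqI)
  have fg: "(\<lambda>x. ereal (f x)) \<in> Rfin" "(\<lambda>x. ereal (g x)) \<in> Rfin" using assms ereal_Brat by auto
  show "continuous_on UNIV (rat_mult \<Gamma> (\<lambda>x. ereal (f x)) (\<lambda>x. ereal (g x)))"
    by (rule Rfin_cont[OF rat_mult_Rfin[OF fg]])
  show "continuous_on UNIV (\<lambda>x. ereal (f x + g x))"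
    using assms by (intro continuous_intros Brat_cont)
  fix x assume "\<not> infp x"
  then show "rat_mult \<Gamma> (\<lambda>x. ereal (f x)) (\<lambda>x. ereal (g x)) x = ereal (f x + g x)"
    using rat_mult_finite[OF fg] by simp
qed

lemma Rfin_const: "(\<lambda>_. ereal c) \<in> Rfin"
  using Brat_const[of c] ereal_Brat[of "\<lambda>_. c"] by simp

lemma Rfin_max:
  assumes "f \<in> Rfin" "g \<in> Rfin"
  shows "(\<lambda>x. max (f x) (g x)) \<in> Rfin"
  unfolding Rfin_iff
proof (intro conjI ballI allI impI)
  show "continuous_on UNIV (\<lambda>x. max (f x) (g x))" using Rfin_cont assms by (intro continuous_on_max)
  fix e assume e: "e \<in> edges G"
  have "rpa (l e) (\<lambda>t. max (real_of_ereal (f (\<iota> e (ereal t)))) (real_of_ereal (g (\<iota> e (ereal t)))))"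
    using assms e unfolding Rfin_iff by (intro rpa_max) auto
  moreover have "real_of_ereal (max (f (\<iota> e (ereal t))) (g (\<iota> e (ereal t)))) =
      max (real_of_ereal (f (\<iota> e (ereal t)))) (real_of_ereal (g (\<iota> e (ereal t))))"
    if "0 < t" "ereal t < l e" for t
  proof -
    have ni: "\<not> infp (\<iota> e (ereal t))" using not_infp_interior[OF e] that by simp
    have "\<bar>f (\<iota> e (ereal t))\<bar> \<noteq> \<infinity>" "\<bar>g (\<iota> e (ereal t))\<bar> \<noteq> \<infinity>" by (rule Rfin_real[OF assms(1) ni], rule Rfin_real[OF assms(2) ni])
    then show ?thesis by (cases "f (\<iota> e (ereal t))"; cases "g (\<iota> e (ereal t))") (auto simp: max_def)
  qed
  ultimately show "rpa (l e) (\<lambda>t. real_of_ereal (max (f (\<iota> e (ereal t))) (g (\<iota> e (ereal t)))))"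
    using rpa_cong by (metis (mono_tags, lifting))
next
  fix x assume "\<bar>max (f x) (g x)\<bar> = \<infinity>"
  then have "\<bar>f x\<bar> = \<infinity> \<or> \<bar>g x\<bar> = \<infinity>" by (auto simp: max_def split: if_splits)
  then show "infp x" using assms by (auto simp: Rfin_def)
qed

end

section \<open>Automorphisms rescale constants\<close>

lemma additive_mono_linear:
  fixes \<mu> :: "real \<Rightarrow> real"
  assumes add: "\<And>s t. \<mu> (s + t) = \<mu> s + \<mu> t" and mono: "\<And>s t. s \<le> t \<Longrightarrow> \<mu> s \<le> \<mu> t"
  shows "\<mu> t = \<mu> 1 * t"
proof -
  have 0: "\<mu> 0 = 0" using add[of 0 0] by simp
  have mult: "\<mu> (of_nat n * s) = of_nat n * \<mu> s" for n s
    by (induction n) (simp_all add: 0 add algebra_simps)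
  have neg: "\<mu> (- s) = - \<mu> s" for s using add[of s "- s"] 0 by simp
  have int: "\<mu> (of_int k) = of_int k * \<mu> 1" for k
    by (cases k rule: int_cases2) (use mult[of _ 1] neg in simp_all)
  have c: "0 \<le> \<mu> 1" using mono[of 0 1] 0 by simp
  have "\<bar>\<mu> t - \<mu> 1 * t\<bar> * of_nat n \<le> \<mu> 1" for n
  proof -
    let ?m = "\<lfloor>of_nat n * t\<rfloor>"
    have "of_int ?m * \<mu> 1 \<le> of_nat n * \<mu> t" using mono[of "of_int ?m" "of_nat n * t"] int mult by simp
    moreover have "of_nat n * \<mu> t \<le> of_int (?m + 1) * \<mu> 1"
      using mono[of "of_nat n * t" "of_int (?m + 1)"] int[of "?m + 1"] mult[of n t] real_of_int_floor_add_one_ge[of "of_nat n * t"] by simp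
    moreover have "of_int ?m * \<mu> 1 \<le> (of_nat n * t) * \<mu> 1" "(of_nat n * t) * \<mu> 1 \<le> of_int (?m + 1) * \<mu> 1"
      using c real_of_int_floor_add_one_ge[of "of_nat n * t"] by (auto intro!: mult_right_mono)
    ultimately have "\<bar>of_nat n * \<mu> t - (of_nat n * t) * \<mu> 1\<bar> \<le> \<mu> 1" by (simp add: algebra_simps)
    moreover have "of_nat n * \<mu> t - (of_nat n * t) * \<mu> 1 = of_nat n * (\<mu> t - \<mu> 1 * t)" by (simp add: algebra_simps)
    ultimately show ?thesis by (simp add: abs_mult mult.commute)
  qed
  have "\<mu> t - \<mu> 1 * t = 0"
  proof (rule ccontr)
    assume "\<mu> t - \<mu> 1 * t \<noteq> 0"
    then obtain n :: nat where "\<mu> 1 < of_nat n * \<bar>\<mu> t - \<mu> 1 * t\<bar>" using reals_Archimedean3[of "\<bar>\<mu> t - \<mu> 1 * t\<bar>"] by auto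
    then show False using \<open>\<And>n. \<bar>\<mu> t - \<mu> 1 * t\<bar> * of_nat n \<le> \<mu> 1\<close>[of n] by (simp add: mult.commute)
  qed
  then show ?thesis by simp
qed

text \<open>
  What remains of a semiring automorphism on the real-valued rational functions: an automorphism of
  this lattice-ordered group that multiplies all constants by \<open>c\<close>.
\<close>

definition scaling ::
  "'p::topological_space curve \<Rightarrow> real \<Rightarrow> (('p \<Rightarrow> real) \<Rightarrow> 'p \<Rightarrow> real) \<Rightarrow> bool" where
  "scaling \<Gamma> c \<Psi> \<longleftrightarrow> 0 < c \<and> bij_betw \<Psi> (Brat \<Gamma>) (Brat \<Gamma>) \<and>
     (\<forall>f\<in>Brat \<Gamma>. \<forall>g\<in>Brat \<Gamma>. \<Psi> (\<lambda>x. f x + g x) = (\<lambda>x. \<Psi> f x + \<Psi> g x) \<and>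
        \<Psi> (\<lambda>x. max (f x) (g x)) = (\<lambda>x. max (\<Psi> f x) (\<Psi> g x))) \<and>
     (\<forall>t. \<Psi> (\<lambda>_. t) = (\<lambda>_. c * t))"

lemma (in tmodel) Brat_bounded:
  assumes "g \<in> Brat \<Gamma>"
  shows "\<exists>N. \<forall>x. \<bar>g x\<bar> \<le> N"
proof -
  have "compact (range g)" by (rule compact_continuous_image[OF Brat_cont[OF assms] compact_UNIV])
  then have "bounded (range g)" by (rule compact_imp_bounded)
  then obtain N where "\<forall>y\<in>range g. norm y \<le> N" unfolding bounded_iff by blast
  then have "\<forall>x. \<bar>g x\<bar> \<le> N" by simp
  then show ?thesis by blast
qed

locale semiring_aut = tmodel +
  fixes \<psi>
  assumes aut: "\<psi> \<in> Aut_semiring (Rat_semifield \<Gamma>)"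
begin

lemma \<psi>_bij: "bij_betw \<psi> (Rat \<Gamma>) (Rat \<Gamma>)"
  and \<psi>_zero: "\<psi> (\<lambda>_. - \<infinity>) = (\<lambda>_. - \<infinity>)"
  and \<psi>_mult: "f \<in> Rat \<Gamma> \<Longrightarrow> g \<in> Rat \<Gamma> \<Longrightarrow> \<psi> (rat_mult \<Gamma> f g) = rat_mult \<Gamma> (\<psi> f) (\<psi> g)"
  and \<psi>_max: "f \<in> Rat \<Gamma> \<Longrightarrow> g \<in> Rat \<Gamma> \<Longrightarrow> \<psi> (\<lambda>x. max (f x) (g x)) = (\<lambda>x. max (\<psi> f x) (\<psi> g x))"
  using aut unfolding Aut_semiring_def ring_hom_def Rat_semifield_def by auto

lemma Rfin_Rat: "f \<in> Rfin \<Longrightarrow> f \<in> Rat \<Gamma>"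
  by (simp add: Rat_eq)

lemma \<psi>_inj: "f \<in> Rat \<Gamma> \<Longrightarrow> g \<in> Rat \<Gamma> \<Longrightarrow> \<psi> f = \<psi> g \<longleftrightarrow> f = g"
  using bij_betw_imp_inj_on[OF \<psi>_bij] by (auto simp: inj_on_def)

lemma \<psi>_Rfin:
  assumes "f \<in> Rfin"
  shows "\<psi> f \<in> Rfin"
proof -
  have "\<psi> f \<in> Rat \<Gamma>" using bij_betwE[OF \<psi>_bij] Rfin_Rat[OF assms] by blast
  moreover have "\<psi> f \<noteq> (\<lambda>_. - \<infinity>)"
  proof
    assume "\<psi> f = (\<lambda>_. - \<infinity>)"
    then have "\<psi> f = \<psi> (\<lambda>_. - \<infinity>)" using \<psi>_zero by simp
    then have "f = (\<lambda>_. - \<infinity>)" using \<psi>_inj[OF Rfin_Rat[OF assms], of "\<lambda>_. - \<infinity>"] Rat_eq by simp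
    then show False using Rfin_not_minf assms by blast
  qed
  ultimately show ?thesis by (simp add: Rat_eq)
qed

lemma \<psi>_mono:
  assumes "f \<in> Rat \<Gamma>" "g \<in> Rat \<Gamma>" "\<And>x. f x \<le> g x"
  shows "\<psi> f x \<le> \<psi> g x"
proof -
  have "(\<lambda>x. max (f x) (g x)) = g" using assms(3) by (simp add: max_absorb2)
  then have "\<psi> g = (\<lambda>x. max (\<psi> f x) (\<psi> g x))" using \<psi>_max[OF assms(1,2)] by simp
  then have "\<psi> g x = max (\<psi> f x) (\<psi> g x)" by (rule fun_cong)
  then show ?thesis by (metis max.cobounded1)
qed

lemma \<psi>_mono_iff:
  assumes "f \<in> Rat \<Gamma>" "g \<in> Rat \<Gamma>" "(\<lambda>x. max (f x) (g x)) \<in> Rat \<Gamma>" "\<And>x. \<psi> f x \<le> \<psi> g x"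
  shows "f x \<le> g x"
proof -
  have "\<psi> (\<lambda>x. max (f x) (g x)) = \<psi> g" unfolding \<psi>_max[OF assms(1,2)] using assms(4) by (simp add: max_absorb2)
  then have "(\<lambda>x. max (f x) (g x)) = g" using \<psi>_inj[OF assms(3,2)] by simp
  then have "max (f x) (g x) = g x" by (rule fun_cong)
  then show ?thesis by (metis max.cobounded1)
qed

abbreviation cst :: "real \<Rightarrow> 'a \<Rightarrow> ereal" where "cst t \<equiv> (\<lambda>_. ereal t)"

definition cval :: "real \<Rightarrow> 'a \<Rightarrow> real" where "cval t x = real_of_ereal (\<psi> (cst t) x)"

lemma cval_eq: "\<not> infp x \<Longrightarrow> \<psi> (cst t) x = ereal (cval t x)"
  unfolding cval_def using Rfin_real[OF \<psi>_Rfin[OF Rfin_const]] by (simp add: ereal_real)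

lemma cst_mult: "rat_mult \<Gamma> (cst s) (cst t) = cst (s + t)"
  using rat_mult_Brat[OF Brat_const Brat_const] .

lemma cval_add: "\<not> infp x \<Longrightarrow> cval (s + t) x = cval s x + cval t x"
proof -
  assume x: "\<not> infp x"
  have "\<psi> (cst (s + t)) x = rat_mult \<Gamma> (\<psi> (cst s)) (\<psi> (cst t)) x"
    using \<psi>_mult[OF Rfin_Rat[OF Rfin_const] Rfin_Rat[OF Rfin_const]] cst_mult by metis
  also have "\<dots> = \<psi> (cst s) x + \<psi> (cst t) x" by (rule rat_mult_finite[OF \<psi>_Rfin[OF Rfin_const] \<psi>_Rfin[OF Rfin_const] x])
  finally show ?thesis using cval_eq[OF x] by simp
qed

lemma cval_mult: "\<not> infp x \<Longrightarrow> cval (of_nat n * s) x = of_nat n * cval s x"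
proof (induction n)
  case 0
  then show ?case using cval_add[of x 0 0] by simp
next
  case (Suc n)
  then show ?case using cval_add[of x s "of_nat n * s"] by (simp add: algebra_simps)
qed

lemma cval_rpa: "e \<in> edges G \<Longrightarrow> rpa (l e) (\<lambda>t. cval s (\<iota> e (ereal t)))"
  unfolding cval_def using \<psi>_Rfin[OF Rfin_const[of s]] unfolding Rfin_iff by blast

text \<open>
  A constant has \<open>n\<close>-th roots for all \<open>n\<close>, and so has its image. Hence the slopes of the image are
  divisible by all \<open>n\<close>.
\<close>

lemma cval_slope:
  assumes e: "e \<in> edges G" and pq: "0 \<le> p" "p < q" "ereal q \<le> l e"
    and k: "\<forall>t\<in>{p<..<q}. cval s (\<iota> e (ereal t)) = of_int k * t + d"
  shows "k = 0"
proof -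
  \<comment> \<open>An integer that is divisible by something larger than its absolute value is zero.\<close>
  define n where "n = nat \<bar>k\<bar> + 1"
  have n: "int n = \<bar>k\<bar> + 1" by (simp add: n_def)
  have pl: "ereal p < l e" using less_le_trans[of "ereal p" "ereal q" "l e"] pq by simp
  obtain \<delta> d' and k' :: int where \<delta>: "0 < \<delta>" "ereal (p + \<delta>) \<le> l e"
    "\<And>t. p < t \<Longrightarrow> t < p + \<delta> \<Longrightarrow> cval (s / of_nat n) (\<iota> e (ereal t)) = of_int k' * t + d'"
    by (rule rpa_right[OF cval_rpa[OF e] pq(1) pl]) (rule that)
  have "of_int k * t + d = of_int (int n * k') * t + of_nat n * d'" if t: "t \<in> {p<..<min q (p + \<delta>)}" for t
  proof -
    have "ereal t \<le> l e" using order_trans[OF _ pq(3), of "ereal t"] t by simp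
    then have ni: "\<not> infp (\<iota> e (ereal t))" using not_infp_interior[OF e] t pq by simp
    have "cval s (\<iota> e (ereal t)) = of_nat n * cval (s / of_nat n) (\<iota> e (ereal t))"
      using cval_mult[OF ni, of n "s / of_nat n"] by (simp add: n_def)
    then show ?thesis using k \<delta>(3)[of t] t by (simp add: algebra_simps)
  qed
  then have "k = int n * k'" using affine_eq_on_segment(1)[of p "min q (p + \<delta>)" k d "int n * k'" "of_nat n * d'"] pq \<delta>(1) by auto
  then have "k = (\<bar>k\<bar> + 1) * k'" by (simp only: n)
  then have "(\<bar>k\<bar> + 1) dvd k" by (rule dvdI)
  then show "k = 0" using zdvd_imp_le[of "\<bar>k\<bar> + 1" "\<bar>k\<bar>"] by fastforce
qed

lemma cval_const_edge:
  assumes e: "e \<in> edges G" and ab: "0 \<le> a" "a \<le> b" "ereal b \<le> l e"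
  shows "cval s (\<iota> e (ereal b)) = cval s (\<iota> e (ereal a))"
proof (rule rpa_constant[OF cval_rpa[OF e] ab])
  have ni: "\<not> infp (\<iota> e (ereal t))" if "t \<in> {a..b}" for t
    using not_infp_interior[OF e] order_trans[OF _ ab(3), of "ereal t"] that ab by simp
  have "continuous_on {a..b} (\<lambda>t. \<psi> (cst s) (\<iota> e (ereal t)))"
  proof (rule continuous_on_compose2[OF Rfin_cont[OF \<psi>_Rfin[OF Rfin_const]]])
    show "continuous_on {a..b} (\<lambda>t. \<iota> e (ereal t))"
      by (rule continuous_on_subset[OF continuous_edge_real[OF e]]) (use ab order_trans[OF _ ab(3)] in auto)
  qed simp
  moreover have "\<psi> (cst s) (\<iota> e (ereal t)) = ereal (cval s (\<iota> e (ereal t)))" if "t \<in> {a..b}" for t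
    using cval_eq ni that by simp
  ultimately have "continuous_on {a..b} (\<lambda>t. ereal (cval s (\<iota> e (ereal t))))"
    by (rule continuous_on_eq)
  then show "continuous_on {a..b} (\<lambda>t. cval s (\<iota> e (ereal t)))"
    unfolding continuous_on_def lim_ereal .
qed (use cval_slope[OF e] in blast)

lemma \<psi>_cst: "\<exists>r. \<psi> (cst s) = cst r"
proof -
  let ?F = "\<psi> (cst s)"
  have real: "?F (\<iota> e (ereal t)) = ?F (\<iota> e 0)" if e: "e \<in> edges G" "0 \<le> t" "ereal t \<le> l e" for e t
  proof -
    have "ereal 0 \<le> l e" using less_imp_le[OF l_pos[OF e(1)]] by (simp add: zero_ereal_def)
    then have "\<not> infp (\<iota> e (ereal t))" "\<not> infp (\<iota> e (ereal 0))"
      using not_infp_interior[OF e(1)] e by simp_all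
    then show ?thesis using cval_eq cval_const_edge[OF e(1) _ e(2,3)] by (simp add: zero_ereal_def)
  qed
  have all: "?F (\<iota> e t) = ?F (\<iota> e 0)" if e: "e \<in> edges G" "t \<in> {0..l e}" for e t
  proof (cases t)
    case PInf
    then have le: "l e = \<infinity>" using e by simp
    have nt: "at (\<iota> e \<infinity>) \<noteq> bot" unfolding at_infp_eq(1)[OF e(1) le] by (simp add: filtermap_bot_iff)
    have "eventually (\<lambda>x. ?F (\<iota> e 0) = ?F x) (at (\<iota> e \<infinity>))"
      unfolding at_infp_eq(1)[OF e(1) le] eventually_filtermap
      using eventually_ge_at_top[of 0] by eventually_elim (use real[OF e(1)] le in simp)
    then have "(?F \<longlongrightarrow> ?F (\<iota> e 0)) (at (\<iota> e \<infinity>))"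
      by (rule Lim_transform_eventually[OF tendsto_const])
    moreover have "(?F \<longlongrightarrow> ?F (\<iota> e \<infinity>)) (at (\<iota> e \<infinity>))"
      using Rfin_cont[OF \<psi>_Rfin[OF Rfin_const[of s]]] by (simp add: continuous_on_def)
    ultimately show ?thesis using tendsto_unique[OF nt] PInf by blast
  qed (use real e in auto)
  have "?F (\<iota> e s') = ?F (\<iota> e t)" if "e \<in> edges G" "s' \<in> {0..l e}" "t \<in> {0..l e}" for e s' t
    using all[OF that(1,2)] all[OF that(1,3)] by simp
  then have const: "?F x = ?F y" for x y by (rule constant_from_edges)
  obtain x where x: "\<not> infp x" using ex_finite_point by blast
  have "?F = cst (cval s x)"
  proof
    fix y show "?F y = ereal (cval s x)" using const[of y x] cval_eq[OF x] by simp
  qed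
  then show ?thesis by blast
qed

lemma \<psi>_constants: "\<exists>c>0. \<forall>t. \<psi> (cst t) = cst (c * t)"
proof -
  obtain \<mu> where \<mu>: "\<And>t. \<psi> (cst t) = cst (\<mu> t)" using \<psi>_cst by metis
  obtain x where x: "\<not> infp x" using ex_finite_point by blast
  have cv: "cval t x = \<mu> t" for t using \<mu> by (simp add: cval_def)
  have add: "\<mu> (s + t) = \<mu> s + \<mu> t" for s t using cval_add[OF x] cv by simp
  have mono: "\<mu> s \<le> \<mu> t" if "s \<le> t" for s t
    using \<psi>_mono[OF Rfin_Rat[OF Rfin_const] Rfin_Rat[OF Rfin_const], of s t] that \<mu> by simp
  have lin: "\<mu> t = \<mu> 1 * t" for t using additive_mono_linear[of \<mu>] add mono by blast
  have "\<mu> 1 \<noteq> \<mu> 0"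
  proof
    assume "\<mu> 1 = \<mu> 0"
    then have "\<psi> (cst 1) = \<psi> (cst 0)" using \<mu> by simp
    then have "cst 1 = cst 0" using \<psi>_inj[OF Rfin_Rat[OF Rfin_const] Rfin_Rat[OF Rfin_const]] by blast
    then show False by (auto dest: fun_cong)
  qed
  then have "0 < \<mu> 1" using lin[of 0] mono[of 0 1] by simp
  moreover have "\<psi> (cst t) = cst (\<mu> 1 * t)" for t using \<mu>[of t] lin[of t] by simp
  ultimately show ?thesis by blast
qed

lemma bounded_Brat:
  assumes "f \<in> Rfin" "\<And>x. ereal (- N) \<le> f x" "\<And>x. f x \<le> ereal N"
  obtains g where "g \<in> Brat \<Gamma>" "f = (\<lambda>x. ereal (g x))"
proof (rule that[of "\<lambda>x. real_of_ereal (f x)"])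
  have "\<bar>f x\<bar> \<noteq> \<infinity>" for x using assms(2)[of x] assms(3)[of x] by (cases "f x") auto
  then show eq: "f = (\<lambda>x. ereal (real_of_ereal (f x)))" by (simp add: ereal_real)
  show "(\<lambda>x. real_of_ereal (f x)) \<in> Brat \<Gamma>" unfolding ereal_Brat using assms(1) eq by simp
qed

text \<open>
  The order and the real constants determine which functions are bounded, so an automorphism restricts
  to the real-valued rational functions.
\<close>

lemma scaling_exists:
  obtains c \<Psi> where "scaling \<Gamma> c \<Psi>" "\<And>t. \<psi> (\<lambda>_. ereal t) = (\<lambda>_. ereal (c * t))"
proof -
  obtain c where c: "c > 0" "\<And>t. \<psi> (cst t) = cst (c * t)" using \<psi>_constants by blast
  define \<Psi> where "\<Psi> g = (\<lambda>x. real_of_ereal (\<psi> (\<lambda>x. ereal (g x)) x))" for g :: "'a \<Rightarrow> real"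
  have img: "\<exists>h\<in>Brat \<Gamma>. \<psi> (\<lambda>x. ereal (g x)) = (\<lambda>x. ereal (h x))" if g: "g \<in> Brat \<Gamma>" for g
  proof -
    obtain N where N: "\<And>x. \<bar>g x\<bar> \<le> N" using Brat_bounded[OF g] by blast
    have gR: "(\<lambda>x. ereal (g x)) \<in> Rfin" using g ereal_Brat by simp
    have "cst (- N) x \<le> ereal (g x)" "ereal (g x) \<le> cst N x" for x using N[of x] by auto
    then have "\<psi> (cst (- N)) x \<le> \<psi> (\<lambda>x. ereal (g x)) x" "\<psi> (\<lambda>x. ereal (g x)) x \<le> \<psi> (cst N) x" for x
      using \<psi>_mono[OF Rfin_Rat[OF Rfin_const] Rfin_Rat[OF gR]] \<psi>_mono[OF Rfin_Rat[OF gR] Rfin_Rat[OF Rfin_const]] by blast+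
    then have *: "ereal (- (c * N)) \<le> \<psi> (\<lambda>x. ereal (g x)) x" "\<psi> (\<lambda>x. ereal (g x)) x \<le> ereal (c * N)" for x
      using c(2) by simp_all
    obtain h where "h \<in> Brat \<Gamma>" "\<psi> (\<lambda>x. ereal (g x)) = (\<lambda>x. ereal (h x))"
      by (rule bounded_Brat[OF \<psi>_Rfin[OF gR] *]) (rule that)
    then show ?thesis by blast
  qed
  have \<Psi>: "\<Psi> g \<in> Brat \<Gamma> \<and> \<psi> (\<lambda>x. ereal (g x)) = (\<lambda>x. ereal (\<Psi> g x))" if "g \<in> Brat \<Gamma>" for g
    using img[OF that] unfolding \<Psi>_def by auto
  have gR: "(\<lambda>x. ereal (g x)) \<in> Rat \<Gamma>" if "g \<in> Brat \<Gamma>" for g using that by (simp add: Brat_def)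
  have "scaling \<Gamma> c \<Psi>"
    unfolding scaling_def
  proof (intro conjI ballI allI)
    show "0 < c" by fact
    show "\<Psi> (\<lambda>_. t) = (\<lambda>_. c * t)" for t using c(2) by (simp add: \<Psi>_def)
    fix f g assume fg: "f \<in> Brat \<Gamma>" "g \<in> Brat \<Gamma>"
    have "(\<lambda>x. ereal (\<Psi> (\<lambda>x. f x + g x) x)) = \<psi> (\<lambda>x. ereal (f x + g x))" using \<Psi>[OF Brat_add[OF fg]] by simp
    also have "\<dots> = \<psi> (rat_mult \<Gamma> (\<lambda>x. ereal (f x)) (\<lambda>x. ereal (g x)))" using rat_mult_Brat[OF fg] by simp
    also have "\<dots> = rat_mult \<Gamma> (\<psi> (\<lambda>x. ereal (f x))) (\<psi> (\<lambda>x. ereal (g x)))" using \<psi>_mult gR fg by blast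
    also have "\<dots> = rat_mult \<Gamma> (\<lambda>x. ereal (\<Psi> f x)) (\<lambda>x. ereal (\<Psi> g x))" using \<Psi> fg by simp
    also have "\<dots> = (\<lambda>x. ereal (\<Psi> f x + \<Psi> g x))" using \<Psi> fg by (intro rat_mult_Brat) auto
    finally show "\<Psi> (\<lambda>x. f x + g x) = (\<lambda>x. \<Psi> f x + \<Psi> g x)" by (auto dest: fun_cong)
    have "(\<lambda>x. ereal (\<Psi> (\<lambda>x. max (f x) (g x)) x)) = \<psi> (\<lambda>x. ereal (max (f x) (g x)))" using \<Psi>[OF Brat_max[OF fg]] by simp
    also have "(\<lambda>x. ereal (max (f x) (g x))) = (\<lambda>x. max (ereal (f x)) (ereal (g x)))" by auto
    also have "\<psi> \<dots> = (\<lambda>x. max (\<psi> (\<lambda>x. ereal (f x)) x) (\<psi> (\<lambda>x. ereal (g x)) x))" using \<psi>_max gR fg by blast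
    also have "\<dots> = (\<lambda>x. max (ereal (\<Psi> f x)) (ereal (\<Psi> g x)))" using \<Psi> fg by simp
    finally have "ereal (\<Psi> (\<lambda>x. max (f x) (g x)) x) = max (ereal (\<Psi> f x)) (ereal (\<Psi> g x))" for x by (rule fun_cong)
    then have "ereal (\<Psi> (\<lambda>x. max (f x) (g x)) x) = ereal (max (\<Psi> f x) (\<Psi> g x))" for x
      by (simp only: ereal_max)
    then have "\<Psi> (\<lambda>x. max (f x) (g x)) x = max (\<Psi> f x) (\<Psi> g x)" for x by (simp only: ereal.inject)
    then show "\<Psi> (\<lambda>x. max (f x) (g x)) = (\<lambda>x. max (\<Psi> f x) (\<Psi> g x))" by (rule ext)
  next
    show "bij_betw \<Psi> (Brat \<Gamma>) (Brat \<Gamma>)"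
      unfolding bij_betw_def
    proof
      show "inj_on \<Psi> (Brat \<Gamma>)"
      proof (rule inj_onI)
        fix f g assume fg: "f \<in> Brat \<Gamma>" "g \<in> Brat \<Gamma>" "\<Psi> f = \<Psi> g"
        then have "\<psi> (\<lambda>x. ereal (f x)) = \<psi> (\<lambda>x. ereal (g x))" using \<Psi> by simp
        then have "(\<lambda>x. ereal (f x)) = (\<lambda>x. ereal (g x))" using \<psi>_inj[OF gR gR] fg by blast
        then show "f = g" by (auto dest: fun_cong)
      qed
      show "\<Psi> ` Brat \<Gamma> = Brat \<Gamma>"
      proof
        show "\<Psi> ` Brat \<Gamma> \<subseteq> Brat \<Gamma>" using \<Psi> by blast
        show "Brat \<Gamma> \<subseteq> \<Psi> ` Brat \<Gamma>"
        proof
          fix h assume h: "h \<in> Brat \<Gamma>"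
          obtain f where f: "f \<in> Rat \<Gamma>" "\<psi> f = (\<lambda>x. ereal (h x))"
            using bij_betw_imp_surj_on[OF \<psi>_bij] gR[OF h] by (metis imageE)
          have "f \<noteq> (\<lambda>_. - \<infinity>)" using f(2) \<psi>_zero by (auto dest: fun_cong)
          then have fR: "f \<in> Rfin" using f(1) by (simp add: Rat_eq)
          obtain N where N: "\<And>x. \<bar>h x\<bar> \<le> N" using Brat_bounded[OF h] by blast
          have "\<psi> f x \<le> \<psi> (cst (N / c)) x" for x using N[of x] c f(2) by simp
          then have 1: "f x \<le> ereal (N / c)" for x
            using \<psi>_mono_iff[OF f(1) Rfin_Rat[OF Rfin_const] Rfin_Rat[OF Rfin_max[OF fR Rfin_const]]] by blast
          have "\<psi> (cst (- (N / c))) x \<le> \<psi> f x" for x using N[of x] c f(2) by simp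
          then have 2: "ereal (- (N / c)) \<le> f x" for x
            using \<psi>_mono_iff[OF Rfin_Rat[OF Rfin_const] f(1) Rfin_Rat[OF Rfin_max[OF Rfin_const fR]]] by blast
          obtain g where g: "g \<in> Brat \<Gamma>" "f = (\<lambda>x. ereal (g x))" by (rule bounded_Brat[OF fR 2 1]) (rule that)
          then have "\<Psi> g = h" using f(2) by (simp add: \<Psi>_def)
          then show "h \<in> \<Psi> ` Brat \<Gamma>" using g(1) by blast
        qed
      qed
    qed
  qed
  then show ?thesis using c(2) that by blast
qed

end

lemma scaling_inverse:
  assumes s: "scaling \<Gamma> c \<Psi>"
    and add: "\<And>f g. f \<in> Brat \<Gamma> \<Longrightarrow> g \<in> Brat \<Gamma> \<Longrightarrow> (\<lambda>x. f x + g x) \<in> Brat \<Gamma>"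
    and max: "\<And>f g. f \<in> Brat \<Gamma> \<Longrightarrow> g \<in> Brat \<Gamma> \<Longrightarrow> (\<lambda>x. max (f x) (g x)) \<in> Brat \<Gamma>"
    and const: "\<And>t. (\<lambda>_. t) \<in> Brat \<Gamma>"
  shows "scaling \<Gamma> (1 / c) (inv_into (Brat \<Gamma>) \<Psi>)"
proof -
  let ?I = "inv_into (Brat \<Gamma>) \<Psi>"
  have bij: "bij_betw \<Psi> (Brat \<Gamma>) (Brat \<Gamma>)" and c: "0 < c"
    and \<Psi>: "\<And>f g. f \<in> Brat \<Gamma> \<Longrightarrow> g \<in> Brat \<Gamma> \<Longrightarrow> \<Psi> (\<lambda>x. f x + g x) = (\<lambda>x. \<Psi> f x + \<Psi> g x)"
    "\<And>f g. f \<in> Brat \<Gamma> \<Longrightarrow> g \<in> Brat \<Gamma> \<Longrightarrow> \<Psi> (\<lambda>x. max (f x) (g x)) = (\<lambda>x. max (\<Psi> f x) (\<Psi> g x))"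
    "\<And>t. \<Psi> (\<lambda>_. t) = (\<lambda>_. c * t)"
    using s by (auto simp: scaling_def)
  have bijI: "bij_betw ?I (Brat \<Gamma>) (Brat \<Gamma>)" by (rule bij_betw_inv_into[OF bij])
  have I: "?I f \<in> Brat \<Gamma>" "\<Psi> (?I f) = f" if "f \<in> Brat \<Gamma>" for f
    using bij_betwE[OF bijI] bij_betw_inv_into_right[OF bij] that by auto
  have eq: "?I f = g" if "g \<in> Brat \<Gamma>" "\<Psi> g = f" for f g
    using bij_betw_inv_into_left[OF bij that(1)] that(2) by simp
  show ?thesis
    unfolding scaling_def
  proof (intro conjI ballI allI)
    show "0 < 1 / c" using c by simp
    fix f g assume fg: "f \<in> Brat \<Gamma>" "g \<in> Brat \<Gamma>"
    show "?I (\<lambda>x. f x + g x) = (\<lambda>x. ?I f x + ?I g x)"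
      using I fg by (intro eq add) (simp_all add: \<Psi>(1))
    show "?I (\<lambda>x. max (f x) (g x)) = (\<lambda>x. max (?I f x) (?I g x))"
      using I fg by (intro eq max) (simp_all add: \<Psi>(2))
  next
    show "?I (\<lambda>_. t) = (\<lambda>_. 1 / c * t)" for t
      using c by (intro eq const) (simp add: \<Psi>(3))
  qed (rule bijI)
qed

section \<open>The homeomorphism behind a scaling\<close>

context tmodel
begin

lemma Brat_eqI:
  assumes "\<And>f. f \<in> Brat \<Gamma> \<Longrightarrow> f x = f y"
  shows "x = y"
proof (rule ccontr)
  assume "x \<noteq> y"
  then have xy: "x \<in> - {y}" by simp
  have op: "open (- {y})" using closed_point by (rule open_Compl)
  obtain f where f: "f \<in> Brat \<Gamma>" "0 < f x" "\<And>z. z \<notin> - {y} \<Longrightarrow> f z = 0"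
    by (rule Brat_separates[OF op xy]) (rule that)
  then show False using assms[OF f(1)] f(2) f(3)[of y] by simp
qed

text \<open>
  A real-valued rational function is bounded, so its last slope on an infinite edge is zero.
\<close>

lemma Brat_const_at_infp:
  assumes "g \<in> Brat \<Gamma>" "infp x"
  obtains U d where "open U" "x \<in> U" "\<And>y. y \<in> U \<Longrightarrow> y \<noteq> x \<Longrightarrow> g y = d"
proof -
  obtain e where e: "e \<in> edges G" "l e = \<infinity>" "x = \<iota> e \<infinity>" using assms(2) by (auto simp: infp_def)
  have "rpa \<infinity> (\<lambda>t. g (\<iota> e (ereal t)))" using Brat_rpa[OF assms(1) e(1)] e(2) by simp
  then obtain M d and k :: int where M: "0 \<le> M" "\<And>t. M < t \<Longrightarrow> g (\<iota> e (ereal t)) = of_int k * t + d"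
    by (rule rpa_at_infinity) (rule that)
  obtain N where N: "\<And>x. \<bar>g x\<bar> \<le> N" using Brat_bounded[OF assms(1)] by blast
  have "k = 0"
  proof (rule ccontr)
    assume "k \<noteq> 0"
    then have k: "1 \<le> \<bar>real_of_int k\<bar>" by simp
    define t where "t = max M (N + \<bar>d\<bar>) + 1"
    have t: "M < t" "N + \<bar>d\<bar> < t" "0 < t" using M(1) by (auto simp: t_def)
    have "1 * t \<le> \<bar>real_of_int k\<bar> * t" by (rule mult_right_mono[OF k]) (use t in simp)
    then have "t \<le> \<bar>of_int k * t\<bar>" using t by (simp add: abs_mult)
    moreover have "\<bar>of_int k * t + d\<bar> \<le> N" using N[of "\<iota> e (ereal t)"] M(2)[OF t(1)] by simp
    ultimately show False using t(2) by linarith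
  qed
  show ?thesis
  proof (rule that[of "\<iota> e ` {ereal M<..\<infinity>}" d])
    show "open (\<iota> e ` {ereal M<..\<infinity>})" using e M(1) by (intro open_ray) auto
    show "x \<in> \<iota> e ` {ereal M<..\<infinity>}" using e(3) by auto
    fix y assume y: "y \<in> \<iota> e ` {ereal M<..\<infinity>}" "y \<noteq> x"
    then obtain s where s: "y = \<iota> e s" "ereal M < s" by auto
    then obtain t where t: "s = ereal t" using y(2) e(3) by (cases s) auto
    then show "g y = d" using s M(2)[of t] \<open>k = 0\<close> by simp
  qed
qed

lemma sphere_nonempty:
  assumes "good x r" "0 < \<delta>" "\<delta> < r"
  shows "\<exists>z. \<Gamma> x z = ereal \<delta>"
proof -
  obtain e s where es: "(e, s) \<in> pre x" using pre_nonempty by blast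
  obtain s' where s': "s = ereal s'" using pre_finite_real good_not_infp assms(1) es by blast
  have e: "e \<in> edges G" "0 \<le> s'" "ereal s' \<le> l e" using es s' by (auto simp: mem_pre)
  show ?thesis
  proof (cases "s = l e")
    case False
    then have "ereal (2 * r) \<le> \<bar>l e - s\<bar>" using goodD[OF assms(1) es, of "l e"] by simp
    then have "ereal (s' + \<delta>) \<le> l e" using e s' assms(2,3) by (cases "l e") auto
    then have "\<Gamma> x (\<iota> e (ereal (s' + \<delta>))) = \<bar>ereal (s' + \<delta>) - s\<bar>"
      using s' e assms by (intro local_dist[OF assms(1) es]) auto
    then show ?thesis using s' assms(2) by auto
  next
    case True
    then have "s \<noteq> 0" using l_pos[OF e(1)] by auto
    then have "ereal (2 * r) \<le> \<bar>0 - s\<bar>" using goodD[OF assms(1) es, of 0] by simp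
    then have "\<delta> \<le> s'" using s' e assms(2,3) by auto
    moreover have "ereal (s' - \<delta>) \<le> l e" using True s' assms(2) by (metis ereal_less_eq(3) diff_le_eq le_add_same_cancel1 less_imp_le)
    ultimately have "\<Gamma> x (\<iota> e (ereal (s' - \<delta>))) = \<bar>ereal (s' - \<delta>) - s\<bar>"
      using s' e assms by (intro local_dist[OF assms(1) es]) auto
    then show ?thesis using s' assms(2) by auto
  qed
qed

lemma Brat_edge_continuous:
  assumes "g \<in> Brat \<Gamma>" "e \<in> edges G" "0 \<le> a" "ereal b \<le> l e"
  shows "continuous_on {a..b} (\<lambda>t. g (\<iota> e (ereal t)))"
proof (rule continuous_on_compose2[OF Brat_cont[OF assms(1)]])
  have "{a..b} \<subseteq> {t. 0 \<le> t \<and> ereal t \<le> l e}"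
    using assms(3) order_trans[OF _ assms(4)] by auto
  then show "continuous_on {a..b} (\<lambda>t. \<iota> e (ereal t))"
    by (rule continuous_on_subset[OF continuous_edge_real[OF assms(2)]])
qed simp

text \<open>
  On either side of \<open>t0\<close> there is a single affine piece next to \<open>t0\<close>, and by continuity it includes the
  value at \<open>t0\<close>.
\<close>

lemma Brat_local_lipschitz:
  assumes g: "g \<in> Brat \<Gamma>" and e: "e \<in> edges G" and t0: "0 \<le> t0" "ereal t0 \<le> l e"
    and slope: "\<And>p q d (k::int). \<lbrakk>0 \<le> p; p < q; ereal q \<le> l e; \<forall>t\<in>{p<..<q}. g (\<iota> e (ereal t)) = of_int k * t + d\<rbrakk> \<Longrightarrow> \<bar>k\<bar> \<le> 1"
  obtains \<delta> where "0 < \<delta>"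
    "\<And>t. \<lbrakk>0 \<le> t; ereal t \<le> l e; \<bar>t - t0\<bar> < \<delta>\<rbrakk> \<Longrightarrow> \<bar>g (\<iota> e (ereal t)) - g (\<iota> e (ereal t0))\<bar> \<le> \<bar>t - t0\<bar>"
proof -
  let ?u = "\<lambda>t. g (\<iota> e (ereal t))"
  have rpa: "rpa (l e) ?u" by (rule Brat_rpa[OF g e])
  have le: "\<bar>?u t - ?u t0\<bar> \<le> \<bar>t - t0\<bar>" if "?u t = of_int k * t + d" "?u t0 = of_int k * t0 + d" "\<bar>k\<bar> \<le> 1" for t d and k :: int
  proof -
    have "?u t - ?u t0 = of_int k * (t - t0)" using that(1,2) by (simp add: algebra_simps)
    moreover have "\<bar>real_of_int k\<bar> \<le> 1" using that(3) by linarith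
    ultimately show ?thesis using mult_right_mono[of "\<bar>real_of_int k\<bar>" 1 "\<bar>t - t0\<bar>"] by (simp add: abs_mult)
  qed
  have R: "\<exists>\<delta>>0. \<forall>t. t0 < t \<and> t < t0 + \<delta> \<and> ereal t \<le> l e \<longrightarrow> \<bar>?u t - ?u t0\<bar> \<le> \<bar>t - t0\<bar>"
  proof (cases "ereal t0 < l e")
    case True
    obtain \<delta> d and k :: int where \<delta>: "0 < \<delta>" "ereal (t0 + \<delta>) \<le> l e" "\<And>t. t0 < t \<Longrightarrow> t < t0 + \<delta> \<Longrightarrow> ?u t = of_int k * t + d"
      by (rule rpa_right[OF rpa t0(1) True]) (rule that)
    have aff: "?u t = of_int k * t + d" if "t \<in> {t0..t0 + \<delta>}" for t
      by (rule affine_on_closure[OF _ Brat_edge_continuous[OF g e t0(1) \<delta>(2)] \<delta>(3) that]) (use \<delta>(1) in simp)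
    have k: "\<bar>k\<bar> \<le> 1" using slope[OF t0(1) _ \<delta>(2), of k d] \<delta>(1,3) by simp
    show ?thesis using \<delta>(1) le[OF aff aff k] by (intro exI[of _ \<delta>]) simp
  next
    case False
    then have "l e = ereal t0" using t0 by simp
    then show ?thesis by (intro exI[of _ 1]) auto
  qed
  have L: "\<exists>\<delta>>0. \<forall>t. t0 - \<delta> < t \<and> t < t0 \<and> 0 \<le> t \<longrightarrow> \<bar>?u t - ?u t0\<bar> \<le> \<bar>t - t0\<bar>"
  proof (cases "0 < t0")
    case True
    obtain \<delta> d and k :: int where \<delta>: "0 < \<delta>" "\<delta> \<le> t0" "\<And>t. t0 - \<delta> < t \<Longrightarrow> t < t0 \<Longrightarrow> ?u t = of_int k * t + d"
      by (rule rpa_left[OF rpa True t0(2)]) (rule that)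
    have t0\<delta>: "0 \<le> t0 - \<delta>" using \<delta>(2) by simp
    have aff: "?u t = of_int k * t + d" if "t \<in> {t0 - \<delta>..t0}" for t
      by (rule affine_on_closure[OF _ Brat_edge_continuous[OF g e t0\<delta> t0(2)] \<delta>(3) that]) (use \<delta>(1) in simp)
    have k: "\<bar>k\<bar> \<le> 1" using slope[OF t0\<delta> _ t0(2), of k d] \<delta>(1,3) by simp
    show ?thesis using \<delta>(1) le[OF aff aff k] by (intro exI[of _ \<delta>]) simp
  next
    case False
    then show ?thesis using t0 by (intro exI[of _ 1]) auto
  qed
  obtain \<delta>1 where \<delta>1: "\<delta>1 > 0" "\<And>t. t0 < t \<Longrightarrow> t < t0 + \<delta>1 \<Longrightarrow> ereal t \<le> l e \<Longrightarrow> \<bar>?u t - ?u t0\<bar> \<le> \<bar>t - t0\<bar>" using R by blast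
  obtain \<delta>2 where \<delta>2: "\<delta>2 > 0" "\<And>t. t0 - \<delta>2 < t \<Longrightarrow> t < t0 \<Longrightarrow> 0 \<le> t \<Longrightarrow> \<bar>?u t - ?u t0\<bar> \<le> \<bar>t - t0\<bar>" using L by blast
  show ?thesis
  proof (rule that[of "min \<delta>1 \<delta>2"])
    show "0 < min \<delta>1 \<delta>2" using \<delta>1 \<delta>2 by simp
    fix t assume t: "0 \<le> t" "ereal t \<le> l e" "\<bar>t - t0\<bar> < min \<delta>1 \<delta>2"
    consider "t = t0" | "t0 < t" | "t < t0" by linarith
    then show "\<bar>?u t - ?u t0\<bar> \<le> \<bar>t - t0\<bar>"
    proof cases
      case 2
      then show ?thesis using \<delta>1(2)[of t] t by auto
    next
      case 3
      then show ?thesis using \<delta>2(2)[of t] t by auto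
    qed simp
  qed
qed

end

locale scaled = tmodel +
  fixes c \<Psi>
  assumes scaling: "scaling \<Gamma> c \<Psi>"
begin

lemma c_pos: "0 < c" and \<Psi>_bij: "bij_betw \<Psi> (Brat \<Gamma>) (Brat \<Gamma>)"
  and \<Psi>_add: "f \<in> Brat \<Gamma> \<Longrightarrow> g \<in> Brat \<Gamma> \<Longrightarrow> \<Psi> (\<lambda>x. f x + g x) = (\<lambda>x. \<Psi> f x + \<Psi> g x)"
  and \<Psi>_max: "f \<in> Brat \<Gamma> \<Longrightarrow> g \<in> Brat \<Gamma> \<Longrightarrow> \<Psi> (\<lambda>x. max (f x) (g x)) = (\<lambda>x. max (\<Psi> f x) (\<Psi> g x))"
  and \<Psi>_const: "\<Psi> (\<lambda>_. t) = (\<lambda>_. c * t)"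
  using scaling by (auto simp: scaling_def)

lemma \<Psi>_Brat: "f \<in> Brat \<Gamma> \<Longrightarrow> \<Psi> f \<in> Brat \<Gamma>"
  using bij_betwE[OF \<Psi>_bij] by blast

lemma \<Psi>_surj: "g \<in> Brat \<Gamma> \<Longrightarrow> \<exists>f\<in>Brat \<Gamma>. \<Psi> f = g"
  using bij_betw_imp_surj_on[OF \<Psi>_bij] by (metis imageE)

lemma \<Psi>_uminus:
  assumes "f \<in> Brat \<Gamma>"
  shows "\<Psi> (\<lambda>x. - f x) = (\<lambda>x. - \<Psi> f x)"
proof -
  have "\<Psi> (\<lambda>x. f x + - f x) = (\<lambda>x. \<Psi> f x + \<Psi> (\<lambda>x. - f x) x)"
    by (rule \<Psi>_add[OF assms Brat_uminus[OF assms]])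
  then have "(\<lambda>x. \<Psi> f x + \<Psi> (\<lambda>x. - f x) x) = (\<lambda>_. 0)" using \<Psi>_const[of 0] by simp
  then have "\<Psi> f x + \<Psi> (\<lambda>x. - f x) x = 0" for x by (rule fun_cong)
  then show ?thesis by (intro ext) (simp add: add_eq_0_iff)
qed

lemma \<Psi>_sum:
  assumes "finite A" "\<And>i. i \<in> A \<Longrightarrow> f i \<in> Brat \<Gamma>"
  shows "\<Psi> (\<lambda>x. \<Sum>i\<in>A. f i x) = (\<lambda>x. \<Sum>i\<in>A. \<Psi> (f i) x)"
  using assms
proof (induction A rule: finite_induct)
  case empty
  show ?case using \<Psi>_const[of 0] by simp
next
  case (insert i A)
  then show ?case using \<Psi>_add[OF insert.prems[of i] Brat_sum[of A f]] by simp
qed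

lemma \<Psi>_lower_bound:
  assumes "f \<in> Brat \<Gamma>" "\<And>x. t \<le> f x"
  shows "c * t \<le> \<Psi> f x"
proof -
  have "(\<lambda>x. max t (f x)) = f" using assms(2) by (simp add: max_absorb2)
  then have "\<Psi> f = (\<lambda>x. max (\<Psi> (\<lambda>_. t) x) (\<Psi> f x))" using \<Psi>_max[OF Brat_const assms(1), of t] by simp
  then have "\<Psi> f x = max (\<Psi> (\<lambda>_. t) x) (\<Psi> f x)" by (rule fun_cong)
  then show ?thesis unfolding \<Psi>_const by linarith
qed

text \<open>
  Evaluation of \<open>\<Psi> f / c\<close> at a point is a homomorphism to the reals that fixes constants, and
  each of these is the evaluation at a point: otherwise, each \<open>x\<close> has a nonnegative \<open>f\<close> in the kernel
  with \<open>f x > 0\<close>, and by compactness a finite sum of such \<open>f\<close> lies in the kernel and has a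
  positive lower bound.
\<close>

lemma \<phi>_exists: "\<exists>x. \<forall>f\<in>Brat \<Gamma>. \<Psi> f y = c * f x"
proof (rule ccontr)
  assume none: "\<not> ?thesis"
  have "\<exists>h\<in>Brat \<Gamma>. (\<forall>z. 0 \<le> h z) \<and> 0 < h x \<and> \<Psi> h y = 0" for x
  proof -
    obtain f where f: "f \<in> Brat \<Gamma>" "\<Psi> f y \<noteq> c * f x" using none by blast
    define b where "b = \<Psi> f y / c"
    define p where "p = (\<lambda>x. f x + - b)"
    have p: "p \<in> Brat \<Gamma>" unfolding p_def by (rule Brat_add[OF f(1) Brat_const])
    have "\<Psi> p y = 0" using \<Psi>_add[OF f(1) Brat_const, of "- b"] \<Psi>_const[of "- b"] c_pos by (simp add: p_def b_def)
    define h where "h = (\<lambda>x. max (p x) (- p x))"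
    have "h \<in> Brat \<Gamma>" unfolding h_def by (rule Brat_max[OF p Brat_uminus[OF p]])
    moreover have "\<Psi> h y = 0"
      using \<Psi>_max[OF p Brat_uminus[OF p]] \<Psi>_uminus[OF p] \<open>\<Psi> p y = 0\<close> by (simp add: h_def)
    moreover have "p x \<noteq> 0" using f(2) c_pos by (auto simp: p_def b_def field_simps)
    then have "0 < h x" by (auto simp: h_def less_max_iff_disj)
    moreover have "\<forall>z. 0 \<le> h z" by (auto simp: h_def le_max_iff_disj)
    ultimately show ?thesis by blast
  qed
  then obtain h where h: "\<And>x. h x \<in> Brat \<Gamma>" "\<And>x z. 0 \<le> h x z" "\<And>x. 0 < h x x" "\<And>x. \<Psi> (h x) y = 0"
    by metis
  have "\<exists>A\<subseteq>UNIV. finite A \<and> UNIV \<subseteq> (\<Union>x\<in>A. {z. 0 < h x z})"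
  proof (rule compactE_image[OF compact_UNIV, of UNIV "\<lambda>x. {z. 0 < h x z}"])
    show "open {z. 0 < h x z}" for x
      using Brat_cont[OF h(1)[of x]] by (simp add: open_Collect_less)
    show "UNIV \<subseteq> (\<Union>x\<in>UNIV. {z. 0 < h x z})" using h(3) by blast
  qed blast
  then obtain A where A: "finite A" "UNIV \<subseteq> (\<Union>x\<in>A. {z. 0 < h x z})" by blast
  define H where "H = (\<lambda>z. \<Sum>x\<in>A. h x z)"
  have HB: "H \<in> Brat \<Gamma>" unfolding H_def by (rule Brat_sum[OF A(1) h(1)])
  have Hpos: "0 < H z" for z
  proof -
    obtain x where "x \<in> A" "0 < h x z" using A(2) by blast
    then show ?thesis unfolding H_def by (intro sum_pos2[OF A(1)]) (auto simp: h(2))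
  qed
  obtain w where w: "\<And>z. H w \<le> H z"
    using continuous_attains_inf[OF compact_UNIV _ Brat_cont[OF HB]] by auto
  have "c * H w \<le> \<Psi> H y" by (rule \<Psi>_lower_bound[OF HB w])
  moreover have "\<Psi> H y = 0" unfolding H_def using \<Psi>_sum[OF A(1) h(1)] h(4) by simp
  ultimately show False using mult_pos_pos[OF c_pos Hpos[of w]] by simp
qed

definition \<phi> :: "'a \<Rightarrow> 'a" where "\<phi> y = (SOME x. \<forall>f\<in>Brat \<Gamma>. \<Psi> f y = c * f x)"

lemma \<Psi>_\<phi>: "f \<in> Brat \<Gamma> \<Longrightarrow> \<Psi> f y = c * f (\<phi> y)"
  using someI_ex[OF \<phi>_exists[of y]] unfolding \<phi>_def by blast

lemma \<phi>_continuous: "open U \<Longrightarrow> open (\<phi> -` U)"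
proof -
  assume U: "open U"
  have "\<exists>V. open V \<and> y \<in> V \<and> V \<subseteq> \<phi> -` U" if "y \<in> \<phi> -` U" for y
  proof -
    have "\<phi> y \<in> U" using that by simp
    obtain f where f: "f \<in> Brat \<Gamma>" "0 < f (\<phi> y)" "\<And>z. z \<notin> U \<Longrightarrow> f z = 0"
      by (rule Brat_separates[OF U \<open>\<phi> y \<in> U\<close>]) (rule that)
    let ?V = "{z. 0 < \<Psi> f z}"
    have "open ?V" using Brat_cont[OF \<Psi>_Brat[OF f(1)]] by (simp add: open_Collect_less)
    moreover have "y \<in> ?V" using f(2) c_pos by (simp add: \<Psi>_\<phi>[OF f(1)])
    moreover have "?V \<subseteq> \<phi> -` U"
    proof
      fix z assume "z \<in> ?V"
      then have "f (\<phi> z) \<noteq> 0" by (auto simp: \<Psi>_\<phi>[OF f(1)])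
      then show "z \<in> \<phi> -` U" using f(3) by auto
    qed
    ultimately show ?thesis by blast
  qed
  then show ?thesis by (subst open_subopen) blast
qed

lemma inverse_scaled: "scaled \<Gamma> G l \<iota> (1 / c) (inv_into (Brat \<Gamma>) \<Psi>)"
  by (intro scaled.intro tmodel_axioms scaled_axioms.intro scaling_inverse[OF scaling] Brat_add Brat_max Brat_const)

definition \<phi>i :: "'a \<Rightarrow> 'a" where "\<phi>i = scaled.\<phi> \<Gamma> (1 / c) (inv_into (Brat \<Gamma>) \<Psi>)"

lemma \<phi>i_eq: "f \<in> Brat \<Gamma> \<Longrightarrow> f x = \<Psi> f (\<phi>i x) / c"
  using scaled.\<Psi>_\<phi>[OF inverse_scaled \<Psi>_Brat, of f x] bij_betw_inv_into_left[OF \<Psi>_bij, of f]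
  by (simp add: \<phi>i_def)

lemma \<phi>_\<phi>i: "\<phi> (\<phi>i x) = x"
proof (rule Brat_eqI)
  fix f assume f: "f \<in> Brat \<Gamma>"
  show "f (\<phi> (\<phi>i x)) = f x" unfolding \<phi>i_eq[OF f, of x] \<Psi>_\<phi>[OF f] using c_pos by simp
qed

lemma \<phi>i_\<phi>: "\<phi>i (\<phi> x) = x"
proof (rule Brat_eqI)
  fix f assume "f \<in> Brat \<Gamma>"
  then obtain g where g: "g \<in> Brat \<Gamma>" "\<Psi> g = f" using \<Psi>_surj by blast
  then show "f (\<phi>i (\<phi> x)) = f x" using \<phi>i_eq[OF g(1), of "\<phi> x"] \<Psi>_\<phi>[OF g(1), of x] c_pos by (simp add: field_simps)
qed

lemma \<phi>i_continuous: "open U \<Longrightarrow> open (\<phi>i -` U)"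
  unfolding \<phi>i_def by (rule scaled.\<phi>_continuous[OF inverse_scaled])

text \<open>
  Near a point at infinity every real-valued rational function is constant, whereas a tent is not
  constant near its top.
\<close>

lemma \<phi>_not_infp:
  assumes "\<not> infp y"
  shows "\<not> infp (\<phi> y)"
proof
  assume inf: "infp (\<phi> y)"
  obtain r where r: "good y r" using good_exists[OF assms] by blast
  obtain g where g: "g \<in> Brat \<Gamma>" "\<Psi> g = tent y r" using \<Psi>_surj[OF tent_Brat[OF r]] by blast
  obtain U d where U: "open U" "\<phi> y \<in> U" "\<And>z. z \<in> U \<Longrightarrow> z \<noteq> \<phi> y \<Longrightarrow> g z = d"
    by (rule Brat_const_at_infp[OF g(1) inf]) (rule that)
  have y: "y \<in> \<phi> -` U" using U(2) by simp
  obtain \<rho> where \<rho>: "good y \<rho>" "\<And>z. \<Gamma> y z < ereal \<rho> \<Longrightarrow> z \<in> \<phi> -` U"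
    by (rule ball_in_open[OF \<phi>_continuous[OF U(1)] y assms]) (rule that)
  define s where "s = min r \<rho>"
  have s: "0 < s" "s \<le> r" "s \<le> \<rho>" using good_pos[OF r] good_pos[OF \<rho>(1)] by (auto simp: s_def)
  have val: "r - \<delta> = c * d" if \<delta>: "0 < \<delta>" "\<delta> < s" for \<delta>
  proof -
    obtain z where z: "\<Gamma> y z = ereal \<delta>" using sphere_nonempty[OF r \<delta>(1)] \<delta>(2) s by auto
    have "z \<noteq> y" using z \<delta>(1) by auto
    then have "\<phi> z \<noteq> \<phi> y" using \<phi>i_\<phi> by metis
    moreover have "\<phi> z \<in> U" using \<rho>(2)[of z] z \<delta> s by simp
    ultimately have "g (\<phi> z) = d" using U(3) by blast
    then have "tent y r z = c * d" using \<Psi>_\<phi>[OF g(1), of z] g(2) by simp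
    moreover have "tent y r z = r - \<delta>" using tent_near[of y z r] z \<delta> s by simp
    ultimately show ?thesis by simp
  qed
  show False using val[of "s / 2"] val[of "s / 3"] s(1) by simp
qed

text \<open>
  If \<open>\<Psi> f\<close> has a slope \<open>k\<close>, then on some open set it is a \<open>k\<close>-th power of a rational function up to
  a constant. Then so is \<open>f\<close> on an open set, where \<open>f\<close> is then constant in case its slopes are
  smaller than \<open>k\<close>. Hence \<open>\<Psi> f\<close> is constant on an open set on which it has slope \<open>k\<close>.
\<close>

lemma \<Psi>_slope:
  assumes f: "f \<in> Brat \<Gamma>" and lip: "\<And>y z. ereal \<bar>f y - f z\<bar> \<le> \<Gamma> y z"
    and e: "e \<in> edges G" and ab: "0 \<le> a" "a < b" "ereal b \<le> l e"
    and k: "\<forall>t\<in>{a<..<b}. \<Psi> f (\<iota> e (ereal t)) = of_int k * t + d"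
  shows "\<bar>k\<bar> \<le> 1"
proof (rule ccontr)
  assume "\<not> \<bar>k\<bar> \<le> 1"
  then have k2: "2 \<le> \<bar>k\<bar>" by simp
  \<comment> \<open>The tent over the midpoint has slope \<open>-1\<close> on the right of it.\<close>
  define m r where "m = (a + b) / 2" and "r = (b - a) / 4"
  have r: "0 < r" "2 * r \<le> m" "m + 2 * r = b" "a < m" using ab by (auto simp: m_def r_def field_simps)
  let ?x = "\<iota> e (ereal m)"
  have good: "good ?x r" using good_interior[OF e r(1,2)] r(3) ab(3) by simp
  define \<tau> where "\<tau> = tent ?x r"
  have \<tau>: "\<tau> (\<iota> e (ereal t)) = r - (t - m)" if t: "m < t" "t < m + r" for t
  proof -
    have "\<Gamma> ?x (\<iota> e (ereal t)) = ereal \<bar>t - m\<bar>"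
      by (rule interior_dist[OF e, of _ _ r]) (use t r ab(3) in auto)
    then show ?thesis using tent_near[of ?x "\<iota> e (ereal t)" r] t by (simp add: \<tau>_def)
  qed
  obtain g where g: "g \<in> Brat \<Gamma>" "\<Psi> g = \<tau>" using \<Psi>_surj[OF tent_Brat[OF good]] by (auto simp: \<tau>_def)
  define W where "W = \<iota> e ` {ereal m<..<ereal (m + r)}"
  have mrl: "ereal (m + r) \<le> l e" using order_trans[OF _ ab(3), of "ereal (m + r)"] r by simp
  have "open W" unfolding W_def using e r mrl by (intro open_segment_image) auto
  have W: "\<exists>t. m < t \<and> t < m + r \<and> y = \<iota> e (ereal t)" if "y \<in> W" for y
  proof -
    obtain s where s: "y = \<iota> e s" "ereal m < s" "s < ereal (m + r)" using \<open>y \<in> W\<close> by (auto simp: W_def)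
    then obtain t where "s = ereal t" by (cases s) auto
    then show ?thesis using s by auto
  qed
  define C where "C = of_int k * (r + m) + d"
  have \<Psi>fg: "\<Psi> f y = - of_int k * \<tau> y + C" if "y \<in> W" for y
  proof -
    obtain t where t: "m < t" "t < m + r" "y = \<iota> e (ereal t)" using W[OF \<open>y \<in> W\<close>] by blast
    have "t = m + r - \<tau> y" using \<tau>[OF t(1,2)] t(3) by simp
    moreover have "\<Psi> f y = of_int k * t + d" using k r t by simp
    ultimately have "\<Psi> f y = of_int k * (m + r - \<tau> y) + d" by simp
    then show ?thesis by (simp add: C_def algebra_simps)
  qed
  have fg: "f z = - of_int k * g z + C / c" if "\<phi>i z \<in> W" for z
  proof -
    have "c * f z = - of_int k * (c * g z) + C"
      using \<Psi>fg[OF that] \<Psi>_\<phi>[OF f, of "\<phi>i z"] \<Psi>_\<phi>[OF g(1), of "\<phi>i z"] g(2) by (simp add: \<phi>_\<phi>i)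
    then show ?thesis using c_pos by (simp add: field_simps)
  qed
  have "\<iota> e (ereal (m + r / 2)) \<in> W" using r(1) by (auto simp: W_def)
  then have "\<phi> (\<iota> e (ereal (m + r / 2))) \<in> \<phi>i -` W" by (simp add: \<phi>i_\<phi>)
  then obtain e' a' b' where seg: "e' \<in> edges G" "0 \<le> a'" "a' < b'" "ereal b' \<le> l e'"
    "\<And>t. a' < t \<Longrightarrow> t < b' \<Longrightarrow> \<iota> e' (ereal t) \<in> \<phi>i -` W"
    by (rule open_contains_segment[OF \<phi>i_continuous[OF \<open>open W\<close>]]) (rule that)
  have a'l: "ereal a' < l e'" using less_le_trans[of "ereal a'" "ereal b'" "l e'"] seg by simp
  obtain \<delta>1 df and kf :: int where f1: "0 < \<delta>1" "ereal (a' + \<delta>1) \<le> l e'" "\<And>t. a' < t \<Longrightarrow> t < a' + \<delta>1 \<Longrightarrow> f (\<iota> e' (ereal t)) = of_int kf * t + df"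
    by (rule rpa_right[OF Brat_rpa[OF f seg(1)] seg(2) a'l]) (rule that)
  obtain \<delta>2 dg and kg :: int where g1: "0 < \<delta>2" "ereal (a' + \<delta>2) \<le> l e'" "\<And>t. a' < t \<Longrightarrow> t < a' + \<delta>2 \<Longrightarrow> g (\<iota> e' (ereal t)) = of_int kg * t + dg"
    by (rule rpa_right[OF Brat_rpa[OF g(1) seg(1)] seg(2) a'l]) (rule that)
  define b1 where "b1 = min b' (min (a' + \<delta>1) (a' + \<delta>2))"
  have b1: "a' < b1" "b1 \<le> b'" "b1 \<le> a' + \<delta>1" "b1 \<le> a' + \<delta>2" using seg f1 g1 by (auto simp: b1_def)
  have "kf = - k * kg"
  proof (rule affine_eq_on_segment(1)[OF b1(1), of kf df "- k * kg" "- of_int k * dg + C / c"])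
    fix t assume t: "t \<in> {a'<..<b1}"
    have "f (\<iota> e' (ereal t)) = - of_int k * g (\<iota> e' (ereal t)) + C / c" using fg seg(5)[of t] t b1 by simp
    then show "of_int kf * t + df = of_int (- k * kg) * t + (- of_int k * dg + C / c)"
      using f1(3)[of t] g1(3)[of t] t b1 by (simp add: algebra_simps)
  qed
  moreover have "\<bar>kf\<bar> \<le> 1"
  proof -
    define s t where "s = (2 * a' + b1) / 3" and "t = (a' + 2 * b1) / 3"
    have st: "a' < s" "s < t" "t < b1" using b1(1) by (auto simp: s_def t_def)
    have "ereal t \<le> l e'" "ereal s \<le> l e'" using order_trans[OF _ seg(4)] st b1 by auto
    then have "\<Gamma> (\<iota> e' (ereal s)) (\<iota> e' (ereal t)) \<le> \<bar>ereal t - ereal s\<bar>" using st seg by (intro \<Gamma>_edge) auto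
    then have "ereal \<bar>f (\<iota> e' (ereal s)) - f (\<iota> e' (ereal t))\<bar> \<le> \<bar>ereal t - ereal s\<bar>" using lip order_trans by blast
    then have "\<bar>of_int kf * (s - t)\<bar> \<le> \<bar>s - t\<bar>" using f1(3)[of s] f1(3)[of t] st b1 by (simp add: algebra_simps)
    then have "\<bar>real_of_int kf\<bar> * \<bar>s - t\<bar> \<le> 1 * \<bar>s - t\<bar>" by (simp add: abs_mult)
    then have "\<bar>real_of_int kf\<bar> \<le> 1" using st by (subst (asm) mult_le_cancel_right) auto
    then show ?thesis by linarith
  qed
  ultimately have "\<bar>k\<bar> * \<bar>kg\<bar> \<le> 1" by (simp add: abs_mult)
  have "kg = 0"
  proof (rule ccontr)
    assume "kg \<noteq> 0"
    then have "2 * 1 \<le> \<bar>k\<bar> * \<bar>kg\<bar>" using k2 by (intro mult_mono) auto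
    then show False using \<open>\<bar>k\<bar> * \<bar>kg\<bar> \<le> 1\<close> by simp
  qed
  then have "kf = 0" using \<open>kf = - k * kg\<close> by simp
  define Z where "Z = \<iota> e' ` {ereal a'<..<ereal b1}"
  have "ereal b1 \<le> l e'" using order_trans[OF _ seg(4), of "ereal b1"] b1 by simp
  then have "open Z" unfolding Z_def using seg by (intro open_segment_image) auto
  have Z: "\<phi>i z \<in> W \<and> f z = df" if "z \<in> Z" for z
  proof -
    obtain s where s: "z = \<iota> e' s" "ereal a' < s" "s < ereal b1" using \<open>z \<in> Z\<close> by (auto simp: Z_def)
    then obtain t where "s = ereal t" by (cases s) auto
    then show ?thesis using s seg(5)[of t] f1(3)[of t] b1 \<open>kf = 0\<close> by simp
  qed
  have "\<iota> e' (ereal ((a' + b1) / 2)) \<in> Z" using b1(1) by (auto simp: Z_def)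
  then have "\<phi>i (\<iota> e' (ereal ((a' + b1) / 2))) \<in> \<phi> -` Z" by (simp add: \<phi>_\<phi>i)
  then obtain e1 p q where pq: "e1 \<in> edges G" "0 \<le> p" "p < q" "ereal q \<le> l e1"
    "\<And>t. p < t \<Longrightarrow> t < q \<Longrightarrow> \<iota> e1 (ereal t) \<in> \<phi> -` Z"
    by (rule open_contains_segment[OF \<phi>_continuous[OF \<open>open Z\<close>]]) (rule that)
  have "of_int k * t + d = of_int 0 * t + c * df" if t: "t \<in> {p<..<q}" for t
  proof -
    let ?y = "\<iota> e1 (ereal t)"
    have "?y \<in> W" using Z[of "\<phi> ?y"] pq(5)[of t] t by (simp add: \<phi>i_\<phi>)
    then obtain s where s: "m < s" "s < m + r" "?y = \<iota> e (ereal s)" using W by blast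
    have sl: "ereal s < l e" using less_le_trans[OF _ mrl, of "ereal s"] s by simp
    have "ereal t < l e1" by (rule real_in_segment[OF pq(4) t])
    then have "s = t" using inj_interior(2)[OF pq(1) e, of "ereal t" "ereal s"] s sl t pq(2) r by simp
    then have "\<Psi> f ?y = of_int k * t + d" using k s r by simp
    moreover have "\<Psi> f ?y = c * df" using Z[of "\<phi> ?y"] pq(5)[of t] t \<Psi>_\<phi>[OF f, of ?y] by simp
    ultimately show ?thesis by simp
  qed
  then have "k = 0" using affine_eq_on_segment(1)[OF pq(3), of k d 0 "c * df"] by blast
  then show False using k2 by simp
qed

text \<open>
  The tent over \<open>\<phi> (\<iota> e t0)\<close> measures the distance from this point, and its image under \<open>\<Psi>\<close> is
  1-Lipschitz along \<open>e\<close>.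
\<close>

lemma \<phi>_local_lipschitz:
  assumes e: "e \<in> edges G" and t0: "0 \<le> t0" "ereal t0 \<le> l e"
  obtains \<delta> where "0 < \<delta>"
    "\<And>t. \<lbrakk>0 \<le> t; ereal t \<le> l e; \<bar>t - t0\<bar> < \<delta>\<rbrakk> \<Longrightarrow> \<Gamma> (\<phi> (\<iota> e (ereal t0))) (\<phi> (\<iota> e (ereal t))) \<le> ereal (\<bar>t - t0\<bar> / c)"
proof -
  let ?y = "\<iota> e (ereal t0)"
  have "\<not> infp (\<phi> ?y)" using \<phi>_not_infp not_infp_interior[OF e t0] by blast
  then obtain r where r: "good (\<phi> ?y) r" using good_exists by blast
  let ?f = "tent (\<phi> ?y) r"
  have f: "?f \<in> Brat \<Gamma>" by (rule tent_Brat[OF r])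
  obtain \<delta> where \<delta>: "0 < \<delta>"
    "\<And>t. \<lbrakk>0 \<le> t; ereal t \<le> l e; \<bar>t - t0\<bar> < \<delta>\<rbrakk> \<Longrightarrow> \<bar>\<Psi> ?f (\<iota> e (ereal t)) - \<Psi> ?f ?y\<bar> \<le> \<bar>t - t0\<bar>"
  proof (rule Brat_local_lipschitz[OF \<Psi>_Brat[OF f] e t0])
    show "\<bar>k\<bar> \<le> 1" if "0 \<le> p" "p < q" "ereal q \<le> l e" "\<forall>t\<in>{p<..<q}. \<Psi> ?f (\<iota> e (ereal t)) = of_int k * t + d" for p q d k
      by (rule \<Psi>_slope[OF f tent_lipschitz e that])
  qed (rule that)
  have r0: "0 < r" by (rule good_pos[OF r])
  have top: "?f (\<phi> ?y) = r" using tent_near[of "\<phi> ?y" "\<phi> ?y" r] r0 by (simp add: zero_ereal_def)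
  show ?thesis
  proof (rule that[of "min \<delta> (c * r)"])
    show "0 < min \<delta> (c * r)" using \<delta>(1) c_pos r0 by simp
    fix t assume t: "0 \<le> t" "ereal t \<le> l e" "\<bar>t - t0\<bar> < min \<delta> (c * r)"
    let ?z = "\<phi> (\<iota> e (ereal t))"
    have "\<bar>c * ?f ?z - c * r\<bar> \<le> \<bar>t - t0\<bar>" using \<delta>(2)[of t] t by (simp add: \<Psi>_\<phi>[OF f] top)
    then have *: "c * (r - ?f ?z) \<le> \<bar>t - t0\<bar>" by (simp add: algebra_simps)
    then have "c * (r - ?f ?z) < c * r" using t(3) by simp
    then have "0 < ?f ?z" using c_pos by simp
    then have "\<Gamma> (\<phi> ?y) ?z < ereal r" by (simp add: tent_pos_iff)
    then have "\<Gamma> (\<phi> ?y) ?z = ereal (r - ?f ?z)" by (rule tent_near)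
    moreover have "r - ?f ?z \<le> \<bar>t - t0\<bar> / c" using * c_pos by (simp add: field_simps)
    ultimately show "\<Gamma> (\<phi> ?y) ?z \<le> ereal (\<bar>t - t0\<bar> / c)" by simp
  qed
qed

text \<open>
  The local estimates add up along the edge by the triangle inequality.
\<close>

lemma \<phi>_edge_lipschitz_real:
  assumes e: "e \<in> edges G" and ab: "0 \<le> a" "a \<le> b" "ereal b \<le> l e"
  shows "\<Gamma> (\<phi> (\<iota> e (ereal a))) (\<phi> (\<iota> e (ereal b))) \<le> ereal ((b - a) / c)"
proof -
  let ?d = "\<lambda>p q. \<Gamma> (\<phi> (\<iota> e (ereal p))) (\<phi> (\<iota> e (ereal q)))"
  define P where "P p q \<longleftrightarrow> (a \<le> p \<and> q \<le> b \<longrightarrow> ?d p q \<le> ereal ((q - p) / c))" for p q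
  have "P a b"
  proof (rule Bolzano[OF ab(2)])
    fix p q r assume *: "P p q" "P q r" "p \<le> q" "q \<le> r"
    show "P p r"
      unfolding P_def
    proof
      assume "a \<le> p \<and> r \<le> b"
      then have "?d p q \<le> ereal ((q - p) / c)" "?d q r \<le> ereal ((r - q) / c)" using * by (auto simp: P_def)
      then have "?d p q + ?d q r \<le> ereal ((q - p) / c) + ereal ((r - q) / c)" by (rule add_mono)
      also have "\<dots> = ereal ((r - p) / c)" by (simp add: diff_divide_distrib)
      finally show "?d p r \<le> ereal ((r - p) / c)" using \<Gamma>_triangle order_trans by blast
    qed
  next
    fix x assume x: "a \<le> x" "x \<le> b"
    have x': "0 \<le> x" "ereal x \<le> l e" using x ab order_trans[OF _ ab(3), of "ereal x"] by auto
    obtain \<delta> where \<delta>: "0 < \<delta>"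
      "\<And>t. \<lbrakk>0 \<le> t; ereal t \<le> l e; \<bar>t - x\<bar> < \<delta>\<rbrakk> \<Longrightarrow> ?d x t \<le> ereal (\<bar>t - x\<bar> / c)"
      by (rule \<phi>_local_lipschitz[OF e x']) (rule that)
    have "P p q" if pq: "p \<le> x" "x \<le> q" "q - p < \<delta>" for p q
      unfolding P_def
    proof
      assume *: "a \<le> p \<and> q \<le> b"
      have "?d x p \<le> ereal (\<bar>p - x\<bar> / c)" "?d x q \<le> ereal (\<bar>q - x\<bar> / c)"
        by (rule \<delta>(2); use * pq ab order_trans[OF _ ab(3), of "ereal p"] in force)
          (rule \<delta>(2); use * pq ab order_trans[OF _ ab(3), of "ereal q"] in force)
      then have "?d p x + ?d x q \<le> ereal (\<bar>p - x\<bar> / c) + ereal (\<bar>q - x\<bar> / c)"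
        unfolding \<Gamma>_sym[of "\<phi> (\<iota> e (ereal p))"] by (rule add_mono)
      also have "\<dots> = ereal ((q - p) / c)" using pq by (simp add: diff_divide_distrib abs_if)
      finally show "?d p q \<le> ereal ((q - p) / c)" using \<Gamma>_triangle order_trans by blast
    qed
    then show "\<exists>\<delta>>0. \<forall>p q. p \<le> x \<and> x \<le> q \<and> q - p < \<delta> \<longrightarrow> P p q" using \<delta>(1) by blast
  qed
  then show ?thesis by (simp add: P_def)
qed

lemma \<phi>_edge_lipschitz:
  assumes e: "e \<in> edges G" and st: "s \<in> {0..l e}" "t \<in> {0..l e}"
  shows "ereal c * \<Gamma> (\<phi> (\<iota> e s)) (\<phi> (\<iota> e t)) \<le> \<bar>t - s\<bar>"
proof (cases "s = \<infinity> \<or> t = \<infinity>")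
  case True
  then have "\<bar>t - s\<bar> = \<infinity>" using st by (cases s; cases t) auto
  then show ?thesis by simp
next
  case False
  then obtain s' t' where st': "s = ereal s'" "t = ereal t'" using st by (cases s; cases t) auto
  have "\<Gamma> (\<phi> (\<iota> e s)) (\<phi> (\<iota> e t)) \<le> ereal (\<bar>t' - s'\<bar> / c)"
  proof (cases "s' \<le> t'")
    case True
    then show ?thesis using \<phi>_edge_lipschitz_real[OF e, of s' t'] st st' by simp
  next
    case False
    then show ?thesis using \<phi>_edge_lipschitz_real[OF e, of t' s'] st st' \<Gamma>_sym[of "\<phi> (\<iota> e s)"] by simp
  qed
  then have "ereal c * \<Gamma> (\<phi> (\<iota> e s)) (\<phi> (\<iota> e t)) \<le> ereal c * ereal (\<bar>t' - s'\<bar> / c)"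
    by (rule ereal_mult_left_mono) (use c_pos in simp)
  then show ?thesis using st' c_pos by simp
qed

lemma \<phi>_contracts: "ereal c * \<Gamma> (\<phi> x) (\<phi> y) \<le> \<Gamma> x y"
proof -
  have "ereal c * \<Gamma> (\<phi> x) (\<phi> y) \<le> path_dist G l \<iota> x y"
  proof (rule path_dist_greatest[where D = "\<lambda>x y. ereal c * \<Gamma> (\<phi> x) (\<phi> y)"])
    show "ereal c * \<Gamma> (\<phi> x) (\<phi> x) \<le> 0" for x by simp
    show "ereal c * \<Gamma> (\<phi> x) (\<phi> z) \<le> ereal c * \<Gamma> (\<phi> x) (\<phi> y) + ereal c * \<Gamma> (\<phi> y) (\<phi> z)" for x y z
      using ereal_mult_left_mono[OF \<Gamma>_triangle[of "\<phi> x" "\<phi> z" "\<phi> y"], of "ereal c"] c_pos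
      by (simp add: ereal_right_distrib)
  qed (rule \<phi>_edge_lipschitz)
  then show ?thesis by (simp add: \<Gamma>_eq)
qed

lemma \<phi>_scales: "ereal c * \<Gamma> (\<phi> x) (\<phi> y) = \<Gamma> x y"
proof (rule antisym[OF \<phi>_contracts])
  have "ereal (1 / c) * \<Gamma> (\<phi>i (\<phi> x)) (\<phi>i (\<phi> y)) \<le> \<Gamma> (\<phi> x) (\<phi> y)"
    unfolding \<phi>i_def by (rule scaled.\<phi>_contracts[OF inverse_scaled])
  then have "ereal (1 / c) * \<Gamma> x y \<le> \<Gamma> (\<phi> x) (\<phi> y)" by (simp only: \<phi>i_\<phi>)
  then have "ereal c * (ereal (1 / c) * \<Gamma> x y) \<le> ereal c * \<Gamma> (\<phi> x) (\<phi> y)"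
    by (rule ereal_mult_left_mono) (use c_pos in simp)
  then show "\<Gamma> x y \<le> ereal c * \<Gamma> (\<phi> x) (\<phi> y)" using c_pos by (simp add: mult.assoc[symmetric])
qed

end

section \<open>Transporting, reversing and merging edges\<close>

lemma ereal_scale_le_iff: "0 < c \<Longrightarrow> ereal c * t \<le> L \<longleftrightarrow> t \<le> ereal (1 / c) * L"
  by (cases t; cases L) (auto simp: field_simps)

lemma ereal_scale_less_iff: "0 < c \<Longrightarrow> ereal c * t < L \<longleftrightarrow> t < ereal (1 / c) * L"
  by (cases t; cases L) (auto simp: field_simps)

lemma ereal_scale_inverse: "0 < c \<Longrightarrow> ereal c * (ereal (1 / c) * t) = t"
  by (cases t) auto

lemma ereal_scale_nonneg: "0 < c \<Longrightarrow> 0 \<le> ereal c * t \<longleftrightarrow> 0 \<le> t"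
  and ereal_scale_pos: "0 < c \<Longrightarrow> 0 < ereal c * t \<longleftrightarrow> 0 < t"
  by (cases t; auto simp: zero_le_mult_iff zero_less_mult_iff)+

lemma ereal_scale_cancel: "0 < c \<Longrightarrow> ereal c * a \<le> ereal c * b \<longleftrightarrow> a \<le> b"
  by (cases a; cases b) auto

lemma ereal_scale_eq: "0 < c \<Longrightarrow> ereal c * a = ereal c * b \<longleftrightarrow> a = b"
  by (cases a; cases b) auto

lemma ereal_scale_abs_diff: "0 < c \<Longrightarrow> \<bar>ereal c * t - ereal c * s\<bar> = ereal c * \<bar>t - s\<bar>"
  by (cases t; cases s) (auto simp: abs_mult right_diff_distrib[symmetric])

lemma leaf_endI:
  assumes "v \<in> verts G" "{e' \<in> edges G. v \<in> ends G e'} = {e}" "ends G e \<noteq> {v}"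
  shows "leaf_end G v"
proof -
  have B: "{e' \<in> edges G. ends G e' = {v}} = {}"
  proof (rule equals0I)
    fix e' assume "e' \<in> {e' \<in> edges G. ends G e' = {v}}"
    then have "e' \<in> {e' \<in> edges G. v \<in> ends G e'}" "ends G e' = {v}" by auto
    then show False using assms(2,3) by auto
  qed
  show ?thesis unfolding leaf_end_def valence_def B assms(2) using assms(1) by simp
qed

context scaled
begin

lemma inj_\<phi>: "inj \<phi>"
  by (rule inj_on_inverseI[of _ \<phi>i]) (rule \<phi>i_\<phi>)

lemma \<phi>_continuous_on: "continuous_on A \<phi>"
proof -
  have "continuous_on UNIV \<phi>" unfolding continuous_on_open_vimage[OF open_UNIV] using \<phi>_continuous by simp
  then show ?thesis by (rule continuous_on_subset) simp
qed

definition push_graph :: "('a, nat) mgraph" where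
  "push_graph = \<lparr>verts = \<phi> ` verts G, edges = edges G, ends = \<lambda>e. \<phi> ` ends G e\<rparr>"

definition push_length :: "nat \<Rightarrow> ereal" where
  "push_length e = ereal (1 / c) * l e"

definition push_map :: "nat \<Rightarrow> ereal \<Rightarrow> 'a" where
  "push_map e t = \<phi> (\<iota> e (ereal c * t))"

lemma push_leaf_end: "leaf_end G v \<Longrightarrow> leaf_end push_graph (\<phi> v)"
proof -
  have "\<phi> v \<in> \<phi> ` A \<longleftrightarrow> v \<in> A" "\<phi> ` A = {\<phi> v} \<longleftrightarrow> A = {v}" for A v
    using inj_image_mem_iff[OF inj_\<phi>] inj_image_eq_iff[OF inj_\<phi>, of A "{v}"] by auto
  then show "leaf_end G v \<Longrightarrow> leaf_end push_graph (\<phi> v)"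
    by (simp add: leaf_end_def valence_def push_graph_def)
qed

lemma push_connected: "connected_mgraph push_graph"
  unfolding connected_mgraph_def
proof (intro ballI)
  fix x y assume "x \<in> verts push_graph" "y \<in> verts push_graph"
  then obtain u v where uv: "u \<in> verts G" "v \<in> verts G" "x = \<phi> u" "y = \<phi> v" by (auto simp: push_graph_def)
  let ?R = "{(x, y). \<exists>e \<in> edges push_graph. ends push_graph e = {x, y}}"
  have "(u, v) \<in> {(x, y). \<exists>e \<in> edges G. ends G e = {x, y}}\<^sup>*"
    using connected_graph uv by (auto simp: connected_mgraph_def)
  then have "(\<phi> u, \<phi> v) \<in> ?R\<^sup>*"
  proof (induction rule: rtrancl_induct)
    case (step v w)
    then have "(\<phi> v, \<phi> w) \<in> ?R" by (auto simp: push_graph_def intro!: bexI)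
    with step.IH show ?case by (rule rtrancl_into_rtrancl)
  qed simp
  then show "(x, y) \<in> ?R\<^sup>*" using uv by simp
qed

lemma push_edge_weighted: "edge_weighted_graph push_graph push_length"
proof -
  have "\<exists>u\<in>verts push_graph. \<exists>v\<in>verts push_graph. ends push_graph e = {u, v}" if "e \<in> edges G" for e
  proof -
    have "ends push_graph e = {\<phi> (\<iota> e 0), \<phi> (\<iota> e (l e))}" using ends_eq[OF that] by (simp add: push_graph_def)
    moreover have "\<phi> (\<iota> e 0) \<in> verts push_graph" "\<phi> (\<iota> e (l e)) \<in> verts push_graph"
      using start_vert[OF that] end_vert[OF that] by (auto simp: push_graph_def)
    ultimately show ?thesis by blast
  qed
  moreover have "verts G \<noteq> {}" using point_on_edge start_vert by (metis empty_iff)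
  ultimately have "graph push_graph"
    using push_connected by (simp add: graph_def) (simp add: push_graph_def)
  moreover have "0 < push_length e \<and> (push_length e = \<infinity> \<longrightarrow> leaf_edge push_graph e)" if e: "e \<in> edges G" for e
  proof
    show "0 < push_length e" using l_pos[OF e] c_pos by (cases "l e") (auto simp: push_length_def)
    show "push_length e = \<infinity> \<longrightarrow> leaf_edge push_graph e"
    proof
      assume "push_length e = \<infinity>"
      then have le: "l e = \<infinity>" using c_pos by (cases "l e") (auto simp: push_length_def)
      have "\<phi> (\<iota> e \<infinity>) \<in> ends push_graph e" using ends_eq[OF e] le by (simp add: push_graph_def)
      then show "leaf_edge push_graph e"
        using push_leaf_end[OF infinite_leaf[OF e le]] e by (auto simp: leaf_edge_def push_graph_def)
    qed
  qed
  ultimately show ?thesis by (simp add: edge_weighted_graph_def) (simp add: push_graph_def)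
qed

text \<open>
  Since \<open>\<phi>\<close> divides all distances by \<open>c\<close>, the image of a model with all lengths divided by \<open>c\<close> induces
  the given distance.
\<close>

lemma push_model: "model_via \<Gamma> push_graph push_length push_map"
proof (rule model_viaI)
  have E [simp]: "edges push_graph = edges G" by (simp add: push_graph_def)
  have range: "t \<in> {0..push_length e} \<longleftrightarrow> ereal c * t \<in> {0..l e}" for e t
    using ereal_scale_le_iff[OF c_pos] ereal_scale_nonneg[OF c_pos] by (simp add: push_length_def)
  have open_range: "0 < t \<and> t < push_length e \<longleftrightarrow> 0 < ereal c * t \<and> ereal c * t < l e" for e t
    using ereal_scale_less_iff[OF c_pos] ereal_scale_pos[OF c_pos] by (simp add: push_length_def)
  have \<phi>\<iota>: "\<phi> (\<iota> e t) = push_map e (ereal (1 / c) * t)" for e t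
    by (simp only: push_map_def ereal_scale_inverse[OF c_pos])
  have range': "ereal (1 / c) * t \<in> {0..push_length e} \<longleftrightarrow> t \<in> {0..l e}" for e t
    unfolding range ereal_scale_inverse[OF c_pos] ..
  show "edge_weighted_graph push_graph push_length" by (rule push_edge_weighted)
  have pd': "ereal c * path_dist push_graph push_length push_map (\<phi> x) (\<phi> y) \<le> path_dist G l \<iota> x y" for x y
  proof (rule path_dist_greatest[where D = "\<lambda>x y. ereal c * path_dist push_graph push_length push_map (\<phi> x) (\<phi> y)"])
    fix x y z
    let ?p = "\<lambda>x y. path_dist push_graph push_length push_map (\<phi> x) (\<phi> y)"
    show "ereal c * ?p x z \<le> ereal c * ?p x y + ereal c * ?p y z"
      using ereal_mult_left_mono[OF path_dist_triangle[of push_graph push_length push_map "\<phi> x" "\<phi> z" "\<phi> y"], of "ereal c"] c_pos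
      by (simp add: ereal_right_distrib path_dist_nonneg)
  next
    fix e s t assume e: "e \<in> edges G" "s \<in> {0..l e}" "t \<in> {0..l e}"
    have "path_dist push_graph push_length push_map (\<phi> (\<iota> e s)) (\<phi> (\<iota> e t)) \<le> \<bar>ereal (1 / c) * t - ereal (1 / c) * s\<bar>"
      unfolding \<phi>\<iota> by (rule path_dist_edge) (use e range' in simp_all)
    also have "\<dots> = ereal (1 / c) * \<bar>t - s\<bar>" by (rule ereal_scale_abs_diff) (use c_pos in simp)
    finally have "ereal c * path_dist push_graph push_length push_map (\<phi> (\<iota> e s)) (\<phi> (\<iota> e t)) \<le> ereal c * (ereal (1 / c) * \<bar>t - s\<bar>)"
      using c_pos by (simp only: ereal_scale_cancel)
    then show "ereal c * path_dist push_graph push_length push_map (\<phi> (\<iota> e s)) (\<phi> (\<iota> e t)) \<le> \<bar>t - s\<bar>"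
      by (simp only: ereal_scale_inverse[OF c_pos])
  qed simp
  have pd: "ereal c * path_dist push_graph push_length push_map (\<phi> x) (\<phi> y) \<le> \<Gamma> x y" for x y
    using pd'[of x y] \<Gamma>_eq by metis
  show "path_dist push_graph push_length push_map (\<iota> e s) (\<iota> e t) \<le> \<bar>t - s\<bar>"
    if e: "e \<in> edges G" "s \<in> {0..l e}" "t \<in> {0..l e}" for e s t
  proof -
    have "ereal c * path_dist push_graph push_length push_map (\<iota> e s) (\<iota> e t) \<le> \<Gamma> (\<phi>i (\<iota> e s)) (\<phi>i (\<iota> e t))"
      using pd[of "\<phi>i (\<iota> e s)" "\<phi>i (\<iota> e t)"] by (simp add: \<phi>_\<phi>i)
    also have "\<dots> = ereal c * \<Gamma> (\<iota> e s) (\<iota> e t)"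
      using \<phi>_scales[of "\<phi>i (\<iota> e s)" "\<phi>i (\<iota> e t)"] by (simp add: \<phi>_\<phi>i)
    finally have "path_dist push_graph push_length push_map (\<iota> e s) (\<iota> e t) \<le> \<Gamma> (\<iota> e s) (\<iota> e t)"
      using c_pos by (simp only: ereal_scale_cancel)
    also have "\<dots> \<le> \<bar>t - s\<bar>" using e by (intro \<Gamma>_edge) auto
    finally show ?thesis .
  qed
  show "ends push_graph e = {push_map e 0, push_map e (push_length e)}" if "e \<in> edges push_graph" for e
    using that ends_eq[of e] ereal_scale_inverse[OF c_pos] by (simp add: push_graph_def push_map_def push_length_def)
  show "leaf_end push_graph (push_map e \<infinity>)" if "e \<in> edges push_graph" "push_length e = \<infinity>" for e
  proof -
    have "l e = \<infinity>" using that(2) c_pos by (cases "l e") (auto simp: push_length_def)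
    then show ?thesis using push_leaf_end[OF infinite_leaf[of e]] that(1) c_pos by (simp add: push_map_def)
  qed
  show "inj_on (\<lambda>(e, t). push_map e t) (SIGMA e:edges push_graph. {0<..<push_length e})"
  proof (rule inj_onI, clarify)
    fix e s e' t
    assume *: "e \<in> edges push_graph" "e' \<in> edges push_graph" "s \<in> {0<..<push_length e}" "t \<in> {0<..<push_length e'}"
      "push_map e s = push_map e' t"
    have "\<iota> e (ereal c * s) = \<iota> e' (ereal c * t)" using *(5) inj_\<phi> by (simp add: push_map_def inj_eq)
    then have "e = e'" "ereal c * s = ereal c * t"
      using inj_interior[of e e' "ereal c * s" "ereal c * t"] * open_range by auto
    then show "e = e' \<and> s = t" using ereal_scale_eq[OF c_pos] by simp
  qed
  show "push_map e t \<notin> verts push_graph" if "e \<in> edges push_graph" "0 < t" "t < push_length e" for e t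
  proof -
    have "0 < ereal c * t \<and> ereal c * t < l e" using that(2,3) open_range by blast
    then have "\<iota> e (ereal c * t) \<notin> verts G" using interior_not_vert[of e] that(1) by simp
    then show ?thesis using inj_image_mem_iff[OF inj_\<phi>] by (simp add: push_map_def push_graph_def)
  qed
  show "\<exists>e\<in>edges push_graph. x \<in> push_map e ` {0..push_length e}" for x
  proof -
    obtain e t where et: "e \<in> edges G" "0 \<le> t" "t \<le> l e" "\<phi>i x = \<iota> e t" by (rule point_on_edge)
    then have "x = push_map e (ereal (1 / c) * t)" using \<phi>\<iota> \<phi>_\<phi>i by metis
    moreover have "ereal (1 / c) * t \<in> {0..push_length e}" using range' et by simp
    ultimately have "x \<in> push_map e ` {0..push_length e}" by (rule image_eqI)
    then show ?thesis using et(1) by (intro bexI[of _ e]) simp_all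
  qed
  show "continuous_on {0..push_length e} (push_map e)" if "e \<in> edges push_graph" for e
  proof -
    have 1: "continuous_on {0..push_length e} (\<lambda>t. ereal c * t)"
      unfolding continuous_on_def by (intro ballI tendsto_cmult_ereal tendsto_ident_at) simp
    have 2: "continuous_on {0..push_length e} (\<lambda>t. \<iota> e (ereal c * t))"
      by (rule continuous_on_compose2[OF continuous_edge 1]) (use that range in auto)
    have "continuous_on {0..push_length e} (\<lambda>t. \<phi> (\<iota> e (ereal c * t)))"
      by (rule continuous_on_compose2[OF \<phi>_continuous_on[of UNIV] 2]) simp
    then show ?thesis by (simp add: push_map_def)
  qed
  show "\<Gamma> (push_map e s) (push_map e t) \<le> \<bar>t - s\<bar>"
    if e: "e \<in> edges push_graph" "s \<in> {0..push_length e}" "t \<in> {0..push_length e}" for e s t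
  proof -
    have "ereal c * \<Gamma> (push_map e s) (push_map e t) = \<Gamma> (\<iota> e (ereal c * s)) (\<iota> e (ereal c * t))"
      unfolding push_map_def by (rule \<phi>_scales)
    also have "\<dots> \<le> \<bar>ereal c * t - ereal c * s\<bar>"
      using e range[of s e] range[of t e] by (intro \<Gamma>_edge) auto
    also have "\<dots> = ereal c * \<bar>t - s\<bar>" by (rule ereal_scale_abs_diff[OF c_pos])
    finally show ?thesis using c_pos by (simp only: ereal_scale_cancel)
  qed
qed

end

context tmodel
begin

definition rev_map :: "nat \<Rightarrow> nat \<Rightarrow> ereal \<Rightarrow> 'p" where
  "rev_map e0 = \<iota>(e0 := \<lambda>t. \<iota> e0 (l e0 - t))"

lemma rev_map_rev_map:
  assumes "e0 \<in> edges G" "l e0 = ereal L" "0 \<le> t" "t \<le> l e"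
  shows "\<iota> e t = rev_map e0 e (if e = e0 then l e0 - t else t)"
  using assms by (cases t) (auto simp: rev_map_def)

lemma reverse_model:
  assumes e0: "e0 \<in> edges G" and L: "l e0 = ereal L"
  shows "model_via \<Gamma> G l (rev_map e0)"
proof (rule model_viaI)
  let ?r = "\<lambda>e t. if e = e0 then ereal L - t else t"
  have rm: "rev_map e0 e t = \<iota> e (?r e t)" for e t by (simp add: rev_map_def L)
  have range: "t \<in> {0..l e} \<Longrightarrow> ?r e t \<in> {0..l e}" for e t using L by (cases t) auto
  have open_range: "0 < t \<Longrightarrow> t < l e \<Longrightarrow> 0 < ?r e t \<and> ?r e t < l e" for e t using L by (cases t) auto
  have diff: "\<bar>?r e t - ?r e s\<bar> = \<bar>t - s\<bar>" if "s \<in> {0..l e}" "t \<in> {0..l e}" for e s t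
    using L that by (cases s; cases t) auto
  have L0: "L > 0" using l_pos[OF e0] L by simp
  show "edge_weighted_graph G l" using mv by (simp add: model_via_def)
  show "ends G e = {rev_map e0 e 0, rev_map e0 e (l e)}" if "e \<in> edges G" for e
    using ends_eq[OF that] by (auto simp: rm L zero_ereal_def)
  show "leaf_end G (rev_map e0 e \<infinity>)" if "e \<in> edges G" "l e = \<infinity>" for e
    using infinite_leaf[OF that] that(2) L by (auto simp: rm)
  show "inj_on (\<lambda>(e, t). rev_map e0 e t) (SIGMA e:edges G. {0<..<l e})"
  proof (rule inj_onI, clarify)
    fix e s e' t
    assume *: "e \<in> edges G" "e' \<in> edges G" "s \<in> {0<..<l e}" "t \<in> {0<..<l e'}" "rev_map e0 e s = rev_map e0 e' t"
    then have "e = e'" "?r e s = ?r e' t"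
      using inj_interior[of e e' "?r e s" "?r e' t"] open_range[of s e] open_range[of t e'] by (simp_all only: rm greaterThanLessThan_iff)
    then show "e = e' \<and> s = t" using * L by (cases s; cases t) (auto split: if_splits)
  qed
  show "rev_map e0 e t \<notin> verts G" if "e \<in> edges G" "0 < t" "t < l e" for e t
    using interior_not_vert[OF that(1)] open_range[OF that(2,3)] by (simp only: rm) blast
  show "\<exists>e\<in>edges G. x \<in> rev_map e0 e ` {0..l e}" for x
  proof -
    obtain e t where et: "e \<in> edges G" "0 \<le> t" "t \<le> l e" "x = \<iota> e t" by (rule point_on_edge)
    then have "x = rev_map e0 e (?r e t)" using rev_map_rev_map[OF e0 L] L by simp
    moreover have "?r e t \<in> {0..l e}" using range et by simp
    ultimately show ?thesis using et(1) by blast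
  qed
  show "continuous_on {0..l e} (rev_map e0 e)" if e: "e \<in> edges G" for e
  proof (cases "e = e0")
    case True
    have "continuous_on {0..l e} (\<lambda>t. ereal L - t)"
      by (rule continuous_on_diff_ereal) (use L True in \<open>auto intro: continuous_intros\<close>)
    then have "continuous_on {0..l e} (\<lambda>t. \<iota> e (ereal L - t))"
      by (rule continuous_on_compose2[OF continuous_edge[OF e]]) (use range[of _ e] True in auto)
    then show ?thesis using True by (simp add: rev_map_def L)
  qed (use continuous_edge[OF e] in \<open>simp add: rev_map_def\<close>)
  show "\<Gamma> (rev_map e0 e s) (rev_map e0 e t) \<le> \<bar>t - s\<bar>" if "e \<in> edges G" "s \<in> {0..l e}" "t \<in> {0..l e}" for e s t
    using \<Gamma>_edge[of e "?r e s" "?r e t"] range[OF that(2)] range[OF that(3)] that(1) diff[OF that(2,3)]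
    by (simp only: rm atLeastAtMost_iff)
  show "path_dist G l (rev_map e0) (\<iota> e s) (\<iota> e t) \<le> \<bar>t - s\<bar>" if "e \<in> edges G" "s \<in> {0..l e}" "t \<in> {0..l e}" for e s t
  proof -
    have "\<iota> e s = rev_map e0 e (?r e s)" "\<iota> e t = rev_map e0 e (?r e t)"
      using rev_map_rev_map[OF e0 L, of s e] rev_map_rev_map[OF e0 L, of t e] that L by simp_all
    then have "path_dist G l (rev_map e0) (\<iota> e s) (\<iota> e t) \<le> \<bar>?r e t - ?r e s\<bar>"
      using path_dist_edge[where G = G and l = l and \<iota> = "rev_map e0" and e = e and s = "?r e s" and t = "?r e t"]
        that(1) range[OF that(2)] range[OF that(3)] by (simp only:)
    then show ?thesis using diff[OF that(2,3)] by (simp only:)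
  qed
qed

end

text \<open>
  A vertex \<open>u\<close> of valence two at which the edge \<open>e1\<close> ends and another edge \<open>e2\<close> starts. The second edge
  may be infinite. The merged edge inherits the name \<open>e1\<close>.
\<close>

locale mergeable = tmodel +
  fixes e1 e2 L1 u
  assumes e1: "e1 \<in> edges G" and e2: "e2 \<in> edges G" and ne: "e1 \<noteq> e2" and L1: "l e1 = ereal L1"
    and pre_u: "pre u = {(e1, ereal L1), (e2, 0)}"
begin

lemma u1: "\<iota> e1 (ereal L1) = u" and u2: "\<iota> e2 0 = u"
  using pre_u mem_pre[of e1 "ereal L1" u] mem_pre[of e2 0 u] by auto

lemma L1_pos: "0 < L1" using l_pos[OF e1] L1 by simp

lemma l2_pos: "0 < l e2" by (rule l_pos[OF e2])

definition mgraph' :: "('a, nat) mgraph" where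
  "mgraph' = \<lparr>verts = verts G - {u}, edges = edges G - {e2},
     ends = (ends G)(e1 := {\<iota> e1 0, \<iota> e2 (l e2)})\<rparr>"

definition mlength :: "nat \<Rightarrow> ereal" where
  "mlength = l(e1 := ereal L1 + l e2)"

definition mmap :: "nat \<Rightarrow> ereal \<Rightarrow> 'a" where
  "mmap = \<iota>(e1 := \<lambda>t. if t \<le> ereal L1 then \<iota> e1 t else \<iota> e2 (t - ereal L1))"

text \<open>
  The parameter in the old model of a parameter in the new one. At \<open>u\<close> it belongs to \<open>e1\<close>.
\<close>

definition orig :: "nat \<Rightarrow> ereal \<Rightarrow> nat \<times> ereal" where
  "orig e t = (if e = e1 \<and> \<not> t \<le> ereal L1 then (e2, t - ereal L1) else (e, t))"

lemma a_ne_u: "\<iota> e1 0 \<noteq> u" and b_ne_u: "\<iota> e2 (l e2) \<noteq> u"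
proof -
  show "\<iota> e1 0 \<noteq> u"
  proof
    assume "\<iota> e1 0 = u"
    then have "(e1, 0) \<in> pre u" using e1 l_pos[OF e1] by (simp add: mem_pre)
    then show False using pre_u ne L1_pos by (auto simp: zero_ereal_def)
  qed
  show "\<iota> e2 (l e2) \<noteq> u"
  proof
    assume "\<iota> e2 (l e2) = u"
    then have "(e2, l e2) \<in> pre u" using e2 l2_pos by (simp add: mem_pre)
    then show False using pre_u ne l2_pos by auto
  qed
qed

lemma u_notin_ends: "e \<in> edges G \<Longrightarrow> e \<noteq> e1 \<Longrightarrow> e \<noteq> e2 \<Longrightarrow> u \<notin> ends G e"
proof
  assume e: "e \<in> edges G" "e \<noteq> e1" "e \<noteq> e2" "u \<in> ends G e"
  then have "(e, 0) \<in> pre u \<or> (e, l e) \<in> pre u" using ends_eq[OF e(1)] l_pos[OF e(1)] by (auto simp: mem_pre)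
  then show False using pre_u e by auto
qed

lemma orig_pre:
  assumes "e \<in> edges mgraph'" "0 \<le> t" "t \<le> mlength e"
  shows "orig e t \<in> pre (mmap e t)"
proof (cases "e = e1 \<and> \<not> t \<le> ereal L1")
  case True
  then have "0 \<le> t - ereal L1" "t - ereal L1 \<le> l e2"
    using assms(3) by (cases t; cases "l e2"; simp add: mlength_def)+
  then show ?thesis using True e2 by (simp add: orig_def mmap_def mem_pre)
next
  case False
  then have "t \<le> l e" using assms(3) L1 by (auto simp: mlength_def split: if_splits)
  then show ?thesis using False assms by (auto simp: orig_def mmap_def mem_pre mgraph'_def)
qed

lemma orig_inj:
  assumes "e \<in> edges mgraph'" "e' \<in> edges mgraph'" "orig e s = orig e' t"
  shows "e = e' \<and> s = t"
proof -
  have *: "e \<noteq> e2" "e' \<noteq> e2" using assms by (auto simp: mgraph'_def)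
  show ?thesis
  proof (cases "e = e1 \<and> \<not> s \<le> ereal L1")
    case True
    then have "e' = e1 \<and> \<not> t \<le> ereal L1 \<and> s - ereal L1 = t - ereal L1"
      using assms(3) * by (auto simp: orig_def split: if_splits)
    moreover from this have "s = t" by (cases s; cases t) auto
    ultimately show ?thesis using True by simp
  next
    case False
    then show ?thesis using assms(3) * by (auto simp: orig_def split: if_splits)
  qed
qed

lemma orig_interior:
  assumes "e \<in> edges mgraph'" "0 < t" "t < mlength e"
  shows "pre (mmap e t) = {orig e t} \<or> (mmap e t = u \<and> orig e t = (e1, ereal L1))"
proof (cases "e = e1")
  case True
  consider "t < ereal L1" | "t = ereal L1" | "ereal L1 < t" by fastforce
  then show ?thesis
  proof cases
    case 1
    then have "t \<le> ereal L1" by (rule less_imp_le)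
    then show ?thesis using 1 pre_interior[OF e1 assms(2)] True L1 by (simp add: mmap_def orig_def)
  next
    case 2
    then show ?thesis using True u1 by (simp add: mmap_def orig_def)
  next
    case 3
    then have "0 < t - ereal L1" "t - ereal L1 < l e2"
      using assms(3) True by (cases t; cases "l e2"; simp add: mlength_def)+
    moreover have "\<not> t \<le> ereal L1" using 3 by simp
    ultimately show ?thesis using pre_interior[OF e2, of "t - ereal L1"] True by (simp add: mmap_def orig_def)
  qed
next
  case False
  then show ?thesis using pre_interior[of e t] assms by (simp add: mmap_def orig_def mlength_def mgraph'_def)
qed

lemma mends: "e \<in> edges mgraph' \<Longrightarrow> ends mgraph' e = {mmap e 0, mmap e (mlength e)}"
proof (cases "e = e1")
  case True
  have "\<not> ereal L1 + l e2 \<le> ereal L1" "ereal L1 + l e2 - ereal L1 = l e2" using l2_pos by (cases "l e2"; simp)+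
  then show ?thesis using True L1_pos by (simp add: mgraph'_def mmap_def mlength_def zero_ereal_def)
next
  case False
  assume "e \<in> edges mgraph'"
  then show ?thesis using False ends_eq[of e] by (simp add: mgraph'_def mmap_def mlength_def)
qed

lemma mends_verts: "e \<in> edges mgraph' \<Longrightarrow> ends mgraph' e \<subseteq> verts mgraph'"
proof (cases "e = e1")
  case True
  then show ?thesis using start_vert[OF e1] end_vert[OF e2] a_ne_u b_ne_u by (simp add: mgraph'_def)
next
  case False
  assume "e \<in> edges mgraph'"
  then show ?thesis using False u_notin_ends[of e] ends_verts[of e] by (auto simp: mgraph'_def)
qed

lemma mleaf:
  assumes "e \<in> edges mgraph'" "mlength e = \<infinity>"
  shows "leaf_end mgraph' (mmap e \<infinity>)"
proof -
  obtain e0 where e0: "e0 \<in> edges G" "l e0 = \<infinity>" "mmap e \<infinity> = \<iota> e0 \<infinity>"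
      "e = e1 \<Longrightarrow> e0 = e2" "e \<noteq> e1 \<Longrightarrow> e0 = e"
  proof (cases "e = e1")
    case True
    then have "l e2 = \<infinity>" using assms(2) by (cases "l e2") (auto simp: mlength_def)
    then show ?thesis using that[of e2] e2 True by (simp add: mmap_def)
  next
    case False
    then show ?thesis using that[of e] assms by (simp add: mmap_def mlength_def mgraph'_def)
  qed
  let ?w = "\<iota> e0 \<infinity>"
  have pre: "pre ?w = {(e0, \<infinity>)}" by (rule pre_infinite[OF e0(1,2)])
  have start: "\<iota> e' 0 \<noteq> ?w" if "e' \<in> edges G" for e'
  proof
    assume "\<iota> e' 0 = ?w"
    then have "(e', 0) \<in> pre ?w" using that l_pos[OF that] by (simp add: mem_pre)
    then show False using pre by auto
  qed
  have stop: "\<iota> e' (l e') = ?w \<longleftrightarrow> e' = e0" if "e' \<in> edges G" for e'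
  proof
    assume "\<iota> e' (l e') = ?w"
    then have "(e', l e') \<in> pre ?w" using that l_pos[OF that] by (simp add: mem_pre)
    then show "e' = e0" using pre by auto
  qed (use e0(2) in simp)
  have inc: "?w \<in> ends mgraph' e' \<longleftrightarrow> e' = e" if "e' \<in> edges mgraph'" for e'
  proof (cases "e' = e1")
    case True
    then have "?w \<in> ends mgraph' e' \<longleftrightarrow> ?w = \<iota> e1 0 \<or> ?w = \<iota> e2 (l e2)" by (simp add: mgraph'_def)
    also have "\<dots> \<longleftrightarrow> e2 = e0" using start[OF e1] stop[OF e2] by metis
    also have "\<dots> \<longleftrightarrow> e' = e"
    proof (cases "e = e1")
      case False
      then have "e0 = e" by (rule e0(5))
      moreover have "e \<noteq> e2" using assms(1) by (simp add: mgraph'_def)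
      ultimately show ?thesis using True False by blast
    next
      case e: True
      then have "e0 = e2" by (rule e0(4))
      then show ?thesis using True e by blast
    qed
    finally show ?thesis .
  next
    case False
    have e': "e' \<in> edges G" "e' \<noteq> e2" using that by (auto simp: mgraph'_def)
    have "?w \<in> ends mgraph' e' \<longleftrightarrow> ?w = \<iota> e' 0 \<or> ?w = \<iota> e' (l e')"
      using False ends_eq[OF e'(1)] by (simp add: mgraph'_def)
    also have "\<dots> \<longleftrightarrow> e' = e0" using start[OF e'(1)] stop[OF e'(1)] by metis
    also have "\<dots> \<longleftrightarrow> e' = e"
    proof (cases "e = e1")
      case True
      then have "e0 = e2" by (rule e0(4))
      then show ?thesis using True e'(2) False by blast
    next
      case e: False
      then have "e0 = e" by (rule e0(5))
      then show ?thesis by blast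
    qed
    finally show ?thesis .
  qed
  have "?w \<in> verts mgraph'" using inc[OF assms(1)] mends_verts[OF assms(1)] by auto
  moreover have "{e' \<in> edges mgraph'. ?w \<in> ends mgraph' e'} = {e}" using inc assms(1) by blast
  moreover have "ends mgraph' e \<noteq> {?w}"
  proof
    assume "ends mgraph' e = {?w}"
    then have "mmap e 0 = ?w" using mends[OF assms(1)] by auto
    moreover have "mmap e 0 = \<iota> e 0" using L1_pos by (simp add: mmap_def zero_ereal_def)
    ultimately show False using start[of e] assms(1) by (simp add: mgraph'_def)
  qed
  ultimately show ?thesis unfolding e0(3) by (rule leaf_endI)
qed

lemma mconnected: "connected_mgraph mgraph'"
  unfolding connected_mgraph_def
proof (intro ballI)
  fix x y assume xy: "x \<in> verts mgraph'" "y \<in> verts mgraph'"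
  let ?R = "{(x, y). \<exists>e \<in> edges mgraph'. ends mgraph' e = {x, y}}"
  \<comment> \<open>Contracting the old edge \<open>e1\<close> to its start turns paths in the old graph into paths in the new one.\<close>
  define q where "q v = (if v = u then \<iota> e1 0 else v)" for v
  have "(x, y) \<in> {(x, y). \<exists>e \<in> edges G. ends G e = {x, y}}\<^sup>*"
    using connected_graph xy by (auto simp: connected_mgraph_def mgraph'_def)
  then have "(q x, q y) \<in> ?R\<^sup>*"
  proof (induction rule: rtrancl_induct)
    case (step v w)
    then obtain e where e: "e \<in> edges G" "ends G e = {v, w}" by auto
    have e1': "e1 \<in> edges mgraph'" "ends mgraph' e1 = {\<iota> e1 0, \<iota> e2 (l e2)}" using e1 ne by (auto simp: mgraph'_def)
    have "(q v, q w) \<in> ?R\<^sup>*"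
    proof -
      consider "e = e1" | "e = e2" | "e \<noteq> e1" "e \<noteq> e2" by blast
      then show ?thesis
      proof cases
        case 1
        then have "{v, w} = {\<iota> e1 0, u}" using e ends_eq[OF e1] L1 u1 by simp
        then have "q v = q w" by (auto simp: q_def doubleton_eq_iff)
        then show ?thesis by simp
      next
        case 2
        then have "{v, w} = {u, \<iota> e2 (l e2)}" using e ends_eq[OF e2] u2 by simp
        then have "{q v, q w} = {\<iota> e1 0, \<iota> e2 (l e2)}" using b_ne_u by (auto simp: q_def doubleton_eq_iff)
        then have "(q v, q w) \<in> ?R" using e1' by auto
        then show ?thesis by blast
      next
        case 3
        then have "q v = v" "q w = w" using u_notin_ends[OF e(1)] e(2) by (auto simp: q_def)
        moreover have "e \<in> edges mgraph'" "ends mgraph' e = {v, w}" using 3 e by (auto simp: mgraph'_def)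
        ultimately have "(q v, q w) \<in> ?R" by auto
        then show ?thesis by blast
      qed
    qed
    with step.IH show ?case by (rule rtrancl_trans)
  qed simp
  moreover have "q x = x" "q y = y" using xy by (auto simp: q_def mgraph'_def)
  ultimately show "(x, y) \<in> ?R\<^sup>*" by simp
qed

lemma medge_weighted: "edge_weighted_graph mgraph' mlength"
proof -
  have "\<exists>v\<in>verts mgraph'. \<exists>w\<in>verts mgraph'. ends mgraph' e = {v, w}" if "e \<in> edges mgraph'" for e
    using mends[OF that] mends_verts[OF that] by auto
  moreover have "\<iota> e1 0 \<in> verts mgraph'" using start_vert[OF e1] a_ne_u by (simp add: mgraph'_def)
  moreover have "finite (verts mgraph')" "finite (edges mgraph')" by (simp_all add: mgraph'_def)
  ultimately have "graph mgraph'" using mconnected unfolding graph_def by blast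
  moreover have "0 < mlength e" if "e \<in> edges mgraph'" for e
    using l_pos[of e] that L1_pos l2_pos by (cases "l e2") (auto simp: mlength_def mgraph'_def)
  moreover have "leaf_edge mgraph' e" if "e \<in> edges mgraph'" "mlength e = \<infinity>" for e
    using mleaf[OF that] that mends[OF that(1)] by (auto simp: leaf_edge_def)
  ultimately show ?thesis by (simp add: edge_weighted_graph_def)
qed

lemma mdist_cross:
  assumes "0 \<le> s" "s \<le> ereal L1" "ereal L1 \<le> t" "t \<le> ereal L1 + l e2"
  shows "\<Gamma> (\<iota> e1 s) (\<iota> e2 (t - ereal L1)) \<le> \<bar>t - s\<bar>"
proof -
  have t2: "0 \<le> t - ereal L1" "t - ereal L1 \<le> l e2"
    using assms by (cases t; cases "l e2"; simp)+
  have "\<Gamma> (\<iota> e1 s) (\<iota> e2 (t - ereal L1)) \<le> \<Gamma> (\<iota> e1 s) u + \<Gamma> u (\<iota> e2 (t - ereal L1))" by (rule \<Gamma>_triangle)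
  also have "\<dots> \<le> \<bar>ereal L1 - s\<bar> + \<bar>(t - ereal L1) - 0\<bar>"
    using \<Gamma>_edge[OF e1 assms(1), of "ereal L1"] \<Gamma>_edge[OF e2, of 0 "t - ereal L1"] t2 assms L1 L1_pos l2_pos u1 u2
    by (intro add_mono) (simp_all add: less_imp_le)
  also have "\<dots> \<le> \<bar>t - s\<bar>" using assms by (cases s; cases t) auto
  finally show ?thesis .
qed

lemma merged_model: "model_via \<Gamma> mgraph' mlength mmap"
proof (rule model_viaI)
  show "edge_weighted_graph mgraph' mlength" by (rule medge_weighted)
  show "ends mgraph' e = {mmap e 0, mmap e (mlength e)}" if "e \<in> edges mgraph'" for e by (rule mends[OF that])
  show "leaf_end mgraph' (mmap e \<infinity>)" if "e \<in> edges mgraph'" "mlength e = \<infinity>" for e by (rule mleaf[OF that])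
  show "inj_on (\<lambda>(e, t). mmap e t) (SIGMA e:edges mgraph'. {0<..<mlength e})"
  proof (rule inj_onI, clarify)
    fix e s e' t
    assume *: "e \<in> edges mgraph'" "e' \<in> edges mgraph'" "s \<in> {0<..<mlength e}" "t \<in> {0<..<mlength e'}"
      "mmap e s = mmap e' t"
    have A: "orig e s \<in> pre (mmap e s)" "orig e' t \<in> pre (mmap e s)"
      using orig_pre[OF *(1), of s] orig_pre[OF *(2), of t] *(3-5) by auto
    have B: "pre (mmap e s) = {orig e s} \<or> (mmap e s = u \<and> orig e s = (e1, ereal L1))"
      "pre (mmap e s) = {orig e' t} \<or> (mmap e s = u \<and> orig e' t = (e1, ereal L1))"
      using orig_interior[OF *(1), of s] orig_interior[OF *(2), of t] *(3-5) by auto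
    have "orig e s = orig e' t" using A B by auto
    then show "e = e' \<and> s = t" by (rule orig_inj[OF *(1,2)])
  qed
  show "mmap e t \<notin> verts mgraph'" if "e \<in> edges mgraph'" "0 < t" "t < mlength e" for e t
  proof (cases "mmap e t = u")
    case False
    then have pre1: "pre (mmap e t) = {orig e t}" using orig_interior[OF that] by blast
    have "mmap e t \<notin> verts G"
    proof
      assume v: "mmap e t \<in> verts G"
      obtain f s where fs: "orig e t = (f, s)" by (cases "orig e t")
      have s: "s = 0 \<or> s = l f" using pre_vert[of f s, OF _ v] pre1 fs by simp
      show False
      proof (cases "e = e1 \<and> \<not> t \<le> ereal L1")
        case True
        then have "f = e2" "s = t - ereal L1" using fs by (auto simp: orig_def)
        then show False using s True that(3) by (cases t; cases "l e2") (auto simp: mlength_def)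
      next
        case nF: False
        then have "f = e" "s = t" using fs by (auto simp: orig_def)
        then have "t = l e" using s that(2) by auto
        then show False
        proof (cases "e = e1")
          case True
          then show False using \<open>t = l e\<close> L1 u1 False by (simp add: mmap_def)
        next
          case e: False
          then show False using \<open>t = l e\<close> that(3) by (simp add: mlength_def)
        qed
      qed
    qed
    then show ?thesis by (simp add: mgraph'_def)
  qed (simp add: mgraph'_def)
  show "\<exists>e\<in>edges mgraph'. x \<in> mmap e ` {0..mlength e}" for x
  proof -
    obtain e t where et: "e \<in> edges G" "0 \<le> t" "t \<le> l e" "x = \<iota> e t" by (rule point_on_edge)
    have e1': "e1 \<in> edges mgraph'" using e1 ne by (simp add: mgraph'_def)
    consider "e = e1" | "e = e2" | "e \<noteq> e1" "e \<noteq> e2" by blast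
    then show ?thesis
    proof cases
      case 1
      have "ereal L1 \<le> ereal L1 + l e2" using l2_pos by (cases "l e2") auto
      then have "t \<in> {0..mlength e1}" using et 1 L1 order_trans[of t "ereal L1"] by (auto simp: mlength_def)
      moreover have "x = mmap e1 t" using et 1 L1 by (simp add: mmap_def)
      ultimately show ?thesis using e1' by blast
    next
      case 2
      have "ereal L1 + t \<in> {0..mlength e1}"
        using et 2 L1_pos by (cases t; cases "l e2") (auto simp: mlength_def)
      moreover have "x = mmap e1 (ereal L1 + t)"
      proof (cases "t = 0")
        case True
        then show ?thesis using et 2 u1 u2 by (simp add: mmap_def)
      next
        case False
        then have "\<not> ereal L1 + t \<le> ereal L1" "ereal L1 + t - ereal L1 = t" using et(2) by (cases t; simp)+
        then show ?thesis using et 2 by (simp add: mmap_def)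
      qed
      ultimately show ?thesis using e1' by blast
    next
      case 3
      then have "e \<in> edges mgraph'" "x = mmap e t" "t \<in> {0..mlength e}"
        using et by (auto simp: mgraph'_def mmap_def mlength_def)
      then show ?thesis by blast
    qed
  qed
  show "continuous_on {0..mlength e} (mmap e)" if "e \<in> edges mgraph'" for e
  proof (cases "e = e1")
    case True
    have U: "{0..mlength e} = {0..ereal L1} \<union> {ereal L1..ereal L1 + l e2}"
    proof -
      have "ereal L1 \<le> ereal L1 + l e2" using l2_pos by (cases "l e2") auto
      then show ?thesis using True L1_pos by (simp add: mlength_def ivl_disj_un)
    qed
    have c1: "continuous_on {0..ereal L1} (\<iota> e1)" using continuous_edge[OF e1] L1 by simp
    have "((\<lambda>t. t + ereal (- L1)) \<longlongrightarrow> x + ereal (- L1)) (at x within A)" for x A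
      by (rule tendsto_add_ereal_general) (auto intro: tendsto_ident_at)
    then have "continuous_on {ereal L1..ereal L1 + l e2} (\<lambda>t. t - ereal L1)"
      by (simp add: continuous_on_def minus_ereal_def)
    moreover have "t - ereal L1 \<in> {0..l e2}" if "t \<in> {ereal L1..ereal L1 + l e2}" for t
      using that by (cases t; cases "l e2") auto
    ultimately have c2: "continuous_on {ereal L1..ereal L1 + l e2} (\<lambda>t. \<iota> e2 (t - ereal L1))"
      by (intro continuous_on_compose2[OF continuous_edge[OF e2]]) auto
    have "continuous_on ({0..ereal L1} \<union> {ereal L1..ereal L1 + l e2})
        (\<lambda>t. if t \<le> ereal L1 then \<iota> e1 t else \<iota> e2 (t - ereal L1))"
    proof (rule continuous_on_cases[OF _ _ c1 c2])
      have "\<iota> e1 x = \<iota> e2 (x - ereal L1)" if "x = ereal L1" for x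
        using that u1 u2 by (simp add: zero_ereal_def)
      then show "\<forall>x. x \<in> {0..ereal L1} \<and> \<not> x \<le> ereal L1 \<or> x \<in> {ereal L1..ereal L1 + l e2} \<and> x \<le> ereal L1 \<longrightarrow>
          \<iota> e1 x = \<iota> e2 (x - ereal L1)" by auto
    qed simp_all
    then show ?thesis unfolding U using True by (simp add: mmap_def)
  next
    case False
    then show ?thesis using continuous_edge[of e] that by (simp add: mgraph'_def mmap_def mlength_def)
  qed
  show "\<Gamma> (mmap e s) (mmap e t) \<le> \<bar>t - s\<bar>"
    if e: "e \<in> edges mgraph'" "s \<in> {0..mlength e}" "t \<in> {0..mlength e}" for e s t
  proof (cases "e = e1")
    case False
    then show ?thesis using \<Gamma>_edge[of e s t] e by (simp add: mgraph'_def mmap_def mlength_def)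
  next
    case True
    have st: "0 \<le> s" "s \<le> ereal L1 + l e2" "0 \<le> t" "t \<le> ereal L1 + l e2" using e True by (auto simp: mlength_def)
    have sh: "0 \<le> w - ereal L1 \<and> w - ereal L1 \<le> l e2" if "\<not> w \<le> ereal L1" "w \<le> ereal L1 + l e2" for w
      using that by (cases w; cases "l e2") auto
    consider "s \<le> ereal L1" "t \<le> ereal L1" | "s \<le> ereal L1" "\<not> t \<le> ereal L1"
      | "\<not> s \<le> ereal L1" "t \<le> ereal L1" | "\<not> s \<le> ereal L1" "\<not> t \<le> ereal L1" by blast
    then show ?thesis
    proof cases
      case 1
      then show ?thesis using \<Gamma>_edge[OF e1, of s t] st L1 True by (simp add: mmap_def)
    next
      case 2
      then show ?thesis using mdist_cross[OF st(1) 2(1) _ st(4)] True by (simp add: mmap_def)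
    next
      case 3
      then show ?thesis using mdist_cross[OF st(3) 3(2) _ st(2)] True \<Gamma>_sym[of "\<iota> e1 t"] ereal_abs_diff_commute[of s t]
        by (simp add: mmap_def)
    next
      case 4
      have "\<bar>(t - ereal L1) - (s - ereal L1)\<bar> = \<bar>t - s\<bar>" by (cases s; cases t) auto
      then show ?thesis using \<Gamma>_edge[OF e2, of "s - ereal L1" "t - ereal L1"] sh[OF 4(1) st(2)] sh[OF 4(2) st(4)] 4 True
        by (simp add: mmap_def)
    qed
  qed
  show "path_dist mgraph' mlength mmap (\<iota> e s) (\<iota> e t) \<le> \<bar>t - s\<bar>"
    if e: "e \<in> edges G" "s \<in> {0..l e}" "t \<in> {0..l e}" for e s t
  proof -
    have e1': "e1 \<in> edges mgraph'" using e1 ne by (simp add: mgraph'_def)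
    have pd: "path_dist mgraph' mlength mmap (mmap f p) (mmap f q) \<le> \<bar>q - p\<bar>"
      if "f \<in> edges mgraph'" "p \<in> {0..mlength f}" "q \<in> {0..mlength f}" for f p q
      using that by (intro path_dist_edge)
    consider "e = e1" | "e = e2" | "e \<noteq> e1" "e \<noteq> e2" by blast
    then show ?thesis
    proof cases
      case 1
      have "ereal L1 \<le> ereal L1 + l e2" using l2_pos by (cases "l e2") auto
      then have "w \<in> {0..mlength e1} \<and> \<iota> e w = mmap e1 w" if "w \<in> {0..l e}" for w
        using that 1 L1 order_trans[of w "ereal L1"] by (auto simp: mlength_def mmap_def)
      then show ?thesis using pd[OF e1', of s t] e by simp
    next
      case 2
      have *: "ereal L1 + w \<in> {0..mlength e1} \<and> \<iota> e w = mmap e1 (ereal L1 + w)" if w: "w \<in> {0..l e}" for w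
      proof
        show "ereal L1 + w \<in> {0..mlength e1}" using w 2 L1_pos by (cases w; cases "l e2") (auto simp: mlength_def)
        show "\<iota> e w = mmap e1 (ereal L1 + w)"
        proof (cases "w = 0")
          case True
          then show ?thesis using 2 u1 u2 by (simp add: mmap_def)
        next
          case False
          then have "\<not> ereal L1 + w \<le> ereal L1" "ereal L1 + w - ereal L1 = w" using w by (cases w; simp)+
          then show ?thesis using 2 by (simp add: mmap_def)
        qed
      qed
      have "\<bar>(ereal L1 + t) - (ereal L1 + s)\<bar> = \<bar>t - s\<bar>" by (cases s; cases t) auto
      then show ?thesis using pd[OF e1', of "ereal L1 + s" "ereal L1 + t"] *[OF e(2)] *[OF e(3)] by simp
    next
      case 3
      then have "e \<in> edges mgraph'" "s \<in> {0..mlength e}" "t \<in> {0..mlength e}" "mmap e = \<iota> e"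
        using e by (auto simp: mgraph'_def mmap_def mlength_def)
      then show ?thesis using pd[of e s t] by simp
    qed
  qed
qed

lemma fewer_edges: "model \<Gamma> mgraph' mlength" "card (edges mgraph') < card (edges G)"
  using merged_model e2 card_Diff1_less[of "edges G" e2] by (auto simp: model_def mgraph'_def)

end

context tmodel
begin

lemma pre_reversed:
  assumes "e0 \<in> edges G" "l e0 = ereal L"
  shows "tmodel.pre G l (rev_map e0) x = (\<lambda>(e, t). (e, if e = e0 then l e0 - t else t)) ` pre x"
proof -
  interpret R: tmodel \<Gamma> G l "rev_map e0"
    by (intro tmodel.intro reverse_model[OF assms] np)
  let ?r = "\<lambda>(e, t). (e, if e = e0 then l e0 - t else t)"
  have invol: "l e0 - (l e0 - t) = t" for t using assms(2) by (cases t) auto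
  have range: "0 \<le> l e0 - t \<and> l e0 - t \<le> l e0 \<longleftrightarrow> 0 \<le> t \<and> t \<le> l e0" for t using assms(2) by (cases t) auto
  have iff: "(e, t) \<in> R.pre x \<longleftrightarrow> ?r (e, t) \<in> pre x" for e t
  proof (cases "e = e0")
    case True
    have rm: "rev_map e0 e0 t = \<iota> e0 (l e0 - t)" by (simp add: rev_map_def)
    have "(e0, t) \<in> R.pre x \<longleftrightarrow> e0 \<in> edges G \<and> (0 \<le> t \<and> t \<le> l e0) \<and> \<iota> e0 (l e0 - t) = x"
      unfolding R.mem_pre rm by blast
    also have "\<dots> \<longleftrightarrow> (e0, l e0 - t) \<in> pre x" unfolding mem_pre using range[of t] by blast
    finally show ?thesis using True by simp
  next
    case False
    then have rm: "rev_map e0 e t = \<iota> e t" by (simp add: rev_map_def)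
    have "(e, t) \<in> R.pre x \<longleftrightarrow> (e, t) \<in> pre x" unfolding R.mem_pre mem_pre rm ..
    then show ?thesis using False by simp
  qed
  show ?thesis
  proof (intro equalityI subsetI)
    fix p assume p: "p \<in> R.pre x"
    obtain e t where et: "p = (e, t)" by (cases p)
    have "p = ?r (?r (e, t))" using invol et by auto
    moreover have "?r (e, t) \<in> pre x" using iff p et by simp
    ultimately show "p \<in> ?r ` pre x" by blast
  next
    fix p assume "p \<in> ?r ` pre x"
    then obtain e t where et: "p = ?r (e, t)" "(e, t) \<in> pre x" by auto
    then have "?r p = (e, t)" using invol by auto
    then show "p \<in> R.pre x" using iff[of "fst p" "snd p"] et by simp
  qed
qed

lemma merge_at_end:
  assumes e: "(e1, l e1) \<in> pre u" "(e2, s) \<in> pre u" "pre u = {(e1, l e1), (e2, s)}" "e1 \<noteq> e2" "l e1 = ereal L1" "\<not> infp u"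
  shows "\<exists>G' l'. model \<Gamma> G' l' \<and> card (edges G') < card (edges G)"
proof -
  have E: "e1 \<in> edges G" "e2 \<in> edges G" using e(1,2) unfolding mem_pre by blast+
  have "\<iota> e1 (l e1) = u" using e(1) unfolding mem_pre by blast
  then have uv: "u \<in> verts G" using end_vert[OF E(1)] by simp
  consider "s = 0" | "s = l e2" using pre_vert[OF e(2) uv] by blast
  then show ?thesis
  proof cases
    case 1
    have P: "pre u = {(e1, ereal L1), (e2, 0)}" unfolding e(3) 1 e(5) ..
    interpret mergeable \<Gamma> G l \<iota> e1 e2 L1 u
      by (intro mergeable.intro tmodel_axioms mergeable_axioms.intro E e(4,5) P)
    show ?thesis using fewer_edges by blast
  next
    case 2
    obtain L2 where L2: "l e2 = ereal L2" using pre_finite_real[OF e(6,2)] 2 by auto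
    interpret R: tmodel \<Gamma> G l "rev_map e2"
      by (intro tmodel.intro reverse_model[OF E(2) L2] np)
    have "R.pre u = {(e1, ereal L1), (e2, 0)}"
      unfolding pre_reversed[OF E(2) L2, of u] e(3) using e(4,5) 2 L2 by (simp add: zero_ereal_def)
    then interpret mergeable \<Gamma> G l "rev_map e2" e1 e2 L1 u
      by (intro mergeable.intro R.tmodel_axioms mergeable_axioms.intro E e(4,5))
    show ?thesis using fewer_edges by blast
  qed
qed

text \<open>
  A finite edge can be reversed, so the directions of the two edges do not matter.
\<close>

lemma merge_at_vertex:
  assumes "pre u = {(e1, s1), (e2, s2)}" "e1 \<noteq> e2" "l e1 \<noteq> \<infinity>" "\<not> infp u" "u \<in> verts G"
  shows "\<exists>G' l'. model \<Gamma> G' l' \<and> card (edges G') < card (edges G)"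
proof -
  have p: "(e1, s1) \<in> pre u" "(e2, s2) \<in> pre u" unfolding assms(1) by simp_all
  then have E: "e1 \<in> edges G" "e2 \<in> edges G" unfolding mem_pre by blast+
  obtain L1 where L1: "l e1 = ereal L1" using assms(3) l_pos[OF E(1)] by (cases "l e1") auto
  consider "s1 = 0" | "s1 = l e1" using pre_vert[OF p(1) assms(5)] by blast
  then show ?thesis
  proof cases
    case 2
    show ?thesis by (rule merge_at_end[OF _ p(2) _ assms(2) L1 assms(4)]) (use p(1) assms(1) 2 in simp_all)
  next
    case 1
    interpret R: tmodel \<Gamma> G l "rev_map e1"
      by (intro tmodel.intro reverse_model[OF E(1) L1] np)
    have P: "R.pre u = {(e1, l e1), (e2, s2)}"
      unfolding pre_reversed[OF E(1) L1, of u] assms(1) 1 using assms(2) L1 by (simp add: zero_ereal_def)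
    have ni: "\<not> R.infp u" using assms(4) infp_model_independent[OF tmodel_axioms R.tmodel_axioms, of u] by simp
    show ?thesis by (rule R.merge_at_end[OF _ _ P assms(2) L1 ni]) (simp_all add: P)
  qed
qed

end

section \<open>Minimal models and their cores\<close>

context tmodel
begin

text \<open>
  The valence is the number of points on a small sphere, which is a matter of the distance only.
\<close>

lemma sphere_card_vert:
  assumes good: "good x r" and \<delta>: "0 < \<delta>" "\<delta> < r" and x: "x \<in> verts G"
  shows "card {z. \<Gamma> x z = ereal \<delta>} = card (pre x)"
proof -
  define \<tau> where "\<tau> s = (if s = 0 then ereal \<delta> else s - ereal \<delta>)" for s
  define h where "h = (\<lambda>(e, s). \<iota> e (\<tau> s))"
  have T: "e \<in> edges G \<and> 0 < \<tau> s \<and> \<tau> s < l e \<and> \<bar>\<tau> s - s\<bar> = ereal \<delta>" if p: "(e, s) \<in> pre x" for e s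
  proof -
    have e: "e \<in> edges G" using p unfolding mem_pre by blast
    obtain s' where s': "s = ereal s'" using pre_finite_real[OF good_not_infp[OF good] p] by blast
    show ?thesis
    proof (cases "s = 0")
      case True
      have "ereal (2 * r) \<le> \<bar>l e - s\<bar>" using goodD[OF good p, of "l e"] l_pos[OF e] True by auto
      then have "ereal \<delta> < l e" using True \<delta> l_pos[OF e] by (cases "l e") auto
      then show ?thesis using e True \<delta> by (simp add: \<tau>_def)
    next
      case False
      then have sl: "s = l e" using pre_vert[OF p x] by blast
      have "ereal (2 * r) \<le> \<bar>0 - s\<bar>" using goodD[OF good p, of 0] False by simp
      moreover have "0 \<le> s" using p unfolding mem_pre by blast
      ultimately show ?thesis using e False sl[symmetric] s' \<delta> by (simp add: \<tau>_def)
    qed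
  qed
  have near: "\<bar>\<tau> s - s\<bar> < ereal r" if "(e, s) \<in> pre x" for e s using T[OF that] \<delta> by simp
  have "bij_betw h (pre x) {z. \<Gamma> x z = ereal \<delta>}"
    unfolding bij_betw_def
  proof
    show "inj_on h (pre x)"
    proof (rule inj_onI, clarify)
      fix e s e' s' assume p: "(e, s) \<in> pre x" "(e', s') \<in> pre x" "h (e, s) = h (e', s')"
      have 1: "e = e'" "\<tau> s = \<tau> s'"
        using inj_interior[of e e' "\<tau> s" "\<tau> s'"] T[OF p(1)] T[OF p(2)] p(3) by (auto simp: h_def)
      have "s = s'"
      proof (rule ereal_abs_small_unique[OF near[OF p(1)]])
        show "\<bar>\<tau> s - s'\<bar> < ereal r" unfolding 1(2) by (rule near[OF p(2)])
        show "s \<noteq> s' \<Longrightarrow> ereal (2 * r) \<le> \<bar>s' - s\<bar>"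
          using goodD[OF good p(1), of s'] p(2) 1(1) by blast
      qed
      with 1(1) show "e = e' \<and> s = s'" by blast
    qed
    show "h ` pre x = {z. \<Gamma> x z = ereal \<delta>}"
    proof (intro equalityI subsetI)
      fix z assume "z \<in> h ` pre x"
      then obtain e s where p: "(e, s) \<in> pre x" "z = \<iota> e (\<tau> s)" by (auto simp: h_def)
      have "\<Gamma> x (\<iota> e (\<tau> s)) = \<bar>\<tau> s - s\<bar>"
        using T[OF p(1)] near[OF p(1)] by (intro local_dist[OF good p(1)]) auto
      then show "z \<in> {z. \<Gamma> x z = ereal \<delta>}" using T[OF p(1)] p(2) by simp
    next
      fix z assume "z \<in> {z. \<Gamma> x z = ereal \<delta>}"
      then have z: "\<Gamma> x z = ereal \<delta>" by simp
      obtain e t where et: "(e, t) \<in> pre z" using pre_nonempty by blast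
      have "\<Gamma> x z < ereal r" using z \<delta> by simp
      from local_dist_converse[OF good this et] obtain s where
        s: "(e, s) \<in> pre x" "\<Gamma> x z = \<bar>t - s\<bar>" by blast
      obtain s' where s': "s = ereal s'" using pre_finite_real[OF good_not_infp[OF good] s(1)] by blast
      have ts: "\<bar>t - s\<bar> = ereal \<delta>" using z s(2) by simp
      have t: "0 \<le> t" "t \<le> l e" "\<iota> e t = z" using et unfolding mem_pre by blast+
      have "t = \<tau> s"
      proof (cases "s = 0")
        case True
        then show ?thesis using ts t(1) by (cases t) (auto simp: \<tau>_def)
      next
        case False
        then have "s = l e" using pre_vert[OF s(1) x] by blast
        then have "t \<le> s" using t(2) by simp
        then show ?thesis using ts s' False by (cases t) (auto simp: \<tau>_def)
      qed
      then have "z = h (e, s)" using t(3) by (simp add: h_def)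
      then show "z \<in> h ` pre x" using s(1) by blast
    qed
  qed
  then show ?thesis by (rule bij_betw_same_card[symmetric])
qed

lemma sphere_card_interior:
  assumes good: "good x r" and \<delta>: "0 < \<delta>" "\<delta> < r" and x: "x \<notin> verts G"
  shows "card {z. \<Gamma> x z = ereal \<delta>} = 2"
proof -
  obtain e s where es: "(e, s) \<in> pre x" using pre_nonempty by blast
  have s: "0 < s" "s < l e" by (rule pre_notvert[OF es x])+
  have e: "e \<in> edges G" and xe: "\<iota> e s = x" using es unfolding mem_pre by blast+
  have pre: "pre x = {(e, s)}" using pre_interior[OF e s] xe by simp
  obtain s' where s': "s = ereal s'" using pre_finite_real[OF good_not_infp[OF good] es] by blast
  have "ereal (2 * r) \<le> \<bar>0 - s\<bar>" using goodD[OF good es, of 0] s by auto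
  then have lo: "0 < s' - \<delta>" using s s' \<delta> by auto
  have "ereal (2 * r) \<le> \<bar>l e - s\<bar>" using goodD[OF good es, of "l e"] s by auto
  then have hi: "ereal (s' + \<delta>) < l e" using s s' \<delta> by (cases "l e") auto
  have mid: "ereal (s' - \<delta>) < l e" using less_trans[OF _ hi, of "ereal (s' - \<delta>)"] \<delta> by simp
  have "{z. \<Gamma> x z = ereal \<delta>} = {\<iota> e (ereal (s' - \<delta>)), \<iota> e (ereal (s' + \<delta>))}"
  proof (intro equalityI subsetI)
    fix z assume "z \<in> {z. \<Gamma> x z = ereal \<delta>}"
    then have z: "\<Gamma> x z = ereal \<delta>" by simp
    obtain e1 t where et: "(e1, t) \<in> pre z" using pre_nonempty by blast
    have "\<Gamma> x z < ereal r" using z \<delta> by simp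
    from local_dist_converse[OF good this et] obtain s1 where
      s1: "(e1, s1) \<in> pre x" "\<Gamma> x z = \<bar>t - s1\<bar>" by blast
    then have "e1 = e" "s1 = s" using pre by auto
    then have ts: "\<bar>t - ereal s'\<bar> = ereal \<delta>" using z s1(2) s' by simp
    have "t = ereal (s' - \<delta>) \<or> t = ereal (s' + \<delta>)" using ts by (cases t) auto
    moreover have "\<iota> e t = z" using et \<open>e1 = e\<close> unfolding mem_pre by blast
    ultimately show "z \<in> {\<iota> e (ereal (s' - \<delta>)), \<iota> e (ereal (s' + \<delta>))}" by auto
  next
    fix z assume "z \<in> {\<iota> e (ereal (s' - \<delta>)), \<iota> e (ereal (s' + \<delta>))}"
    then obtain t where t: "z = \<iota> e (ereal t)" "t = s' - \<delta> \<or> t = s' + \<delta>" by blast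
    have "\<Gamma> x (\<iota> e (ereal t)) = \<bar>ereal t - s\<bar>"
      using t(2) lo hi mid \<delta> s' by (intro local_dist[OF good es]) auto
    then show "z \<in> {z. \<Gamma> x z = ereal \<delta>}" using t \<delta> s' by auto
  qed
  moreover have "\<iota> e (ereal (s' - \<delta>)) \<noteq> \<iota> e (ereal (s' + \<delta>))"
    using inj_interior(2)[OF e e, of "ereal (s' - \<delta>)" "ereal (s' + \<delta>)"] lo hi mid \<delta> by auto
  ultimately show ?thesis by simp
qed

text \<open>
  If the two edge ends at \<open>u\<close> belong to one edge, the graph is a loop and the curve has no points at
  infinity. Otherwise the two edges can be merged, or both are infinite and there are no others.
\<close>

lemma valence_two_cases:
  assumes u: "u \<in> verts G" "\<not> infp u" "card (pre u) = 2" and w: "infp w"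
  shows "l ` edges G = {\<infinity>} \<or> (\<exists>G' l'. model \<Gamma> G' l' \<and> card (edges G') < card (edges G))"
proof -
  obtain p q where "pre u = {p, q}" "p \<noteq> q" using u(3) by (auto simp: card_2_iff)
  moreover obtain e1 s1 where "p = (e1, s1)" by (cases p)
  moreover obtain e2 s2 where "q = (e2, s2)" by (cases q)
  ultimately have P: "pre u = {(e1, s1), (e2, s2)}" and ne: "(e1, s1) \<noteq> (e2, s2)" by auto
  have p: "(e1, s1) \<in> pre u" "(e2, s2) \<in> pre u" unfolding P by simp_all
  have E: "e1 \<in> edges G" "e2 \<in> edges G" using p unfolding mem_pre by blast+
  have at_u: "e = e1 \<or> e = e2" if "e \<in> edges G" "u \<in> ends G e" for e
  proof -
    have "(e, 0) \<in> pre u \<or> (e, l e) \<in> pre u" using that ends_eq[OF that(1)] l_pos[OF that(1)] by (auto simp: mem_pre)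
    then show ?thesis unfolding P by auto
  qed
  have reach: "(u, v) \<in> {(x, y). \<exists>e \<in> edges G. ends G e = {x, y}}\<^sup>*" if "v \<in> verts G" for v
    using connected_graph u(1) that by (auto simp: connected_mgraph_def)
  show ?thesis
  proof (cases "e1 = e2")
    case True
    then have "{s1, s2} = {0, l e1}" using ne pre_vert[OF p(1) u(1)] pre_vert[OF p(2) u(1)] by auto
    then have "(e1, 0) \<in> pre u" "(e1, l e1) \<in> pre u" using p True by (auto simp: doubleton_eq_iff)
    then have loop: "\<iota> e1 0 = u" "\<iota> e1 (l e1) = u" unfolding mem_pre by blast+
    then have ends1: "ends G e1 = {u}" using ends_eq[OF E(1)] by simp
    have only: "v = u" if "v \<in> verts G" for v
      using reach[OF that]
    proof (induction rule: rtrancl_induct)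
      case (step y z)
      then obtain e where e: "e \<in> edges G" "ends G e = {u, z}" by auto
      then have "e = e1" using at_u[OF e(1)] True by blast
      then show ?case using e ends1 by auto
    qed simp
    obtain f where f: "f \<in> edges G" "l f = \<infinity>" using w by (auto simp: infp_def)
    have "\<iota> f 0 = u" by (rule only[OF start_vert[OF f(1)]])
    then have "f = e1" using at_u[OF f(1)] ends_eq[OF f(1)] True by blast
    then have "infp u" using f loop(2) E(1) by (auto simp: infp_def)
    then show ?thesis using u(2) by simp
  next
    case False
    show ?thesis
    proof (cases "l e1 = \<infinity> \<and> l e2 = \<infinity>")
      case True
      have inf0: "\<iota> e (l e) \<noteq> u" if "e \<in> edges G" "l e = \<infinity>" for e using u(2) that by (auto simp: infp_def)
      have start: "\<iota> e1 0 = u" "\<iota> e2 0 = u"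
        using pre_vert[OF p(1) u(1)] pre_vert[OF p(2) u(1)] p inf0[OF E(1)] inf0[OF E(2)] True unfolding mem_pre by auto
      have leaf: "e' = e" if "e \<in> edges G" "l e = \<infinity>" "e' \<in> edges G" "\<iota> e \<infinity> \<in> ends G e'" for e e'
      proof -
        have "(e', 0) \<in> pre (\<iota> e \<infinity>) \<or> (e', l e') \<in> pre (\<iota> e \<infinity>)"
          using that ends_eq[OF that(3)] l_pos[OF that(3)] by (auto simp: mem_pre)
        then show ?thesis using pre_infinite[OF that(1,2)] by auto
      qed
      have only: "v = u \<or> v = \<iota> e1 \<infinity> \<or> v = \<iota> e2 \<infinity>" if "v \<in> verts G" for v
        using reach[OF that]
      proof (induction rule: rtrancl_induct)
        case (step y z)
        then obtain e where e: "e \<in> edges G" "ends G e = {y, z}" by auto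
        have "e = e1 \<or> e = e2"
          using step.IH at_u[OF e(1)] leaf[OF E(1) _ e(1)] leaf[OF E(2) _ e(1)] True e(2) by auto
        then have "ends G e = {u, \<iota> e1 \<infinity>} \<or> ends G e = {u, \<iota> e2 \<infinity>}"
          using ends_eq[OF E(1)] ends_eq[OF E(2)] start True by auto
        then show ?case using e(2) by (auto simp: doubleton_eq_iff)
      qed simp
      have "e = e1 \<or> e = e2" if e: "e \<in> edges G" for e
      proof -
        have "\<iota> e 0 \<in> ends G e" using ends_eq[OF e] by simp
        then show ?thesis using only[OF start_vert[OF e]] at_u[OF e] leaf[OF E(1) _ e] leaf[OF E(2) _ e] True by auto
      qed
      then have "edges G = {e1, e2}" using E by blast
      then show ?thesis using True by simp
    next
      case nF: False
      show ?thesis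
      proof (cases "l e1 = \<infinity>")
        case False
        then show ?thesis using merge_at_vertex[OF P \<open>e1 \<noteq> e2\<close> _ u(2,1)] by blast
      next
        case True
        then have l2: "l e2 \<noteq> \<infinity>" using nF by simp
        have P': "pre u = {(e2, s2), (e1, s1)}" using P by (simp add: insert_commute)
        show ?thesis using merge_at_vertex[OF P' _ l2 u(2,1)] \<open>e1 \<noteq> e2\<close> by blast
      qed
    qed
  qed
qed

text \<open>
  A finite end of an infinite edge belongs to the core, its infinite end does not.
\<close>

definition core :: "'p set" where
  "core = {x. \<forall>f\<in>edges G. l f = \<infinity> \<longrightarrow> x \<notin> \<iota> f ` {0<..\<infinity>}}"

text \<open>
  Whether a point has finite distance from \<open>x\<close> is constant along finite edges. To make this constant
  along infinite edges as well, the infinite end is given the answer of the start of its edge.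
\<close>

lemma finite_dist:
  assumes "\<not> infp x" "\<not> infp y"
  shows "\<Gamma> x y < \<infinity>"
proof -
  define f where "f y \<longleftrightarrow> (\<not> infp y \<and> \<Gamma> x y < \<infinity>) \<or> (\<exists>e\<in>edges G. l e = \<infinity> \<and> y = \<iota> e \<infinity> \<and> \<Gamma> x (\<iota> e 0) < \<infinity>)" for y
  have fe: "f (\<iota> e s) \<longleftrightarrow> \<Gamma> x (\<iota> e 0) < \<infinity>" if e: "e \<in> edges G" "s \<in> {0..l e}" for e s
  proof (cases "s = \<infinity>")
    case True
    then have le: "l e = \<infinity>" using e by simp
    have "infp (\<iota> e s)" using infp_edge_iff[OF e(1), of s] e True by simp
    moreover have "e' = e" if "e' \<in> edges G" "l e' = \<infinity>" "\<iota> e s = \<iota> e' \<infinity>" for e'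
    proof -
      have "(e', \<infinity>) \<in> pre (\<iota> e \<infinity>)" using that True by (simp add: mem_pre)
      then show ?thesis using pre_infinite[OF e(1) le] by simp
    qed
    ultimately show ?thesis unfolding f_def using e(1) le True by metis
  next
    case False
    have ni: "\<not> infp (\<iota> e s)" using infp_edge_iff[OF e(1), of s] e False by simp
    obtain s' where s': "s = ereal s'" using e(2) False by (cases s) auto
    have "\<Gamma> (\<iota> e 0) (\<iota> e s) \<le> \<bar>s - 0\<bar>" using e l_pos[OF e(1)] by (intro \<Gamma>_edge) auto
    then have d: "\<Gamma> (\<iota> e 0) (\<iota> e s) \<le> ereal \<bar>s'\<bar>" using s' by simp
    have fin: "a < \<infinity>" if "a \<le> b + d" "b < \<infinity>" "d \<le> ereal k" for a b d :: ereal and k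
      using that by (cases a; cases b; cases d) auto
    have "\<Gamma> x (\<iota> e s) < \<infinity> \<longleftrightarrow> \<Gamma> x (\<iota> e 0) < \<infinity>"
    proof
      assume "\<Gamma> x (\<iota> e s) < \<infinity>"
      then show "\<Gamma> x (\<iota> e 0) < \<infinity>" using fin[OF \<Gamma>_triangle[of x "\<iota> e 0" "\<iota> e s"]] d \<Gamma>_sym[of "\<iota> e 0"] by simp
    next
      assume "\<Gamma> x (\<iota> e 0) < \<infinity>"
      then show "\<Gamma> x (\<iota> e s) < \<infinity>" using fin[OF \<Gamma>_triangle[of x "\<iota> e s" "\<iota> e 0"]] d by simp
    qed
    moreover have "\<not> (\<exists>e'\<in>edges G. l e' = \<infinity> \<and> \<iota> e s = \<iota> e' \<infinity>)" using ni by (simp add: infp_def)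
    ultimately show ?thesis unfolding f_def using ni by blast
  qed
  have "f x = f y"
    by (rule constant_from_edges) (use fe in simp)
  moreover have "f x" unfolding f_def using assms(1) by simp
  ultimately have "f y" by simp
  then show ?thesis unfolding f_def using assms(2) by (auto simp: infp_def)
qed

lemma core_not_infp: "x \<in> core \<Longrightarrow> \<not> infp x"
  by (auto simp: core_def infp_def)

lemma core_bounded: "\<exists>C. \<forall>x\<in>core. \<forall>y\<in>core. \<Gamma> x y \<le> ereal C"
proof -
  obtain v where v: "\<not> infp v" using ex_finite_point by blast
  have nn: "0 \<le> real_of_ereal (\<Gamma> v (\<iota> e 0)) + real_of_ereal (l e)" if "e \<in> edges G" for e
    using l_pos[OF that] by (simp add: real_of_ereal_pos less_imp_le)
  define C where "C = (\<Sum>e\<in>edges G. real_of_ereal (\<Gamma> v (\<iota> e 0)) + real_of_ereal (l e))"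
  have near: "\<Gamma> v x \<le> ereal C" if x: "x \<in> core" for x
  proof -
    obtain e t where et: "e \<in> edges G" "0 \<le> t" "t \<le> l e" "x = \<iota> e t" by (rule point_on_edge)
    have "0 \<le> l e" using et(2,3) by order
    have "\<not> infp (\<iota> e 0)" using infp_edge_iff[OF et(1), of 0] \<open>0 \<le> l e\<close> by simp
    then have "\<Gamma> v (\<iota> e 0) < \<infinity>" by (rule finite_dist[OF v])
    then obtain a where a: "\<Gamma> v (\<iota> e 0) = ereal a" using \<Gamma>_nonneg[of v "\<iota> e 0"] by (cases "\<Gamma> v (\<iota> e 0)") auto
    have "t \<le> ereal (real_of_ereal (l e))"
    proof (cases "l e = \<infinity>")
      case True
      have "t = 0"
      proof (rule ccontr)
        assume "t \<noteq> 0"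
        then have "x \<in> \<iota> e ` {0<..\<infinity>}" using et by auto
        then show False using x et(1) True by (auto simp: core_def)
      qed
      then show ?thesis using True by simp
    next
      case False
      then show ?thesis using et(3) \<open>0 \<le> l e\<close> by (cases "l e") auto
    qed
    then have "\<Gamma> v x \<le> ereal a + ereal (real_of_ereal (l e))"
      using \<Gamma>_triangle[of v x "\<iota> e 0"] \<Gamma>_edge[OF et(1), of 0 t] et \<open>0 \<le> l e\<close> a
        add_mono[of "ereal a" "ereal a" "\<Gamma> (\<iota> e 0) x" "ereal (real_of_ereal (l e))"]
      by (auto intro: order_trans)
    also have "\<dots> \<le> ereal C"
      using member_le_sum[of e "edges G" "\<lambda>e. real_of_ereal (\<Gamma> v (\<iota> e 0)) + real_of_ereal (l e)"] nn et(1) a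
      by (simp add: C_def)
    finally show ?thesis .
  qed
  have "\<Gamma> x y \<le> ereal (2 * C)" if "x \<in> core" "y \<in> core" for x y
  proof -
    have "\<Gamma> x y \<le> \<Gamma> x v + \<Gamma> v y" by (rule \<Gamma>_triangle)
    also have "\<dots> \<le> ereal C + ereal C" using near[OF that(1)] near[OF that(2)] \<Gamma>_sym[of x v] by (intro add_mono) auto
    finally show ?thesis by simp
  qed
  then show ?thesis by blast
qed

end

context tmodel_pair
begin

lemma valence_two:
  assumes u: "u \<in> verts G'" "u \<notin> verts G" "\<not> infp u"
  shows "card (M'.pre u) = 2"
proof -
  have "\<not> M'.infp u" using u(3) infp_pair by simp
  then obtain r2 where r2: "M'.good u r2" using M'.good_exists by blast
  obtain r1 where r1: "good u r1" using good_exists[OF u(3)] by blast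
  define \<delta> where "\<delta> = min r1 r2 / 2"
  have \<delta>: "0 < \<delta>" "\<delta> < r1" "\<delta> < r2" using good_pos[OF r1] M'.good_pos[OF r2] by (auto simp: \<delta>_def)
  show ?thesis using sphere_card_interior[OF r1 \<delta>(1,2) u(2)] M'.sphere_card_vert[OF r2 \<delta>(1,3) u(1)] by simp
qed

text \<open>
  The second model has fewest edges, and not all of them are infinite. Hence no vertex of it lies inside
  an infinite edge of the first model (\<open>valence_two_cases\<close>). By \<open>transition\<close>, such an edge then runs
  along a single edge of the second model, which must be infinite, too.
\<close>

lemma core_subset:
  assumes minimal: "\<And>G'' l''. model \<Gamma> G'' l'' \<Longrightarrow> card (edges G') \<le> card (edges G'')"
    and no_star: "l' ` edges G' \<noteq> {\<infinity>}"
  shows "M'.core \<subseteq> core"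
proof (rule subsetI, rule ccontr)
  fix x assume x: "x \<in> M'.core" "x \<notin> core"
  then obtain f where f: "f \<in> edges G" "l f = \<infinity>" "x \<in> \<iota> f ` {0<..\<infinity>}" by (auto simp: core_def)
  then obtain t where t: "0 < t" "x = \<iota> f t" by auto
  have "\<not> M'.infp x" by (rule M'.core_not_infp[OF x(1)])
  then have nix: "\<not> infp x" using infp_pair by simp
  then have "t \<noteq> \<infinity>" using f t by (auto simp: infp_def)
  then obtain t' where t': "t = ereal t'" using t(1) by (cases t) auto
  have inf: "M'.infp (\<iota> f \<infinity>)"
    unfolding infp_pair using f by (auto simp: infp_def)
  have nv: "\<iota> f (ereal s) \<notin> verts G'" if "0 < ereal s" "ereal s < \<infinity>" for s
  proof
    assume v: "\<iota> f (ereal s) \<in> verts G'"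
    have nv: "\<iota> f (ereal s) \<notin> verts G" using interior_not_vert[OF f(1), of "ereal s"] that f(2) by simp
    have ni: "\<not> infp (\<iota> f (ereal s))" using not_infp_interior[OF f(1), of s] that f(2) by simp
    then have ni': "\<not> M'.infp (\<iota> f (ereal s))" using infp_pair by simp
    from M'.valence_two_cases[OF v ni' valence_two[OF v nv ni] inf] show False
      using no_star minimal by (auto simp: not_less[symmetric])
  qed
  have t'0: "0 < ereal t'" "ereal t' < \<infinity>" using t t' by auto
  obtain e' \<sigma> d where tr: "e' \<in> edges G'" "\<sigma> = 1 \<or> \<sigma> = - 1"
    "\<And>t. 0 < ereal t \<Longrightarrow> ereal t < \<infinity> \<Longrightarrow> 0 < of_int \<sigma> * t + d \<and> ereal (of_int \<sigma> * t + d) < l' e' \<and>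
        \<iota> f (ereal t) = \<iota>' e' (ereal (of_int \<sigma> * t + d))"
  proof (rule transition[OF f(1) order_refl _ _ t'0])
    show "\<infinity> \<le> l f" using f(2) by simp
    show "\<iota> f (ereal s) \<notin> verts G'" if "0 < ereal s" "ereal s < \<infinity>" for s by (rule nv[OF that])
  qed (rule that)
  have "0 < \<bar>d\<bar> + 1" by linarith
  then have "0 < of_int \<sigma> * (\<bar>d\<bar> + 1) + d" using tr(3)[of "\<bar>d\<bar> + 1"] by simp
  then have "\<sigma> = 1" using tr(2) by auto
  have "l' e' = \<infinity>"
  proof (cases "l' e'")
    case (real L)
    define T where "T = \<bar>d\<bar> + \<bar>L\<bar> + 1"
    have "0 < T" by (simp add: T_def)
    then have "T + d < L" using tr(3)[of T] real \<open>\<sigma> = 1\<close> by simp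
    then show ?thesis by (simp add: T_def)
  next
    case MInf
    then show ?thesis using M'.l_pos[OF tr(1)] by simp
  qed
  moreover have "x \<in> \<iota>' e' ` {0<..\<infinity>}" using tr(3)[OF t'0] t(2) t' by auto
  ultimately show False using x(1) tr(1) by (auto simp: M'.core_def)
qed

end

context scaled
begin

lemma push_length_infinite: "push_length f = \<infinity> \<longleftrightarrow> l f = \<infinity>"
  using c_pos by (cases "l f") (auto simp: push_length_def)

text \<open>
  The core of a minimal model does not depend on the model, so it is invariant under the homeomorphism
  behind a scaling. Hence its diameter, which is finite, is zero unless \<open>c = 1\<close>.
\<close>

lemma minimal_model_star:
  assumes minimal: "\<And>G' l'. model \<Gamma> G' l' \<Longrightarrow> card (edges G) \<le> card (edges G')"
    and c1: "c \<noteq> 1"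
  shows "l ` edges G = {\<infinity>}"
proof (rule ccontr)
  assume no_star: "l ` edges G \<noteq> {\<infinity>}"
  interpret P: tmodel_pair \<Gamma> G l \<iota> push_graph push_length push_map
    by (intro tmodel_pair.intro tmodel_axioms tmodel.intro push_model np)
  interpret Q: tmodel_pair \<Gamma> push_graph push_length push_map G l \<iota>
    by (intro tmodel_pair.intro tmodel_axioms P.M'.tmodel_axioms)
  have E: "edges push_graph = edges G" by (simp add: push_graph_def)
  have ns: "push_length ` edges push_graph \<noteq> {\<infinity>}"
  proof
    assume *: "push_length ` edges push_graph = {\<infinity>}"
    then have "push_length e = \<infinity>" if "e \<in> edges G" for e using that E by blast
    then have "l e = \<infinity>" if "e \<in> edges G" for e using that push_length_infinite by blast
    moreover have "edges G \<noteq> {}" using * E by auto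
    ultimately have "l ` edges G = {\<infinity>}" by (auto simp: image_constant_conv)
    then show False using no_star by blast
  qed
  have core_eq: "P.M'.core = core"
  proof
    show "P.M'.core \<subseteq> core" by (rule P.core_subset[OF _ ns]) (use minimal E in simp)
    show "core \<subseteq> P.M'.core" by (rule Q.core_subset[OF minimal no_star])
  qed
  have ray: "\<phi> x \<in> push_map f ` {0<..\<infinity>} \<longleftrightarrow> x \<in> \<iota> f ` {0<..\<infinity>}" for x f
  proof
    assume "\<phi> x \<in> push_map f ` {0<..\<infinity>}"
    then obtain t where t: "0 < t" "\<phi> x = \<phi> (\<iota> f (ereal c * t))" by (auto simp: push_map_def)
    then have "x = \<iota> f (ereal c * t)" using inj_\<phi> by (simp add: inj_eq)
    then show "x \<in> \<iota> f ` {0<..\<infinity>}" using ereal_scale_pos[OF c_pos, of t] t(1) by auto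
  next
    assume "x \<in> \<iota> f ` {0<..\<infinity>}"
    then obtain t where t: "0 < t" "x = \<iota> f t" by auto
    have "\<phi> x = push_map f (ereal (1 / c) * t)" by (simp only: t(2) push_map_def ereal_scale_inverse[OF c_pos])
    moreover have "0 < ereal (1 / c) * t" using ereal_scale_pos[of "1 / c" t] c_pos t(1) by simp
    ultimately show "\<phi> x \<in> push_map f ` {0<..\<infinity>}" by auto
  qed
  have inv: "\<phi> x \<in> core \<longleftrightarrow> x \<in> core" for x
  proof -
    have "\<phi> x \<in> P.M'.core \<longleftrightarrow> x \<in> core"
      unfolding P.M'.core_def core_def mem_Collect_eq E push_length_infinite ray ..
    then show ?thesis using core_eq by simp
  qed
  \<comment> \<open>The set of distances in the core is bounded and closed under multiplication by \<open>c\<close> and by \<open>1 / c\<close>.\<close>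
  define A where "A = {a. \<exists>x\<in>core. \<exists>y\<in>core. \<Gamma> x y = ereal a}"
  obtain C where C: "\<And>x y. x \<in> core \<Longrightarrow> y \<in> core \<Longrightarrow> \<Gamma> x y \<le> ereal C" using core_bounded by blast
  have bdd: "bdd_above A"
  proof (rule bdd_aboveI)
    fix a assume "a \<in> A"
    then obtain x y where xy: "x \<in> core" "y \<in> core" "\<Gamma> x y = ereal a" by (auto simp: A_def)
    then show "a \<le> C" using C[of x y] by simp
  qed
  have down: "a / c \<in> A" if aA: "a \<in> A" for a
  proof -
    obtain x y where xy: "x \<in> core" "y \<in> core" "\<Gamma> x y = ereal a" using aA by (auto simp: A_def)
    have "\<Gamma> (\<phi> x) (\<phi> y) = ereal (a / c)" using \<phi>_scales[of x y] xy(3) c_pos by (cases "\<Gamma> (\<phi> x) (\<phi> y)") auto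
    then show ?thesis unfolding A_def using xy(1,2) inv by blast
  qed
  have up: "c * a \<in> A" if aA: "a \<in> A" for a
  proof -
    obtain x y where xy: "x \<in> core" "y \<in> core" "\<Gamma> x y = ereal a" using aA by (auto simp: A_def)
    have "\<phi>i x \<in> core" "\<phi>i y \<in> core" using inv[of "\<phi>i x"] inv[of "\<phi>i y"] xy by (simp_all add: \<phi>_\<phi>i)
    moreover have "\<Gamma> (\<phi>i x) (\<phi>i y) = ereal (c * a)" using \<phi>_scales[of "\<phi>i x" "\<phi>i y"] xy(3) by (simp add: \<phi>_\<phi>i)
    ultimately show ?thesis unfolding A_def by blast
  qed
  obtain a where a: "a \<in> A" "0 < a"
  proof -
    have "edges G \<noteq> {}" using point_on_edge by blast
    have "\<exists>e\<in>edges G. l e \<noteq> \<infinity>"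
    proof (rule ccontr)
      assume "\<not> ?thesis"
      then have "l e = \<infinity>" if "e \<in> edges G" for e using that by blast
      then have "l ` edges G = {\<infinity>}" using \<open>edges G \<noteq> {}\<close> by (auto simp: image_constant_conv)
      then show False using no_star by blast
    qed
    then obtain e where e: "e \<in> edges G" "l e \<noteq> \<infinity>" by blast
    obtain m where m: "0 < ereal m" "ereal m < l e" using ereal_dense2[OF l_pos[OF e(1)]] by blast
    have in_core: "\<iota> e t \<in> core" if t: "0 \<le> t" "t \<le> l e" for t
      unfolding core_def
    proof (intro CollectI ballI impI notI)
      fix f assume f: "f \<in> edges G" "l f = \<infinity>" "\<iota> e t \<in> \<iota> f ` {0<..\<infinity>}"
      then obtain s where s: "0 < s" "\<iota> e t = \<iota> f s" by auto
      have "pre (\<iota> f s) = {(f, s)}" by (rule pre_ray[OF f(1,2) s(1)])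
      moreover have "(e, t) \<in> pre (\<iota> f s)" using e t s by (simp add: mem_pre)
      ultimately show False using e(2) f(2) by auto
    qed
    have x: "\<iota> e 0 \<in> core" "\<iota> e (ereal m) \<in> core" using in_core l_pos[OF e(1)] m by (auto simp: less_imp_le)
    have "\<iota> e 0 \<noteq> \<iota> e (ereal m)" using interior_not_vert[OF e(1) m] start_vert[OF e(1)] by auto
    then have "\<Gamma> (\<iota> e 0) (\<iota> e (ereal m)) \<noteq> 0" using \<Gamma>_eq_0_iff by simp
    moreover have "\<Gamma> (\<iota> e 0) (\<iota> e (ereal m)) < \<infinity>" by (rule finite_dist[OF x[THEN core_not_infp]])
    ultimately obtain a where "\<Gamma> (\<iota> e 0) (\<iota> e (ereal m)) = ereal a" "0 < a"
      using \<Gamma>_nonneg[of "\<iota> e 0" "\<iota> e (ereal m)"] by (cases "\<Gamma> (\<iota> e 0) (\<iota> e (ereal m))") auto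
    then show ?thesis using that x unfolding A_def by blast
  qed
  have "A \<noteq> {}" using a(1) by blast
  have "Sup A \<le> c * Sup A"
  proof (rule cSup_least[OF \<open>A \<noteq> {}\<close>])
    fix b assume "b \<in> A"
    then have "b / c \<le> Sup A" using cSup_upper[OF down bdd] by blast
    then show "b \<le> c * Sup A" using c_pos by (simp add: field_simps)
  qed
  moreover have "Sup A \<le> Sup A / c"
  proof (rule cSup_least[OF \<open>A \<noteq> {}\<close>])
    fix b assume "b \<in> A"
    then have "c * b \<le> Sup A" using cSup_upper[OF up bdd] by blast
    then show "b \<le> Sup A / c" using c_pos by (simp add: field_simps)
  qed
  then have "c * Sup A \<le> Sup A" using c_pos by (simp add: field_simps)
  ultimately have "(c - 1) * Sup A = 0" by (simp add: algebra_simps)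
  moreover have "0 < Sup A" using cSup_upper[OF a(1) bdd] a(2) by linarith
  ultimately show False using c1 by simp
qed

end

section \<open>Scaling a star\<close>

locale star = tmodel +
  assumes all_infinite: "\<And>e. e \<in> edges G \<Longrightarrow> l e = \<infinity>"
begin

text \<open>
  The start of the edge through a point is well defined, because no point at infinity is the start of an
  edge. It is constant on edges.
\<close>

lemma centre:
  assumes e: "e \<in> edges G" "e' \<in> edges G"
  shows "\<iota> e 0 = \<iota> e' 0"
proof -
  define f where "f y = (SOME z. \<exists>e t. (e, t) \<in> pre y \<and> z = \<iota> e 0)" for y
  have fe: "f (\<iota> e s) = \<iota> e 0" if es: "e \<in> edges G" "s \<in> {0..l e}" for e s
  proof -
    have p: "(e, s) \<in> pre (\<iota> e s)" using es by (simp add: mem_pre)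
    have "\<iota> e'' 0 = \<iota> e 0" if q: "(e'', t) \<in> pre (\<iota> e s)" for e'' t
    proof (cases "e'' = e")
      case False
      have le: "l e = \<infinity>" "l e'' = \<infinity>" "e'' \<in> edges G" "\<iota> e'' t = \<iota> e s"
        using all_infinite es(1) q unfolding mem_pre by blast+
      have "s = 0 \<or> s = l e" "t = 0 \<or> t = l e''" using pre_cases[OF p q] False by auto
      moreover have "s \<noteq> \<infinity>" using q pre_infinite[OF es(1) le(1)] False by auto
      moreover have "t \<noteq> \<infinity>" using p pre_infinite[OF le(3,2)] False le(4) by auto
      ultimately show ?thesis using le by simp
    qed simp
    then show ?thesis unfolding f_def using p by (intro some_equality) blast+
  qed
  have "f (\<iota> e 0) = f (\<iota> e' 0)" by (rule constant_from_edges) (simp add: fe)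
  then show ?thesis using fe[OF e(1), of 0] fe[OF e(2), of 0] l_pos[OF e(1)] l_pos[OF e(2)] by simp
qed

definition stretch :: "real \<Rightarrow> 'a \<Rightarrow> 'a" where
  "stretch c y = (SOME z. \<exists>e t. (e, t) \<in> pre y \<and> z = \<iota> e (ereal c * t))"

lemma stretch_edge:
  assumes e: "e \<in> edges G" and t: "0 \<le> t"
  shows "stretch c (\<iota> e t) = \<iota> e (ereal c * t)"
proof -
  have le: "l e = \<infinity>" by (rule all_infinite[OF e])
  have p: "(e, t) \<in> pre (\<iota> e t)" using assms le by (simp add: mem_pre)
  have "\<iota> e' (ereal c * s) = \<iota> e (ereal c * t)" if q: "(e', s) \<in> pre (\<iota> e t)" for e' s
  proof (cases "(e', s) = (e, t)")
    case False
    have le': "l e' = \<infinity>" "e' \<in> edges G" "\<iota> e' s = \<iota> e t" using all_infinite q unfolding mem_pre by blast+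
    have "t = 0 \<or> t = \<infinity>" "s = 0 \<or> s = \<infinity>" using pre_cases[OF p q] False le le' by auto
    moreover have "t \<noteq> \<infinity>" using q pre_infinite[OF e le] False by auto
    moreover have "s \<noteq> \<infinity>" using p pre_infinite[OF le'(2,1)] False le'(3) by auto
    ultimately have "s = 0" "t = 0" by auto
    then show ?thesis using centre[OF e le'(2)] by simp
  qed simp
  then show ?thesis unfolding stretch_def using p by (intro some_equality) blast+
qed

lemma star_point: obtains e t where "e \<in> edges G" "0 \<le> t" "y = \<iota> e t"
  by (rule point_on_edge[of y]) (rule that)

lemma stretch_inverse: "0 < c \<Longrightarrow> stretch c (stretch (1 / c) y) = y"
proof -
  assume c: "0 < c"
  obtain e t where et: "e \<in> edges G" "0 \<le> t" "y = \<iota> e t" by (rule star_point)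
  have "0 \<le> ereal (1 / c) * t" using ereal_scale_nonneg[of "1 / c" t] c et by simp
  then show ?thesis using et by (simp only: stretch_edge ereal_scale_inverse[OF c])
qed

lemma infp_stretch: "0 < c \<Longrightarrow> infp (stretch c y) \<longleftrightarrow> infp y"
proof -
  assume c: "0 < c"
  obtain e t where et: "e \<in> edges G" "0 \<le> t" "y = \<iota> e t" by (rule star_point)
  have "0 \<le> ereal c * t" using ereal_scale_nonneg[OF c, of t] et by simp
  moreover have "ereal c * t = \<infinity> \<longleftrightarrow> t = \<infinity>" using c by (cases t) auto
  ultimately show ?thesis
    using infp_edge_iff[OF et(1,2)] infp_edge_iff[OF et(1), of "ereal c * t"] all_infinite[OF et(1)] et(2,3)
    by (simp add: stretch_edge[OF et(1,2)])
qed

lemma continuous_stretch: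
  assumes c: "0 < c"
  shows "continuous_on UNIV (stretch c)"
proof (rule continuous_from_edges)
  fix e assume e: "e \<in> edges G"
  have 1: "continuous_on {0..l e} (\<lambda>t. ereal c * t)"
    unfolding continuous_on_def by (intro ballI tendsto_cmult_ereal tendsto_ident_at) simp
  have "continuous_on {0..l e} (\<lambda>t. \<iota> e (ereal c * t))"
    by (rule continuous_on_compose2[OF continuous_edge[OF e] 1])
      (use ereal_scale_nonneg[OF c] all_infinite[OF e] in auto)
  then show "continuous_on {0..l e} (\<lambda>t. stretch c (\<iota> e t))"
    by (rule continuous_on_eq) (simp add: stretch_edge[OF e])
qed

text \<open>
  The two factors cancel in the slopes.
\<close>

definition rescale :: "real \<Rightarrow> ('a \<Rightarrow> ereal) \<Rightarrow> 'a \<Rightarrow> ereal" where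
  "rescale c f y = ereal (1 / c) * f (stretch c y)"

lemma rescale_minf: "0 < c \<Longrightarrow> rescale c (\<lambda>_. - \<infinity>) = (\<lambda>_. - \<infinity>)"
  by (rule ext) (simp add: rescale_def)

lemma rescale_inverse: "0 < c \<Longrightarrow> rescale (1 / c) (rescale c f) = f"
proof -
  assume c: "0 < c"
  show ?thesis
  proof
    fix y
    have "rescale (1 / c) (rescale c f) y = ereal (1 / (1 / c)) * (ereal (1 / c) * f (stretch c (stretch (1 / c) y)))"
      by (simp only: rescale_def)
    then show "rescale (1 / c) (rescale c f) y = f y"
      using stretch_inverse[OF c] ereal_scale_inverse[OF c] by simp
  qed
qed

lemma rescale_Rfin:
  assumes c: "0 < c" and f: "f \<in> Rfin"
  shows "rescale c f \<in> Rfin"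
  unfolding Rfin_iff
proof (intro conjI ballI allI impI)
  have "continuous_on UNIV (\<lambda>y. f (stretch c y))"
    by (rule continuous_on_compose2[OF Rfin_cont[OF f] continuous_stretch[OF c]]) simp
  then show "continuous_on UNIV (rescale c f)"
    unfolding rescale_def continuous_on_def by (intro ballI tendsto_cmult_ereal) auto
  fix e assume e: "e \<in> edges G"
  have le: "l e = \<infinity>" by (rule all_infinite[OF e])
  have "rpa \<infinity> (\<lambda>t. real_of_ereal (f (\<iota> e (ereal t))))" using f e le unfolding Rfin_iff by force
  then have r: "rpa \<infinity> (\<lambda>t. real_of_ereal (f (\<iota> e (ereal (c * t)))) / c)" by (rule rpa_rescale[OF _ c])
  have eq: "real_of_ereal (rescale c f (\<iota> e (ereal t))) = real_of_ereal (f (\<iota> e (ereal (c * t)))) / c"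
    if "0 < t" "ereal t < \<infinity>" for t
    using stretch_edge[OF e, of "ereal t" c] that(1) by (simp add: rescale_def)
  have "rpa \<infinity> (\<lambda>t. real_of_ereal (rescale c f (\<iota> e (ereal t)))) \<longleftrightarrow>
      rpa \<infinity> (\<lambda>t. real_of_ereal (f (\<iota> e (ereal (c * t)))) / c)"
    by (rule rpa_cong) (rule eq)
  then show "rpa (l e) (\<lambda>t. real_of_ereal (rescale c f (\<iota> e (ereal t))))" using r le by simp
next
  fix y assume "\<bar>rescale c f y\<bar> = \<infinity>"
  then have "\<bar>f (stretch c y)\<bar> = \<infinity>" unfolding rescale_def by (cases "f (stretch c y)") auto
  then have "infp (stretch c y)" using Rfin_real[OF f, of "stretch c y"] by metis
  then show "infp y" using infp_stretch[OF c] by simp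
qed

lemma rescale_Rat:
  assumes "0 < c" "f \<in> Rat \<Gamma>"
  shows "rescale c f \<in> Rat \<Gamma>"
  using assms rescale_Rfin[of c f] rescale_minf[of c] unfolding Rat_eq by auto

lemma rescale_mult:
  assumes c: "0 < c" and fg: "f \<in> Rat \<Gamma>" "g \<in> Rat \<Gamma>"
  shows "rescale c (rat_mult \<Gamma> f g) = rat_mult \<Gamma> (rescale c f) (rescale c g)"
proof (cases "f = (\<lambda>_. - \<infinity>) \<or> g = (\<lambda>_. - \<infinity>)")
  case True
  then have "rat_mult \<Gamma> f g = (\<lambda>_. - \<infinity>)" unfolding rat_mult_def by (rule if_P)
  moreover have "rescale c f = (\<lambda>_. - \<infinity>) \<or> rescale c g = (\<lambda>_. - \<infinity>)" using True rescale_minf[OF c] by metis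
  then have "rat_mult \<Gamma> (rescale c f) (rescale c g) = (\<lambda>_. - \<infinity>)" unfolding rat_mult_def by (rule if_P)
  ultimately show ?thesis using rescale_minf[OF c] by simp
next
  case False
  then have R: "f \<in> Rfin" "g \<in> Rfin" using fg by (auto simp: Rat_eq)
  show ?thesis
  proof (rule continuous_eqI)
    show "continuous_on UNIV (rescale c (rat_mult \<Gamma> f g))"
      by (rule Rfin_cont[OF rescale_Rfin[OF c rat_mult_Rfin[OF R]]])
    show "continuous_on UNIV (rat_mult \<Gamma> (rescale c f) (rescale c g))"
      by (rule Rfin_cont[OF rat_mult_Rfin[OF rescale_Rfin[OF c R(1)] rescale_Rfin[OF c R(2)]]])
    fix x assume x: "\<not> infp x"
    then have sx: "\<not> infp (stretch c x)" using infp_stretch[OF c] by blast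
    obtain a b where ab: "f (stretch c x) = ereal a" "g (stretch c x) = ereal b"
      using Rfin_real[OF R(1) sx] Rfin_real[OF R(2) sx] by (cases "f (stretch c x)"; cases "g (stretch c x)") auto
    show "rescale c (rat_mult \<Gamma> f g) x = rat_mult \<Gamma> (rescale c f) (rescale c g) x"
      unfolding rat_mult_finite[OF rescale_Rfin[OF c R(1)] rescale_Rfin[OF c R(2)] x]
      unfolding rescale_def rat_mult_finite[OF R sx] ab by (simp add: add_divide_distrib)
  qed
qed

lemma rescale_max:
  assumes c: "0 < c"
  shows "rescale c (\<lambda>x. max (f x) (g x)) = (\<lambda>x. max (rescale c f x) (rescale c g x))"
proof
  fix y
  have "ereal (1 / c) * max a b = max (ereal (1 / c) * a) (ereal (1 / c) * b)" for a b
    using ereal_scale_cancel[of "1 / c" a b] c by (simp add: max_def)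
  then show "rescale c (\<lambda>x. max (f x) (g x)) y = max (rescale c f y) (rescale c g y)"
    by (simp only: rescale_def)
qed

lemma rescale_automorphism:
  assumes c: "0 < c"
  shows "restrict (rescale c) (Rat \<Gamma>) \<in> Aut_semiring (Rat_semifield \<Gamma>)"
proof -
  let ?\<psi> = "restrict (rescale c) (Rat \<Gamma>)"
  have minf: "(\<lambda>_. - \<infinity>) \<in> Rat \<Gamma>" unfolding Rat_eq by simp
  have one: "(\<lambda>_. 0) \<in> Rat \<Gamma>" using Rfin_const[of 0] by (simp add: Rat_eq zero_ereal_def)
  have mult: "rat_mult \<Gamma> f g \<in> Rat \<Gamma>" if "f \<in> Rat \<Gamma>" "g \<in> Rat \<Gamma>" for f g
  proof (cases "f = (\<lambda>_. - \<infinity>) \<or> g = (\<lambda>_. - \<infinity>)")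
    case True
    then have "rat_mult \<Gamma> f g = (\<lambda>_. - \<infinity>)" unfolding rat_mult_def by (rule if_P)
    then show ?thesis using minf by simp
  next
    case False
    then show ?thesis using rat_mult_Rfin[of f g] that by (simp add: Rat_eq)
  qed
  have max: "(\<lambda>x. max (f x) (g x)) \<in> Rat \<Gamma>" if fg: "f \<in> Rat \<Gamma>" "g \<in> Rat \<Gamma>" for f g
  proof -
    consider "f = (\<lambda>_. - \<infinity>)" | "g = (\<lambda>_. - \<infinity>)" | "f \<in> Rfin" "g \<in> Rfin"
      using fg unfolding Rat_eq by blast
    then show ?thesis
    proof cases
      case 1
      then show ?thesis using fg(2) by simp
    next
      case 2
      then show ?thesis using fg(1) by simp
    next
      case 3
      then show ?thesis using Rfin_max by (simp add: Rat_eq)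
    qed
  qed
  have "?\<psi> \<in> ring_hom (Rat_semifield \<Gamma>) (Rat_semifield \<Gamma>)"
  proof (rule ring_hom_memI)
    fix f g assume f: "f \<in> carrier (Rat_semifield \<Gamma>)"
    then have f': "f \<in> Rat \<Gamma>" by (simp add: Rat_semifield_def)
    then show "?\<psi> f \<in> carrier (Rat_semifield \<Gamma>)" using rescale_Rat[OF c] by (simp add: Rat_semifield_def)
    assume g: "g \<in> carrier (Rat_semifield \<Gamma>)"
    then have g': "g \<in> Rat \<Gamma>" by (simp add: Rat_semifield_def)
    show "?\<psi> (f \<otimes>\<^bsub>Rat_semifield \<Gamma>\<^esub> g) = ?\<psi> f \<otimes>\<^bsub>Rat_semifield \<Gamma>\<^esub> ?\<psi> g"
      using f' g' mult rescale_mult[OF c f' g'] by (simp add: Rat_semifield_def)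
    show "?\<psi> (f \<oplus>\<^bsub>Rat_semifield \<Gamma>\<^esub> g) = ?\<psi> f \<oplus>\<^bsub>Rat_semifield \<Gamma>\<^esub> ?\<psi> g"
      using f' g' max rescale_max[OF c] by (simp add: Rat_semifield_def)
  next
    have "rescale c (\<lambda>_. 0) = (\<lambda>_. 0)" by (rule ext) (simp add: rescale_def)
    then show "?\<psi> \<one>\<^bsub>Rat_semifield \<Gamma>\<^esub> = \<one>\<^bsub>Rat_semifield \<Gamma>\<^esub>"
      using one by (simp add: Rat_semifield_def)
  qed
  moreover have "?\<psi> \<zero>\<^bsub>Rat_semifield \<Gamma>\<^esub> = \<zero>\<^bsub>Rat_semifield \<Gamma>\<^esub>"
    using minf rescale_minf[OF c] by (simp add: Rat_semifield_def)
  moreover have "bij_betw ?\<psi> (Rat \<Gamma>) (Rat \<Gamma>)"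
  proof (rule bij_betw_byWitness[where f' = "rescale (1 / c)"])
    show "\<forall>f\<in>Rat \<Gamma>. rescale (1 / c) (?\<psi> f) = f" using rescale_inverse[OF c] by simp
    show "\<forall>f\<in>Rat \<Gamma>. ?\<psi> (rescale (1 / c) f) = f"
      using rescale_inverse[of "1 / c"] rescale_Rat[of "1 / c"] c by simp
    show "?\<psi> ` Rat \<Gamma> \<subseteq> Rat \<Gamma>" using rescale_Rat[OF c] by auto
    show "rescale (1 / c) ` Rat \<Gamma> \<subseteq> Rat \<Gamma>" using rescale_Rat[of "1 / c"] c by auto
  qed
  ultimately show ?thesis by (simp add: Aut_semiring_def Rat_semifield_def)
qed

lemma star_automorphisms: "Aut_T \<Gamma> \<noteq> Aut_semiring (Rat_semifield \<Gamma>)"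
proof
  assume eq: "Aut_T \<Gamma> = Aut_semiring (Rat_semifield \<Gamma>)"
  have "restrict (rescale 2) (Rat \<Gamma>) \<in> Aut_T \<Gamma>" unfolding eq by (rule rescale_automorphism) simp
  then have "\<forall>t. t \<noteq> \<infinity> \<longrightarrow> restrict (rescale 2) (Rat \<Gamma>) (\<lambda>_. t) = (\<lambda>_. t)"
    unfolding Aut_T_def mem_Collect_eq by (rule conjunct2)
  from this[rule_format, of "ereal 1"]
  have "restrict (rescale 2) (Rat \<Gamma>) (\<lambda>_. ereal 1) = (\<lambda>_. ereal 1)" by simp
  moreover have "(\<lambda>_. ereal 1) \<in> Rat \<Gamma>" using Rfin_const[of 1] by (simp add: Rat_eq)
  ultimately have "rescale 2 (\<lambda>_. ereal 1) = (\<lambda>_. ereal 1)" by simp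
  then have "rescale 2 (\<lambda>_. ereal 1) y = ereal 1" for y by (rule fun_cong)
  then show False by (simp add: rescale_def)
qed

end

section \<open>Curves with an automorphism that moves constants\<close>

theorem corollary3p12:
  fixes \<Gamma> :: "'p::topological_space curve"
  assumes "tropical_curve \<Gamma>"
    and not_a_point: "\<exists>x y :: 'p. x \<noteq> y"
  shows "(\<exists>G l. model \<Gamma> G l \<and> l ` edges G = {\<infinity>}) \<longleftrightarrow>
         Aut_T \<Gamma> \<noteq> Aut_semiring (Rat_semifield \<Gamma>)"
proof
  assume "\<exists>G l. model \<Gamma> G l \<and> l ` edges G = {\<infinity>}"
  then obtain G l \<iota> where m: "model_via \<Gamma> G l \<iota>" and inf: "l ` edges G = {\<infinity>}" by (auto simp: model_def)
  interpret star \<Gamma> G l \<iota>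
    by (intro star.intro tmodel.intro star_axioms.intro m not_a_point) (use inf in blast)
  show "Aut_T \<Gamma> \<noteq> Aut_semiring (Rat_semifield \<Gamma>)" by (rule star_automorphisms)
next
  assume "Aut_T \<Gamma> \<noteq> Aut_semiring (Rat_semifield \<Gamma>)"
  moreover have "Aut_T \<Gamma> \<subseteq> Aut_semiring (Rat_semifield \<Gamma>)" by (auto simp: Aut_T_def)
  ultimately obtain \<psi> where \<psi>: "\<psi> \<in> Aut_semiring (Rat_semifield \<Gamma>)" "\<psi> \<notin> Aut_T \<Gamma>" by blast
  obtain G0 :: "('p, nat) mgraph" and l0 where "model \<Gamma> G0 l0"
    using assms(1) by (auto simp: tropical_curve_def)
  then have "\<exists>p. model \<Gamma> (fst p) (snd p)" by (intro exI[of _ "(G0, l0)"]) simp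
  then obtain p where p: "model \<Gamma> (fst p) (snd p)"
    "\<And>q. model \<Gamma> (fst q) (snd q) \<Longrightarrow> card (edges (fst p)) \<le> card (edges (fst q))"
    using ex_has_least_nat[of "\<lambda>p. model \<Gamma> (fst p) (snd p)" _ "\<lambda>p. card (edges (fst p))"] by blast
  obtain G l where Gl: "p = (G, l)" by (cases p)
  then obtain \<iota> where m: "model_via \<Gamma> G l \<iota>" using p(1) by (auto simp: model_def)
  have minimal: "card (edges G) \<le> card (edges G')" if "model \<Gamma> G' l'" for G' l'
    using p(2)[of "(G', l')"] that Gl by simp
  interpret semiring_aut \<Gamma> G l \<iota> \<psi>
    by (intro semiring_aut.intro tmodel.intro semiring_aut_axioms.intro m not_a_point \<psi>(1))
  obtain c \<Psi> where c: "scaling \<Gamma> c \<Psi>" "\<And>t. \<psi> (\<lambda>_. ereal t) = (\<lambda>_. ereal (c * t))"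
    by (rule scaling_exists) (rule that)
  have "c \<noteq> 1"
  proof
    assume "c = 1"
    have "\<psi> (\<lambda>_. t) = (\<lambda>_. t)" if "t \<noteq> \<infinity>" for t
      using that c(2) \<open>c = 1\<close> \<psi>_zero by (cases t) auto
    then show False using \<psi> by (auto simp: Aut_T_def)
  qed
  interpret scaled \<Gamma> G l \<iota> c \<Psi>
    by (intro scaled.intro tmodel_axioms scaled_axioms.intro c(1))
  have "l ` edges G = {\<infinity>}" by (rule minimal_model_star[OF minimal \<open>c \<noteq> 1\<close>])
  moreover have "model \<Gamma> G l" using m by (auto simp: model_def)
  ultimately show "\<exists>G l. model \<Gamma> G l \<and> l ` edges G = {\<infinity>}" by blast
qed

end
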